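(* The variety $\Sigma(2,3,2,5)$ has codimension $1$ in $G(2,S_3)$. (Here $N_1=N_2=16$.)
   Context: For positive integers $n,d,r,s$: let $V$ be a $\mathbb C$-vector space of dimension $n+1$ and $S_d=\mathrm{Sym}^d V$ (degree $d$ forms in $x_0,\dots,x_n$); assume $r\le s\le\dim S_d$. $G(r,S_d)$ is the Grassmannian of $r$-dimensional subspaces of $S_d$. $U_s\subseteq \mathrm{Sym}^s(\mathbb P S_1)$ is the open set of unordered $s$-tuples $\{Q_1,\dots,Q_s\}$ of linear forms (up to scalars) with $Q_1^d,\dots,Q_s^d$ linearly independent over $\mathbb C$. $\Sigma=\Sigma(n,d,r,s)\subseteq G(r,S_d)$ is the (constructible) set of all $\Lambda$ such that $\Lambda\subseteq \mathrm{span}(Q_1^d,\dots,Q_s^d)$ for some $\{Q_1,\dots,Q_s\}\in U_s$. Also $N_1=sn+r(s-r)$ and $N_2=\dim G(r,S_d)=r\left(\binom{n+d}{d}-r\right)$. In the present statement $(n,d,r,s)=(2,3,2,5)$. *)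

theory Defs
  imports
    "HOL-Analysis.Function_Topology"
    "HOL-Library.Poly_Mapping"
    "HOL-Library.Extended_Nat"
    "Jordan_Normal_Form.Determinant"
begin

section \<open>Forms\<close>

text \<open>
  A polynomial over the complex numbers in variables \<open>'x\<close> is a finitely supported function from
  monomials (exponent vectors \<open>'x \<Rightarrow>\<^sub>0 nat\<close>) to coefficients; the ring structure is the
  convolution product of \<^theory>\<open>HOL-Library.Poly_Mapping\<close>.
\<close>

type_synonym 'x cpoly = "('x \<Rightarrow>\<^sub>0 nat) \<Rightarrow>\<^sub>0 complex"

definition cscale :: "complex \<Rightarrow> 'x cpoly \<Rightarrow> 'x cpoly" where
  "cscale c p = Poly_Mapping.map (\<lambda>a. c * a) p"

lemma lookup_cscale: "Poly_Mapping.lookup (cscale c p) m = c * Poly_Mapping.lookup p m"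
  unfolding cscale_def by transfer (simp add: when_def)

global_interpretation cpoly: vector_space "cscale :: complex \<Rightarrow> 'x cpoly \<Rightarrow> 'x cpoly"
  by unfold_locales
    (auto intro!: poly_mapping_eqI simp: lookup_cscale lookup_add algebra_simps)

definition monomials :: "'x set \<Rightarrow> nat \<Rightarrow> ('x \<Rightarrow>\<^sub>0 nat) set" where
  "monomials X d =
     {m. Poly_Mapping.keys m \<subseteq> X \<and>
         (\<Sum>x\<in>Poly_Mapping.keys m. Poly_Mapping.lookup m x) = d}"

definition forms :: "'x set \<Rightarrow> nat \<Rightarrow> 'x cpoly set" where
  "forms X d = {p. Poly_Mapping.keys p \<subseteq> monomials X d}"

definition peval :: "('x \<Rightarrow> complex) \<Rightarrow> 'x cpoly \<Rightarrow> complex" where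
  "peval \<alpha> p =
     (\<Sum>m\<in>Poly_Mapping.keys p. Poly_Mapping.lookup p m *
        (\<Prod>x\<in>Poly_Mapping.keys m. \<alpha> x ^ Poly_Mapping.lookup m x))"

text \<open>\<open>S n d\<close> is the space of degree \<open>d\<close> forms in \<open>x\<^sub>0, \<dots>, x\<^sub>n\<close>.\<close>

definition S :: "nat \<Rightarrow> nat \<Rightarrow> nat cpoly set" where
  "S n d = forms {..n} d"


section \<open>The Grassmannian and its Zariski topology\<close>

definition Gr :: "nat \<Rightarrow> 'x cpoly set \<Rightarrow> 'x cpoly set set" where
  "Gr r W = {\<Lambda>. cpoly.subspace \<Lambda> \<and> \<Lambda> \<subseteq> W \<and> cpoly.dim \<Lambda> = r}"

definition ordered_basis :: "'x cpoly list \<Rightarrow> 'x cpoly set \<Rightarrow> bool" where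
  "ordered_basis vs \<Lambda> \<longleftrightarrow>
     distinct vs \<and> cpoly.independent (set vs) \<and> cpoly.span (set vs) = \<Lambda>"

text \<open>
  The Pluecker coordinates of a subspace are the maximal minors of the matrix of coefficients of a
  basis. They are indexed by arbitrary length \<open>r\<close> lists of degree \<open>d\<close> monomials; lists with
  repetitions give the coordinate \<open>0\<close> and permuted lists the same coordinate up to sign, so this
  redundancy does not affect the induced topology.
\<close>

definition pluecker_index :: "nat \<Rightarrow> nat \<Rightarrow> nat \<Rightarrow> (nat \<Rightarrow>\<^sub>0 nat) list set" where
  "pluecker_index n d r = {I. length I = r \<and> set I \<subseteq> monomials {..n} d}"

definition pluecker :: "nat cpoly list \<Rightarrow> (nat \<Rightarrow>\<^sub>0 nat) list \<Rightarrow> complex" where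
  "pluecker vs I =
     Determinant.det
       (Matrix.mat (length vs) (length vs) (\<lambda>(i, j). Poly_Mapping.lookup (vs ! i) (I ! j)))"

text \<open>
  The standard open set of \<open>G(r, S\<^sub>d)\<close> where a form \<open>F\<close> in the Pluecker coordinates does not
  vanish. Another choice of basis rescales all coordinates by a common nonzero factor, so for
  homogeneous \<open>F\<close> some basis may equally be replaced by every basis.
\<close>

definition nonvanishing ::
    "nat \<Rightarrow> nat \<Rightarrow> nat \<Rightarrow> (nat \<Rightarrow>\<^sub>0 nat) list cpoly \<Rightarrow> nat cpoly set set" where
  "nonvanishing n d r F =
     {\<Lambda> \<in> Gr r (S n d). \<exists>vs. ordered_basis vs \<Lambda> \<and> peval (pluecker vs) F \<noteq> 0}"

text \<open>
  The standard open sets are closed under binary intersection (multiply the forms) and cover the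
  Grassmannian (take \<open>F = 1\<close>), so they are a base of the generated topology: its closed sets are
  the common zero loci of families of homogeneous polynomials in the Pluecker coordinates.
\<close>

definition zariski_Gr :: "nat \<Rightarrow> nat \<Rightarrow> nat \<Rightarrow> nat cpoly set topology" where
  "zariski_Gr n d r =
     topology_generated_by
       {nonvanishing n d r F | F e. F \<in> forms (pluecker_index n d r) e}"


section \<open>Codimension\<close>

definition irreducible_closed :: "'a topology \<Rightarrow> 'a set \<Rightarrow> bool" where
  "irreducible_closed X Z \<longleftrightarrow> closedin X Z \<and> Z \<noteq> {} \<and>
     (\<forall>A B. closedin X A \<longrightarrow> closedin X B \<longrightarrow> Z = A \<union> B \<longrightarrow> Z = A \<or> Z = B)"

text \<open>
  The codimension of an irreducible closed \<open>Z\<close> is the supremum of the lengths of chains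
  \<open>Z = C 0 \<subset> C 1 \<subset> \<dots> \<subset> C k\<close> of irreducible closed sets. For an arbitrary subset
  \<open>Y\<close> it is the infimum over the irreducible closed subsets of the closure of \<open>Y\<close>.
\<close>

definition codim_irreducible :: "'a topology \<Rightarrow> 'a set \<Rightarrow> enat" where
  "codim_irreducible X Z =
     (SUP k \<in> {k. \<exists>C. C 0 = Z \<and> (\<forall>i\<le>k. irreducible_closed X (C i)) \<and>
                      (\<forall>i<k. C i \<subset> C (Suc i))}. enat k)"

definition codimension :: "'a topology \<Rightarrow> 'a set \<Rightarrow> enat" where
  "codimension X Y =
     (INF Z \<in> {Z. irreducible_closed X Z \<and> Z \<subseteq> X closure_of Y}. codim_irreducible X Z)"


section \<open>The variety of subspaces spanned by powers\<close>

text \<open>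
  An element of \<open>U\<^sub>s\<close> is an unordered \<open>s\<close>-tuple of points of the projective space of linear
  forms; it is given here by a set of representatives. Independence of the powers, as a family,
  makes the representatives nonzero and pairwise non-proportional (\<open>d \<ge> 1\<close>), so the points are
  distinct and a set suffices; neither this condition nor the span of the powers depends on the
  choice of representatives.
\<close>

definition U :: "nat \<Rightarrow> nat \<Rightarrow> nat \<Rightarrow> nat cpoly set set" where
  "U n d s = {Q. Q \<subseteq> S n 1 \<and> finite Q \<and> card Q = s \<and>
     inj_on (\<lambda>q. q ^ d) Q \<and> cpoly.independent ((\<lambda>q. q ^ d) ` Q)}"

definition Sigma_var :: "nat \<Rightarrow> nat \<Rightarrow> nat \<Rightarrow> nat \<Rightarrow> nat cpoly set set" where
  "Sigma_var n d r s =
     {\<Lambda> \<in> Gr r (S n d). \<exists>Q \<in> U n d s. \<Lambda> \<subseteq> cpoly.span ((\<lambda>q. q ^ d) ` Q)}"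

definition N1 :: "nat \<Rightarrow> nat \<Rightarrow> nat \<Rightarrow> nat" where
  "N1 n r s = s * n + r * (s - r)"

text \<open>The dimension of \<open>G(r, S\<^sub>d)\<close>, as \<open>dim S\<^sub>d = (n + d choose d)\<close>.\<close>

definition N2 :: "nat \<Rightarrow> nat \<Rightarrow> nat \<Rightarrow> nat" where
  "N2 n d r = r * (((n + d) choose d) - r)"

end

(*
  A pencil <f, g> of ternary cubics inside the span of five cubes of linear forms is apolar to the
  conic through the five corresponding points, so the 6 x 6 matrix of the map that sends a dual
  conic q to (q.f, q.g) is singular on the variety. Its determinant is linear in the coefficient
  a of x^3 in f, say D = A a + B, and vanishes on the closure of the variety, which is therefore not
  the whole Grassmannian.

  Conversely, projecting the variety along that coefficient is dominant. Given the other
  coefficients, solve D = 0; the kernel is spanned by a conic q, generically smooth. In coordinates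
  adapted to q, the cubics apolar to q are the Hankel forms sum a_(i+j+k) l_i l_j l_k. Two sequences
  a, b of length 7 generically satisfy a common monic linear recurrence of order 5, hence both are
  combinations of the same five geometric progressions t_s^m whenever the roots t_s are distinct,
  and the corresponding Hankel forms are combinations of the cubes of sum t_s^i l_i.

  Hence every polynomial function vanishing on the variety is, up to powers of A, divisible by D
  (pseudo-division), which makes the closure of the part of the variety with A nonzero irreducible
  and maximal among the irreducible closed proper subsets.
*)

theory Submission
  imports Defs "HOL-Computational_Algebra.Fundamental_Theorem_Algebra"
begin

section \<open>Polynomial functions\<close>

text \<open>Parameter counting predicts a dense variety, as \<open>N1\<close> and \<open>N2\<close>
  agree; the defect arises because any five points of the plane lie on a conic. Codimension is
  defined by chains of irreducible closed sets, so counting the parameters of a family proves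
  nothing by itself. Everything is therefore turned into identities between functions on an affine
  chart, the only algebra being the absence of zero divisors and division by a function linear in
  one variable. The coefficient of x^3 is singled out because it occurs in a single entry of the
  matrix: the cofactors along the first row give both A and the kernel conic, and none of them
  involves it. Irreducibility is shown neither for D nor for the closure of the whole variety. As
  the codimension is an infimum, a lower bound for all irreducible closed subsets and one subset
  attaining it suffice. The Hankel families do not respect the normalisation of the chart, so
  functions on the chart are first extended to all pairs of cubics, with the dependent pairs as
  additional zeros. Each genericity condition is witnessed by one explicit point.\<close>

inductive polyfun :: "'i set \<Rightarrow> (('i \<Rightarrow> complex) \<Rightarrow> complex) \<Rightarrow> bool" for I where
  polyfun_const [intro, simp]: "polyfun I (\<lambda>_. c)"
| polyfun_var: "i \<in> I \<Longrightarrow> polyfun I (\<lambda>x. x i)"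
| polyfun_add: "polyfun I P \<Longrightarrow> polyfun I Q \<Longrightarrow> polyfun I (\<lambda>x. P x + Q x)"
| polyfun_mult: "polyfun I P \<Longrightarrow> polyfun I Q \<Longrightarrow> polyfun I (\<lambda>x. P x * Q x)"

lemma polyfun_cmult: "polyfun I P \<Longrightarrow> polyfun I (\<lambda>x. c * P x)"
  by (intro polyfun_mult polyfun_const)

lemma polyfun_uminus: "polyfun I P \<Longrightarrow> polyfun I (\<lambda>x. - P x)"
  using polyfun_cmult[of I P "-1"] by simp

lemma polyfun_diff: "polyfun I P \<Longrightarrow> polyfun I Q \<Longrightarrow> polyfun I (\<lambda>x. P x - Q x)"
  using polyfun_add[OF _ polyfun_uminus, of I P Q] by simp

lemma polyfun_divide_const: "polyfun I P \<Longrightarrow> polyfun I (\<lambda>x. P x / c)"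
  using polyfun_cmult[of I P "inverse c"] by (simp add: field_simps)

lemma polyfun_power: "polyfun I P \<Longrightarrow> polyfun I (\<lambda>x. P x ^ k)"
  by (induction k) (auto intro: polyfun_mult)

lemma polyfun_sum: "(\<And>a. a \<in> A \<Longrightarrow> polyfun I (P a)) \<Longrightarrow> polyfun I (\<lambda>x. \<Sum>a\<in>A. P a x)"
  by (induction A rule: infinite_finite_induct) (auto intro: polyfun_add)

lemma polyfun_prod: "(\<And>a. a \<in> A \<Longrightarrow> polyfun I (P a)) \<Longrightarrow> polyfun I (\<lambda>x. \<Prod>a\<in>A. P a x)"
  by (induction A rule: infinite_finite_induct) (auto intro: polyfun_mult)

lemmas polyfun_intros = polyfun_const polyfun_var polyfun_add polyfun_mult polyfun_uminus
  polyfun_diff polyfun_divide_const polyfun_power polyfun_sum polyfun_prod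

lemma polyfun_det:
  assumes "\<And>x. M x \<in> carrier_mat n n"
    and "\<And>i j. i < n \<Longrightarrow> j < n \<Longrightarrow> polyfun I (\<lambda>x. M x $$ (i, j))"
  shows "polyfun I (\<lambda>x. Determinant.det (M x))"
proof -
  have "polyfun I (\<lambda>x. \<Sum>p\<in>{p. p permutes {0..<n}}. signof p * (\<Prod>i = 0..<n. M x $$ (i, p i)))"
    by (intro polyfun_intros assms(2)) (auto dest: permutes_in_image)
  then show ?thesis
    by (simp add: Determinant.det_def'[OF assms(1)])
qed

lemma polyfun_compose:
  assumes "polyfun I P" "\<And>i. i \<in> I \<Longrightarrow> polyfun J (\<lambda>x. \<phi> x i)"
  shows "polyfun J (\<lambda>x. P (\<phi> x))"
  using assms(1) by induction (auto intro: polyfun_intros assms(2))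

lemma polyfun_cong:
  assumes "polyfun I P" "\<And>i. i \<in> I \<Longrightarrow> x i = y i"
  shows "P x = P y"
  using assms(1) by induction (auto simp: assms(2))

section \<open>Restriction to lines and the absence of zero divisors\<close>

lemma polyfun_on_line:
  assumes "polyfun I P"
  shows "\<exists>p. \<forall>t. P (\<lambda>i. x i + t * (y i - x i)) = poly p t"
  using assms
proof induction
  case (polyfun_const c)
  show ?case by (rule exI[of _ "[:c:]"]) simp
next
  case (polyfun_var i)
  show ?case by (rule exI[of _ "[:x i, y i - x i:]"]) simp
next
  case (polyfun_add P Q)
  then obtain p q where "\<forall>t. P (\<lambda>i. x i + t * (y i - x i)) = poly p t"
      "\<forall>t. Q (\<lambda>i. x i + t * (y i - x i)) = poly q t" by blast
  then show ?case by (intro exI[of _ "p + q"]) simp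
next
  case (polyfun_mult P Q)
  then obtain p q where "\<forall>t. P (\<lambda>i. x i + t * (y i - x i)) = poly p t"
      "\<forall>t. Q (\<lambda>i. x i + t * (y i - x i)) = poly q t" by blast
  then show ?case by (intro exI[of _ "p * q"]) simp
qed

text \<open>Affine subspaces, described by the lines through two of their points, which is all that
  restriction to lines uses. The cases of interest are the whole space and
  \<open>chart_points\<close>.\<close>

definition line_closed :: "('i \<Rightarrow> complex) set \<Rightarrow> bool" where
  "line_closed N \<longleftrightarrow> (\<forall>x\<in>N. \<forall>y\<in>N. \<forall>t. (\<lambda>i. x i + t * (y i - x i)) \<in> N)"

lemma line_closed_UNIV [simp]: "line_closed UNIV"
  by (simp add: line_closed_def)

text \<open>On the line from \<open>x\<close> to \<open>y\<close> both functions become univariate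
  polynomials. Their product is zero everywhere and the first is nonzero at parameter 0, so the
  second is the zero polynomial; its value at parameter 1 is \<open>Q y\<close>.\<close>

lemma polyfun_integral:
  assumes N: "line_closed N" and P: "polyfun I P" and Q: "polyfun I Q"
    and PQ: "\<And>x. x \<in> N \<Longrightarrow> P x * Q x = 0"
    and x: "x \<in> N" "P x \<noteq> 0" and y: "y \<in> N"
  shows "Q y = 0"
proof -
  let ?l = "\<lambda>t i. x i + t * (y i - x i)"
  obtain p q where p: "\<forall>t. P (?l t) = poly p t" and q: "\<forall>t. Q (?l t) = poly q t"
    using polyfun_on_line[OF P] polyfun_on_line[OF Q] by blast
  have "poly (p * q) t = 0" for t
    using PQ[of "?l t"] N x(1) y p q unfolding line_closed_def by (simp del: mult_eq_0_iff)
  then have "p * q = 0" using poly_all_0_iff_0 by blast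
  moreover have "poly p 0 \<noteq> 0" using p[rule_format, of 0] x(2) by simp
  then have "p \<noteq> 0" by auto
  ultimately have "q = 0" by simp
  then show ?thesis using q[rule_format, of 1] by simp
qed

subsection \<open>Division by a function that is linear in one variable\<close>

definition indep_of :: "'i \<Rightarrow> (('i \<Rightarrow> complex) \<Rightarrow> complex) \<Rightarrow> bool" where
  "indep_of a P \<longleftrightarrow> (\<forall>x c. P (x(a := c)) = P x)"

lemma indep_ofD: "indep_of a P \<Longrightarrow> P (x(a := c)) = P x"
  by (simp add: indep_of_def)

text \<open>Degree at most \<open>n\<close> in the variable \<open>a\<close>. Being only an upper
  bound, it is insensitive to cancellation of leading coefficients.\<close>

definition has_degree :: "'i set \<Rightarrow> 'i \<Rightarrow> nat \<Rightarrow> (('i \<Rightarrow> complex) \<Rightarrow> complex) \<Rightarrow> bool" where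
  "has_degree I a n P \<longleftrightarrow> (\<exists>c. (\<forall>k. polyfun I (c k) \<and> indep_of a (c k)) \<and>
     (\<forall>x. P x = (\<Sum>k\<le>n. c k x * x a ^ k)))"

lemma has_degree_mono:
  assumes "has_degree I a n P" "n \<le> m"
  shows "has_degree I a m P"
proof -
  obtain c where c: "\<And>k. polyfun I (c k)" "\<And>k. indep_of a (c k)"
     "\<And>x. P x = (\<Sum>k\<le>n. c k x * x a ^ k)"
    using assms(1) unfolding has_degree_def by blast
  let ?c = "\<lambda>k. if k \<le> n then c k else (\<lambda>_. 0)"
  have "P x = (\<Sum>k\<le>m. ?c k x * x a ^ k)" for x
    unfolding c(3) by (rule sum.mono_neutral_cong_left) (use assms(2) in auto)
  moreover have "polyfun I (?c k) \<and> indep_of a (?c k)" for k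
    using c by (auto simp: indep_of_def)
  ultimately show ?thesis unfolding has_degree_def by (intro exI[of _ ?c]) auto
qed

lemma has_degree_add:
  assumes "has_degree I a n P" "has_degree I a n Q"
  shows "has_degree I a n (\<lambda>x. P x + Q x)"
proof -
  obtain c where "\<And>k. polyfun I (c k) \<and> indep_of a (c k)" "\<And>x. P x = (\<Sum>k\<le>n. c k x * x a ^ k)"
    using assms(1) unfolding has_degree_def by metis
  moreover obtain d where "\<And>k. polyfun I (d k) \<and> indep_of a (d k)"
      "\<And>x. Q x = (\<Sum>k\<le>n. d k x * x a ^ k)"
    using assms(2) unfolding has_degree_def by metis
  ultimately show ?thesis unfolding has_degree_def
    by (intro exI[of _ "\<lambda>k x. c k x + d k x"])
       (simp add: indep_of_def sum.distrib distrib_right polyfun_add)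
qed

lemma has_degree_cmult:
  assumes "has_degree I a n P" "polyfun I b" "indep_of a b"
  shows "has_degree I a n (\<lambda>x. b x * P x)"
proof -
  obtain c where "\<And>k. polyfun I (c k) \<and> indep_of a (c k)" "\<And>x. P x = (\<Sum>k\<le>n. c k x * x a ^ k)"
    using assms unfolding has_degree_def by metis
  with assms show ?thesis unfolding has_degree_def
    by (intro exI[of _ "\<lambda>k x. b x * c k x"])
       (simp add: indep_of_def sum_distrib_left mult.assoc polyfun_mult)
qed

lemma has_degree_times_var:
  assumes "has_degree I a n P"
  shows "has_degree I a (Suc n) (\<lambda>x. x a * P x)"
proof -
  obtain c where c: "\<And>k. polyfun I (c k) \<and> indep_of a (c k)"
      "\<And>x. P x = (\<Sum>k\<le>n. c k x * x a ^ k)"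
    using assms unfolding has_degree_def by metis
  let ?c = "\<lambda>k. case k of 0 \<Rightarrow> (\<lambda>_. 0) | Suc k \<Rightarrow> c k"
  have "x a * P x = (\<Sum>k\<le>Suc n. ?c k x * x a ^ k)" for x
    unfolding c(2) sum.atMost_Suc_shift by (simp add: sum_distrib_left algebra_simps)
  moreover have "polyfun I (?c k) \<and> indep_of a (?c k)" for k
    using c(1) by (auto simp: indep_of_def split: nat.split)
  ultimately show ?thesis unfolding has_degree_def by (intro exI[of _ ?c]) auto
qed

lemma has_degree_0: "polyfun I P \<Longrightarrow> indep_of a P \<Longrightarrow> has_degree I a n P"
  by (rule has_degree_mono[of _ _ 0], unfold has_degree_def)
     (auto intro!: exI[of _ "\<lambda>_. P"])

lemma has_degree_sum:
  "(\<And>k. k \<in> K \<Longrightarrow> has_degree I a n (P k)) \<Longrightarrow> has_degree I a n (\<lambda>x. \<Sum>k\<in>K. P k x)"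
  by (induction K rule: infinite_finite_induct)
     (simp_all add: has_degree_add has_degree_0 indep_of_def)

lemma has_degree_power:
  assumes "polyfun I b" "indep_of a b"
  shows "has_degree I a k (\<lambda>x. (b x * x a) ^ k)"
proof (induction k)
  case 0
  then show ?case by (simp add: has_degree_0 indep_of_def)
next
  case (Suc k)
  have "has_degree I a (Suc k) (\<lambda>x. b x * (x a * (b x * x a) ^ k))"
    by (intro has_degree_cmult has_degree_times_var Suc assms)
  then show ?case by (simp add: mult.assoc)
qed

lemma polyfun_has_degree:
  assumes "polyfun I P"
  shows "\<exists>n. has_degree I a n P"
  using assms
proof induction
  case (polyfun_const c)
  show ?case by (rule exI[of _ 0], rule has_degree_0) (simp_all add: indep_of_def)
next
  case (polyfun_var i)
  show ?case
  proof (cases "i = a")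
    case True
    then show ?thesis
      using has_degree_power[of I "\<lambda>_. 1" a 1] by (auto simp: indep_of_def)
  next
    case False
    then show ?thesis
      using polyfun_var by (intro exI has_degree_0 polyfun.polyfun_var) (auto simp: indep_of_def)
  qed
next
  case (polyfun_add P Q)
  then obtain n m where "has_degree I a n P" "has_degree I a m Q" by blast
  from has_degree_add[OF has_degree_mono[OF this(1) max.cobounded1[of n m]]
      has_degree_mono[OF this(2) max.cobounded2[of m n]]] show ?case by blast
next
  case (polyfun_mult P Q)
  then obtain n m where P: "has_degree I a n P" and Q: "has_degree I a m Q" by blast
  then obtain c where c: "\<And>k. polyfun I (c k) \<and> indep_of a (c k)"
      "\<And>x. P x = (\<Sum>k\<le>n. c k x * x a ^ k)"
    unfolding has_degree_def by metis
  have *: "has_degree I a (m + k) (\<lambda>x. x a ^ k * Q x)" for k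
  proof (induction k)
    case (Suc k)
    then show ?case using has_degree_times_var[OF Suc] by (simp add: mult.assoc)
  qed (simp add: Q)
  have "has_degree I a (m + n) (\<lambda>x. \<Sum>k\<le>n. c k x * (x a ^ k * Q x))"
    using c(1) by (intro has_degree_sum has_degree_cmult has_degree_mono[OF *]) auto
  moreover have "(\<lambda>x. \<Sum>k\<le>n. c k x * (x a ^ k * Q x)) = (\<lambda>x. P x * Q x)"
    by (simp add: c(2) sum_distrib_right mult.assoc)
  ultimately show ?case by auto
qed

lemma has_degree_polyfun:
  assumes "has_degree I a n P" "a \<in> I"
  shows "polyfun I P"
proof -
  obtain c where c: "\<And>k. polyfun I (c k)" "\<And>x. P x = (\<Sum>k\<le>n. c k x * x a ^ k)"
    using assms unfolding has_degree_def by metis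
  have "polyfun I (\<lambda>x. \<Sum>k\<le>n. c k x * x a ^ k)"
    by (intro polyfun_intros c assms)
  then show ?thesis by (simp add: c(2)[symmetric])
qed

lemma has_degree_0_indep: "has_degree I a 0 P \<Longrightarrow> indep_of a P"
  unfolding has_degree_def by (auto simp: indep_of_def)

text \<open>The drop to \<open>n - 1\<close> drives a later minimality argument. The remainder is
  free of \<open>a\<close>, so that dominance of the projection along \<open>a\<close> can force it
  to vanish. For \<open>n = 0\<close> the bound does not drop, and that case is treated
  apart.\<close>

lemma pseudo_division:
  assumes P: "has_degree I a n P"
    and A: "polyfun I A" "indep_of a A" and B: "polyfun I B" "indep_of a B"
  obtains Q R where "has_degree I a (n - 1) Q" "polyfun I R" "indep_of a R"
    "\<And>x. A x ^ n * P x = (A x * x a + B x) * Q x + R x"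
proof -
  obtain c where c: "\<And>k. polyfun I (c k)" "\<And>k. indep_of a (c k)"
      "\<And>x. P x = (\<Sum>k\<le>n. c k x * x a ^ k)"
    using P unfolding has_degree_def by metis
  \<comment> \<open>replace \<open>x a\<close> by \<open>- B x / A x\<close> and factor \<open>(A x * x a)\<^sup>k - (- B x)\<^sup>k\<close>\<close>
  define R where "R = (\<lambda>x. \<Sum>k\<le>n. c k x * A x ^ (n - k) * (- B x) ^ k)"
  define Q where "Q = (\<lambda>x. \<Sum>k\<le>n. (c k x * A x ^ (n - k)) *
    (\<Sum>j<k. (- B x) ^ (k - Suc j) * (A x * x a) ^ j))"
  have iA: "indep_of a (\<lambda>x. c k x * A x ^ m)" for k m
    using A(2) c(2) by (simp add: indep_of_def)
  show thesis
  proof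
    show "has_degree I a (n - 1) Q"
      unfolding Q_def
    proof (intro has_degree_sum has_degree_cmult)
      fix k j assume kj: "k \<in> {..n}" "j \<in> {..<k}"
      then have "j \<le> n - 1" by auto
      from has_degree_mono[OF has_degree_power[OF A] this]
      show "has_degree I a (n - 1) (\<lambda>x. (A x * x a) ^ j)" .
    qed (use A B c iA in \<open>auto intro!: polyfun_intros simp: indep_of_def\<close>)
    show "polyfun I R" unfolding R_def by (intro polyfun_intros A B c)
    show "indep_of a R" unfolding R_def using A B c by (simp add: indep_of_def)
    fix x
    have "A x ^ n * P x - R x = (\<Sum>k\<le>n. c k x * A x ^ (n - k) * ((A x * x a) ^ k - (- B x) ^ k))"
      unfolding R_def c(3) sum_distrib_left sum_subtractf[symmetric]
    proof (rule sum.cong)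
      fix k assume "k \<in> {..n}"
      then have "A x ^ n = A x ^ (n - k) * A x ^ k" by (simp flip: power_add)
      then show "A x ^ n * (c k x * x a ^ k) - c k x * A x ^ (n - k) * (- B x) ^ k =
         c k x * A x ^ (n - k) * ((A x * x a) ^ k - (- B x) ^ k)"
        by (simp add: algebra_simps power_mult_distrib)
    qed simp
    also have "\<dots> = (A x * x a + B x) * Q x"
      unfolding Q_def
      by (subst sum_distrib_left, rule sum.cong) (simp_all add: power_diff_sumr2[of "A x * x a"] ac_simps)
    finally show "A x ^ n * P x = (A x * x a + B x) * Q x + R x"
      by (simp add: algebra_simps)
  qed
qed

section \<open>Evaluation of polynomials\<close>

definition monom_eval :: "('x \<Rightarrow> complex) \<Rightarrow> ('x \<Rightarrow>\<^sub>0 nat) \<Rightarrow> complex" where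
  "monom_eval \<alpha> m = (\<Prod>x\<in>Poly_Mapping.keys m. \<alpha> x ^ Poly_Mapping.lookup m x)"

lemma monom_eval_superset:
  assumes "finite K" "Poly_Mapping.keys m \<subseteq> K"
  shows "monom_eval \<alpha> m = (\<Prod>x\<in>K. \<alpha> x ^ Poly_Mapping.lookup m x)"
  unfolding monom_eval_def
  by (rule prod.mono_neutral_left) (use assms in \<open>auto simp: in_keys_iff\<close>)

lemma monom_eval_add: "monom_eval \<alpha> (m + m') = monom_eval \<alpha> m * monom_eval \<alpha> m'"
proof -
  let ?K = "Poly_Mapping.keys m \<union> Poly_Mapping.keys m'"
  have "Poly_Mapping.keys (m + m') \<subseteq> ?K" by (rule keys_add)
  then show ?thesis
    by (simp add: monom_eval_superset[of ?K] lookup_add power_add prod.distrib)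
qed

lemma monom_eval_single [simp]: "monom_eval \<alpha> (Poly_Mapping.single x k) = \<alpha> x ^ k"
  by (subst monom_eval_superset[of "{x}"]) auto

lemma peval_superset:
  assumes "finite K" "Poly_Mapping.keys p \<subseteq> K"
  shows "peval \<alpha> p = (\<Sum>m\<in>K. Poly_Mapping.lookup p m * monom_eval \<alpha> m)"
  unfolding peval_def monom_eval_def[symmetric]
  by (rule sum.mono_neutral_left) (use assms in \<open>auto simp: in_keys_iff\<close>)

lemma peval_0 [simp]: "peval \<alpha> 0 = 0"
  by (simp add: peval_def)

lemma peval_add: "peval \<alpha> (p + q) = peval \<alpha> p + peval \<alpha> q"
proof -
  let ?K = "Poly_Mapping.keys p \<union> Poly_Mapping.keys q"
  have "Poly_Mapping.keys (p + q) \<subseteq> ?K" by (rule keys_add)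
  then show ?thesis
    by (simp add: peval_superset[of ?K] lookup_add distrib_right sum.distrib)
qed

lemma peval_sum: "peval \<alpha> (\<Sum>a\<in>A. p a) = (\<Sum>a\<in>A. peval \<alpha> (p a))"
  by (induction A rule: infinite_finite_induct) (auto simp: peval_add)

lemma peval_single [simp]: "peval \<alpha> (Poly_Mapping.single m c) = c * monom_eval \<alpha> m"
  by (subst peval_superset[of "{m}"]) auto

lemma peval_cscale: "peval \<alpha> (cscale c p) = c * peval \<alpha> p"
proof -
  have "Poly_Mapping.keys (cscale c p) \<subseteq> Poly_Mapping.keys p"
    by (auto simp: in_keys_iff lookup_cscale)
  then show ?thesis
    by (simp add: peval_superset[of "Poly_Mapping.keys p"] lookup_cscale sum_distrib_left mult.assoc)
qed

lemma sum_single_lookup: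
  "(\<Sum>m\<in>Poly_Mapping.keys p. Poly_Mapping.single m (Poly_Mapping.lookup p m)) = p"
  by (rule poly_mapping_eqI) (auto simp: lookup_sum lookup_single when_def in_keys_iff)

lemma peval_mult: "peval \<alpha> (p * q) = peval \<alpha> p * peval \<alpha> q"
proof -
  have "p * q = (\<Sum>m\<in>Poly_Mapping.keys p. Poly_Mapping.single m (Poly_Mapping.lookup p m)) *
      (\<Sum>m\<in>Poly_Mapping.keys q. Poly_Mapping.single m (Poly_Mapping.lookup q m))"
    by (simp only: sum_single_lookup)
  then have "peval \<alpha> (p * q) = (\<Sum>m\<in>Poly_Mapping.keys p. \<Sum>m'\<in>Poly_Mapping.keys q.
      Poly_Mapping.lookup p m * Poly_Mapping.lookup q m' * (monom_eval \<alpha> m * monom_eval \<alpha> m'))"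
    by (simp add: sum_product peval_sum mult_single monom_eval_add)
  then show ?thesis
    unfolding peval_def monom_eval_def[symmetric] by (simp add: sum_product ac_simps)
qed

lemma peval_1 [simp]: "peval \<alpha> 1 = 1"
  using peval_single[of \<alpha> 0 1] by (simp add: monom_eval_def del: peval_single)

lemma peval_power: "peval \<alpha> (p ^ k) = peval \<alpha> p ^ k"
  by (induction k) (simp_all add: peval_mult)

subsection \<open>Homogeneous polynomials\<close>

definition total_degree :: "('x \<Rightarrow>\<^sub>0 nat) \<Rightarrow> nat" where
  "total_degree m = (\<Sum>x\<in>Poly_Mapping.keys m. Poly_Mapping.lookup m x)"

lemma total_degree_superset:
  assumes "finite K" "Poly_Mapping.keys m \<subseteq> K"
  shows "total_degree m = (\<Sum>x\<in>K. Poly_Mapping.lookup m x)"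
  unfolding total_degree_def
  by (rule sum.mono_neutral_left) (use assms in \<open>auto simp: in_keys_iff\<close>)

lemma total_degree_add: "total_degree (m + m') = total_degree m + total_degree m'"
proof -
  let ?K = "Poly_Mapping.keys m \<union> Poly_Mapping.keys m'"
  have "Poly_Mapping.keys (m + m') \<subseteq> ?K" by (rule keys_add)
  then show ?thesis
    by (simp add: total_degree_superset[of ?K] lookup_add sum.distrib)
qed

lemma monomials_iff: "m \<in> monomials X d \<longleftrightarrow> Poly_Mapping.keys m \<subseteq> X \<and> total_degree m = d"
  by (simp add: monomials_def total_degree_def)

lemma monomials_add:
  assumes "m \<in> monomials X d" "m' \<in> monomials X e"
  shows "m + m' \<in> monomials X (d + e)"
  using assms keys_add[of m m'] by (auto simp: monomials_iff total_degree_add)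

lemma finite_monomials:
  assumes "finite X"
  shows "finite (monomials X d)"
proof -
  have "Poly_Mapping.lookup ` monomials X d \<subseteq>
      {f. \<forall>x. (x \<in> X \<longrightarrow> f x \<in> {..d}) \<and> (x \<notin> X \<longrightarrow> f x = 0)}"
  proof (intro subsetI CollectI allI conjI impI, elim imageE, goal_cases)
    case (1 f x m)
    then have "(\<Sum>y\<in>X. Poly_Mapping.lookup m y) = d"
      using total_degree_superset[OF assms, of m] by (simp add: monomials_iff)
    then show ?case
      using member_le_sum[of x X "Poly_Mapping.lookup m"] assms 1 by auto
  qed (auto simp: monomials_iff subset_iff in_keys_iff)
  moreover have "finite {f. \<forall>x. (x \<in> X \<longrightarrow> f x \<in> {..d}) \<and> (x \<notin> X \<longrightarrow> f x = 0)}"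
    by (rule finite_set_of_finite_funs) (use assms in auto)
  ultimately have "finite (Poly_Mapping.lookup ` monomials X d)"
    by (rule finite_subset)
  then show ?thesis
    by (rule finite_imageD) (auto intro!: inj_onI simp: lookup_inject)
qed

lemma formsD: "p \<in> forms X d \<Longrightarrow> m \<notin> monomials X d \<Longrightarrow> Poly_Mapping.lookup p m = 0"
  by (auto simp: forms_def in_keys_iff)

lemma formsI: "(\<And>m. m \<notin> monomials X d \<Longrightarrow> Poly_Mapping.lookup p m = 0) \<Longrightarrow> p \<in> forms X d"
  by (auto simp: forms_def in_keys_iff)

lemma forms_add: "p \<in> forms X d \<Longrightarrow> q \<in> forms X d \<Longrightarrow> p + q \<in> forms X d"
  by (rule formsI) (simp add: lookup_add formsD)

lemma forms_cscale: "p \<in> forms X d \<Longrightarrow> cscale c p \<in> forms X d"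
  by (rule formsI) (simp add: lookup_cscale formsD)

lemma subspace_forms: "cpoly.subspace (forms X d)"
  by (rule cpoly.subspaceI) (auto intro: forms_add forms_cscale formsI)

lemma forms_mult:
  assumes "p \<in> forms X d" "q \<in> forms X e"
  shows "p * q \<in> forms X (d + e)"
  using assms keys_mult[of p q] unfolding forms_def by (fastforce intro: monomials_add)

lemma forms_power: "p \<in> forms X d \<Longrightarrow> p ^ k \<in> forms X (k * d)"
proof (induction k)
  case 0
  show ?case by (rule formsI) (auto simp: lookup_one when_def monomials_def)
qed (auto intro: forms_mult)

lemma forms_single: "m \<in> monomials X d \<Longrightarrow> Poly_Mapping.single m c \<in> forms X d"
  by (rule formsI) (auto simp: lookup_single when_def)

lemma single_in_monomials: "x \<in> X \<Longrightarrow> Poly_Mapping.single x 1 \<in> monomials X 1"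
  by (simp add: monomials_def)

lemma monom_eval_scale:
  "monom_eval (\<lambda>i. c * \<alpha> i) m = c ^ total_degree m * monom_eval \<alpha> m"
  by (simp add: monom_eval_def total_degree_def power_mult_distrib prod.distrib power_sum)

lemma peval_scale:
  assumes "F \<in> forms X e"
  shows "peval (\<lambda>i. c * \<alpha> i) F = c ^ e * peval \<alpha> F"
proof -
  have "total_degree m = e" if "m \<in> Poly_Mapping.keys F" for m
    using assms that by (auto simp: forms_def monomials_iff)
  then show ?thesis
    by (simp add: peval_def monom_eval_scale sum_distrib_left flip: monom_eval_def)
       (simp add: ac_simps)
qed

lemma peval_cong:
  assumes "F \<in> forms X e" "\<And>x. x \<in> X \<Longrightarrow> \<alpha> x = \<beta> x"
  shows "peval \<alpha> F = peval \<beta> F"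
proof -
  have "monom_eval \<alpha> m = monom_eval \<beta> m" if "m \<in> Poly_Mapping.keys F" for m
    unfolding monom_eval_def
    by (rule prod.cong) (use assms that in \<open>auto simp: forms_def monomials_def subset_iff\<close>)
  then show ?thesis by (simp add: peval_def flip: monom_eval_def)
qed

lemma polyfun_peval:
  assumes "\<And>x. x \<in> X \<Longrightarrow> polyfun I (\<lambda>\<xi>. \<phi> \<xi> x)" "F \<in> forms X e"
  shows "polyfun I (\<lambda>\<xi>. peval (\<phi> \<xi>) F)"
  unfolding peval_def using assms(2)
  by (intro polyfun_intros assms(1)) (auto simp: forms_def monomials_def)

lemma homogenise:
  assumes "polyfun I P" "\<And>i. i \<in> I \<Longrightarrow> h i \<in> X" "z \<in> X"
  shows "\<exists>e. \<exists>F\<in>forms X e. \<forall>\<alpha>. \<alpha> z \<noteq> 0 \<longrightarrow> peval \<alpha> F = \<alpha> z ^ e * P (\<lambda>i. \<alpha> (h i) / \<alpha> z)"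
  using assms(1)
proof induction
  case (polyfun_const c)
  have "Poly_Mapping.single 0 c \<in> forms X 0" by (rule forms_single) (simp add: monomials_def)
  then show ?case by (intro exI[of _ 0] bexI) (auto simp: monom_eval_def)
next
  case (polyfun_var i)
  have "Poly_Mapping.single (Poly_Mapping.single (h i) 1) 1 \<in> forms X 1"
    by (intro forms_single single_in_monomials assms polyfun_var)
  then show ?case by (intro exI[of _ 1] bexI) auto
next
  case (polyfun_mult P Q)
  then obtain e F e' G where
    "F \<in> forms X e" "\<forall>\<alpha>. \<alpha> z \<noteq> 0 \<longrightarrow> peval \<alpha> F = \<alpha> z ^ e * P (\<lambda>i. \<alpha> (h i) / \<alpha> z)"
    "G \<in> forms X e'" "\<forall>\<alpha>. \<alpha> z \<noteq> 0 \<longrightarrow> peval \<alpha> G = \<alpha> z ^ e' * Q (\<lambda>i. \<alpha> (h i) / \<alpha> z)"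
    by blast
  then show ?case
    by (intro exI[of _ "e + e'"] bexI[of _ "F * G"])
       (auto simp: peval_mult power_add intro: forms_mult)
next
  case (polyfun_add P Q)
  then obtain e F e' G where
    F: "F \<in> forms X e" "\<forall>\<alpha>. \<alpha> z \<noteq> 0 \<longrightarrow> peval \<alpha> F = \<alpha> z ^ e * P (\<lambda>i. \<alpha> (h i) / \<alpha> z)" and
    G: "G \<in> forms X e'" "\<forall>\<alpha>. \<alpha> z \<noteq> 0 \<longrightarrow> peval \<alpha> G = \<alpha> z ^ e' * Q (\<lambda>i. \<alpha> (h i) / \<alpha> z)"
    by blast
  \<comment> \<open>The two forms may differ in degree; powers of the variable \<open>z\<close>
    bring both to degree \<open>e + e'\<close>.\<close>
  define Z where "Z = Poly_Mapping.single (Poly_Mapping.single z (1 :: nat)) (1 :: complex)"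
  have Z: "Z \<in> forms X 1"
    unfolding Z_def by (intro forms_single single_in_monomials assms)
  have "F * Z ^ e' \<in> forms X (e + e')" "G * Z ^ e \<in> forms X (e + e')"
    using forms_mult[OF F(1) forms_power[OF Z, of e']] forms_mult[OF G(1) forms_power[OF Z, of e]]
    by (auto simp: add.commute)
  then have "F * Z ^ e' + G * Z ^ e \<in> forms X (e + e')" by (rule forms_add)
  moreover have "peval \<alpha> Z = \<alpha> z" for \<alpha> by (simp add: Z_def)
  ultimately show ?case using F(2) G(2)
    by (intro exI[of _ "e + e'"] bexI)
       (auto simp: peval_add peval_mult peval_power power_add algebra_simps)
qed

section \<open>Pencils of forms\<close>

lemma span_pair: "cpoly.span {f, g} = {cscale a f + cscale b g | a b. True}"
  unfolding cpoly.span_insert[of f] cpoly.span_singleton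
  by (auto simp: algebra_simps image_iff)

lemma pluecker_pair:
  "pluecker [f, g] [i, j] =
     Poly_Mapping.lookup f i * Poly_Mapping.lookup g j - Poly_Mapping.lookup f j * Poly_Mapping.lookup g i"
proof -
  let ?A = "Matrix.mat 2 2 (\<lambda>(k, l). Poly_Mapping.lookup ([f, g] ! k) ([i, j] ! l))"
  have A: "?A \<in> carrier_mat 2 2" by simp
  have "Determinant.det ?A = (\<Sum>j<2. ?A $$ (0, j) * cofactor ?A 0 j)"
    by (rule laplace_expansion_row[OF A]) simp
  then show ?thesis
    by (simp add: pluecker_def numeral_2_eq_2 cofactor_def det_single mat_delete_def)
qed

lemma pluecker_index_2:
  "I \<in> pluecker_index n d 2 \<longleftrightarrow>
     (\<exists>i j. I = [i, j] \<and> i \<in> monomials {..n} d \<and> j \<in> monomials {..n} d)"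
  by (auto simp: pluecker_index_def length_Suc_conv numeral_2_eq_2)

lemma pluecker_base_change:
  assumes "f' \<in> cpoly.span {f, g}" "g' \<in> cpoly.span {f, g}"
  shows "\<exists>c. \<forall>I\<in>pluecker_index n d 2. pluecker [f', g'] I = c * pluecker [f, g] I"
proof -
  obtain a b a' b' where "f' = cscale a f + cscale b g" "g' = cscale a' f + cscale b' g"
    using assms unfolding span_pair by blast
  \<comment> \<open>The factor is the determinant of the base change.\<close>
  then show ?thesis
    by (intro exI[of _ "a * b' - a' * b"])
       (auto simp: pluecker_index_2 pluecker_pair lookup_add lookup_cscale algebra_simps)
qed

lemma ordered_basis_pair:
  assumes "\<Lambda> \<in> Gr 2 W" "ordered_basis vs \<Lambda>"
  obtains f g where "vs = [f, g]" "f \<in> W" "g \<in> W" "cpoly.span {f, g} = \<Lambda>"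
proof -
  have "length vs = card (set vs)"
    using assms(2) by (simp add: ordered_basis_def distinct_card)
  also have "\<dots> = cpoly.dim \<Lambda>"
    using assms(2) cpoly.dim_span_eq_card_independent[of "set vs"] by (simp add: ordered_basis_def)
  finally have "length vs = 2" using assms(1) by (simp add: Gr_def)
  then obtain f g where vs: "vs = [f, g]"
    by (auto simp: length_Suc_conv numeral_2_eq_2)
  moreover have "set vs \<subseteq> \<Lambda>"
    using assms(2) cpoly.span_superset unfolding ordered_basis_def by blast
  ultimately show thesis using assms that by (auto simp: ordered_basis_def Gr_def)
qed

lemma exists_ordered_basis:
  assumes "\<Lambda> \<in> Gr 2 W"
  shows "\<exists>vs. ordered_basis vs \<Lambda>"
proof -
  obtain B where B: "B \<subseteq> \<Lambda>" "cpoly.independent B" "\<Lambda> \<subseteq> cpoly.span B" "card B = cpoly.dim \<Lambda>"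
    by (rule cpoly.basis_exists)
  have "finite B" using B(4) assms by (intro card_ge_0_finite) (simp add: Gr_def)
  then obtain vs where "set vs = B" "distinct vs" using finite_distinct_list by blast
  moreover have "cpoly.span B = \<Lambda>"
    using B assms by (auto simp: Gr_def dest: cpoly.span_minimal)
  ultimately show ?thesis using B(2) by (auto simp: ordered_basis_def)
qed

text \<open>Bases of the same pencil have proportional Pluecker coordinates, so the values of the
  form \<open>F\<close> differ by the factor \<open>c ^ e\<close>. A nonzero product has nonzero
  factors, hence \<open>c\<close> need not be examined.\<close>

lemma nonvanishing_iff:
  assumes L: "\<Lambda> \<in> Gr 2 (S n d)" and vs: "ordered_basis vs \<Lambda>" and F: "F \<in> forms (pluecker_index n d 2) e"
  shows "\<Lambda> \<in> nonvanishing n d 2 F \<longleftrightarrow> peval (pluecker vs) F \<noteq> 0"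
proof
  assume "\<Lambda> \<in> nonvanishing n d 2 F"
  then obtain ws where ws: "ordered_basis ws \<Lambda>" "peval (pluecker ws) F \<noteq> 0"
    by (auto simp: nonvanishing_def)
  obtain f g where fg: "vs = [f, g]" "cpoly.span {f, g} = \<Lambda>"
    using ordered_basis_pair[OF L vs] by metis
  obtain f' g' where fg': "ws = [f', g']" "cpoly.span {f', g'} = \<Lambda>"
    using ordered_basis_pair[OF L ws(1)] by metis
  have "{f', g'} \<subseteq> cpoly.span {f, g}"
    using cpoly.span_superset[of "{f', g'}"] fg fg' by blast
  then obtain c where "\<forall>I\<in>pluecker_index n d 2. pluecker [f', g'] I = c * pluecker [f, g] I"
    using pluecker_base_change[of f' f g g' n d] by auto
  then have "peval (pluecker ws) F = peval (\<lambda>I. c * pluecker vs I) F"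
    by (intro peval_cong[OF F]) (simp add: fg fg')
  then show "peval (pluecker vs) F \<noteq> 0"
    using ws(2) by (auto simp: peval_scale[OF F])
qed (use assms in \<open>auto simp: nonvanishing_def\<close>)

lemma nonvanishing_mult:
  assumes F: "F \<in> forms (pluecker_index n d 2) e" and G: "G \<in> forms (pluecker_index n d 2) e'"
  shows "nonvanishing n d 2 F \<inter> nonvanishing n d 2 G = nonvanishing n d 2 (F * G)"
proof -
  have "\<Lambda> \<in> nonvanishing n d 2 F \<inter> nonvanishing n d 2 G \<longleftrightarrow> \<Lambda> \<in> nonvanishing n d 2 (F * G)"
    if L: "\<Lambda> \<in> Gr 2 (S n d)" for \<Lambda>
  proof -
    obtain vs where vs: "ordered_basis vs \<Lambda>" using exists_ordered_basis[OF L] by blast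
    show ?thesis
      by (simp add: nonvanishing_iff[OF L vs F] nonvanishing_iff[OF L vs G]
          nonvanishing_iff[OF L vs forms_mult[OF F G]] peval_mult)
  qed
  then show ?thesis by (auto simp: nonvanishing_def)
qed

lemma topspace_zariski: "topspace (zariski_Gr n d 2) = Gr 2 (S n d)"
proof
  show "topspace (zariski_Gr n d 2) \<subseteq> Gr 2 (S n d)"
    by (auto simp: zariski_Gr_def nonvanishing_def)
  have "1 \<in> forms (pluecker_index n d 2) 0"
    by (rule formsI) (auto simp: lookup_one when_def monomials_def)
  moreover have "Gr 2 (S n d) \<subseteq> nonvanishing n d 2 1"
    using exists_ordered_basis[of _ "S n d"] by (auto simp: nonvanishing_def)
  ultimately show "Gr 2 (S n d) \<subseteq> topspace (zariski_Gr n d 2)"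
    by (auto simp: zariski_Gr_def)
qed

lemma openin_nonvanishing:
  "F \<in> forms (pluecker_index n d 2) e \<Longrightarrow> openin (zariski_Gr n d 2) (nonvanishing n d 2 F)"
  unfolding zariski_Gr_def by (rule topology_generated_by_Basis) blast

lemma zariski_basis:
  assumes "openin (zariski_Gr n d 2) W" "\<Lambda> \<in> W"
  shows "\<exists>F e. F \<in> forms (pluecker_index n d 2) e \<and> \<Lambda> \<in> nonvanishing n d 2 F \<and>
    nonvanishing n d 2 F \<subseteq> W"
proof -
  have "generate_topology_on
      {nonvanishing n d 2 F | F e. F \<in> forms (pluecker_index n d 2) e} W"
    using assms(1) unfolding zariski_Gr_def by (rule openin_topology_generated_by)
  then show ?thesis using assms(2)
  proof induction
    case (Int V W)
    obtain F e where
      F: "F \<in> forms (pluecker_index n d 2) e" "\<Lambda> \<in> nonvanishing n d 2 F" "nonvanishing n d 2 F \<subseteq> V"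
      using Int.IH(1) Int.prems by blast
    obtain G e' where
      G: "G \<in> forms (pluecker_index n d 2) e'" "\<Lambda> \<in> nonvanishing n d 2 G" "nonvanishing n d 2 G \<subseteq> W"
      using Int.IH(2) Int.prems by blast
    have "F * G \<in> forms (pluecker_index n d 2) (e + e')" using F G by (intro forms_mult)
    moreover have "\<Lambda> \<in> nonvanishing n d 2 (F * G)" "nonvanishing n d 2 (F * G) \<subseteq> V \<inter> W"
      using F G by (auto simp: nonvanishing_mult[OF F(1) G(1), symmetric])
    ultimately show ?case by blast
  next
    case (UN K)
    then show ?case by (meson Union_iff Union_upper order_trans)
  qed auto
qed

section \<open>An affine chart of the Grassmannian of pencils\<close>

type_synonym coord = "bool \<times> (nat \<Rightarrow>\<^sub>0 nat)"

text \<open>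
  A point \<open>\<xi>\<close> encodes the coefficients of two forms; \<open>\<xi> (False, m)\<close> belongs to the first form and
  \<open>\<xi> (True, m)\<close> to the second one. On \<open>chart_points\<close> the coefficients at \<open>m0\<close> and \<open>m1\<close> form the
  identity matrix, which makes the basis of the spanned pencil unique.
\<close>

locale pencil_chart =
  fixes n d :: nat and m0 m1 :: "nat \<Rightarrow>\<^sub>0 nat"
  assumes m0: "m0 \<in> monomials {..n} d" and m1: "m1 \<in> monomials {..n} d" and m0_m1: "m0 \<noteq> m1"
begin

abbreviation coords :: "coord set" where
  "coords \<equiv> UNIV \<times> monomials {..n} d"

definition form_of :: "(coord \<Rightarrow> complex) \<Rightarrow> bool \<Rightarrow> nat cpoly" where
  "form_of \<xi> b = (\<Sum>m\<in>monomials {..n} d. Poly_Mapping.single m (\<xi> (b, m)))"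

definition pencil :: "(coord \<Rightarrow> complex) \<Rightarrow> nat cpoly set" where
  "pencil \<xi> = cpoly.span {form_of \<xi> False, form_of \<xi> True}"

definition minor :: "(coord \<Rightarrow> complex) \<Rightarrow> complex" where
  "minor \<xi> = \<xi> (False, m0) * \<xi> (True, m1) - \<xi> (False, m1) * \<xi> (True, m0)"

definition chart_points :: "(coord \<Rightarrow> complex) set" where
  "chart_points = {\<xi>. \<xi> (False, m0) = 1 \<and> \<xi> (False, m1) = 0 \<and> \<xi> (True, m0) = 0 \<and> \<xi> (True, m1) = 1}"

lemma lookup_form_of:
  "Poly_Mapping.lookup (form_of \<xi> b) m = (if m \<in> monomials {..n} d then \<xi> (b, m) else 0)"
  by (auto simp: form_of_def lookup_sum lookup_single when_def finite_monomials)

lemma form_of_in_S: "form_of \<xi> b \<in> S n d"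
  unfolding S_def by (rule formsI) (simp add: lookup_form_of)

lemma form_of_eqI:
  assumes "f \<in> S n d" "\<And>m. m \<in> monomials {..n} d \<Longrightarrow> \<xi> (b, m) = Poly_Mapping.lookup f m"
  shows "form_of \<xi> b = f"
  by (rule poly_mapping_eqI) (use assms in \<open>auto simp: lookup_form_of S_def dest: formsD\<close>)

lemma minor_chart_points [simp]: "\<xi> \<in> chart_points \<Longrightarrow> minor \<xi> = 1"
  by (simp add: minor_def chart_points_def)

lemma polyfun_minor: "polyfun coords minor"
  unfolding minor_def[abs_def] by (intro polyfun_intros) (auto simp: m0 m1)

lemma line_closed_chart_points: "line_closed chart_points"
  by (simp add: line_closed_def chart_points_def)

lemma minor_nonzero: "\<exists>\<xi>. minor \<xi> \<noteq> 0"
  using m0_m1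
  by (intro exI[of _ "\<lambda>(b, m). if b then of_bool (m = m1) else of_bool (m = m0)"])
     (simp add: minor_def)

lemma ordered_basis_pencil:
  assumes "minor \<xi> \<noteq> 0"
  shows "ordered_basis [form_of \<xi> False, form_of \<xi> True] (pencil \<xi>)" "pencil \<xi> \<in> Gr 2 (S n d)"
proof -
  let ?f = "form_of \<xi> False" and ?g = "form_of \<xi> True"
  have f: "?f \<notin> cpoly.span {?g}"
  proof
    assume "?f \<in> cpoly.span {?g}"
    then obtain c where "?f = cscale c ?g" by (auto simp: cpoly.span_singleton)
    then have "Poly_Mapping.lookup ?f m = c * Poly_Mapping.lookup ?g m" for m
      by (simp add: lookup_cscale)
    from this[of m0] this[of m1] have "\<xi> (False, m0) = c * \<xi> (True, m0)" "\<xi> (False, m1) = c * \<xi> (True, m1)"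
      by (simp_all add: lookup_form_of m0 m1)
    then show False using assms by (simp add: minor_def)
  qed
  have g: "?g \<noteq> 0"
  proof
    assume "?g = 0"
    then have "Poly_Mapping.lookup ?g m = 0" for m by simp
    from this[of m0] this[of m1] show False
      using assms by (simp add: lookup_form_of m0 m1 minor_def)
  qed
  have fg: "?f \<noteq> ?g" using f cpoly.span_base[of ?g "{?g}"] by auto
  have ind: "cpoly.independent {?f, ?g}"
    using f g by (intro cpoly.independent_insertI cpoly.independent_empty) auto
  show "ordered_basis [?f, ?g] (pencil \<xi>)"
    using fg ind by (simp add: ordered_basis_def pencil_def)
  have "cpoly.dim (pencil \<xi>) = 2"
    using cpoly.dim_span_eq_card_independent[OF ind] fg by (simp add: pencil_def)
  moreover have "pencil \<xi> \<subseteq> S n d"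
    unfolding pencil_def
    by (rule cpoly.span_minimal) (auto simp: form_of_in_S, simp add: S_def subspace_forms)
  ultimately show "pencil \<xi> \<in> Gr 2 (S n d)"
    by (simp add: Gr_def pencil_def)
qed

abbreviation pluecker_of :: "(coord \<Rightarrow> complex) \<Rightarrow> (nat \<Rightarrow>\<^sub>0 nat) list \<Rightarrow> complex" where
  "pluecker_of \<xi> \<equiv> pluecker [form_of \<xi> False, form_of \<xi> True]"

lemma pluecker_of_minor: "pluecker_of \<xi> [m0, m1] = minor \<xi>"
  by (simp add: pluecker_pair lookup_form_of m0 m1 minor_def)

lemma pencil_in_nonvanishing:
  assumes "minor \<xi> \<noteq> 0" "F \<in> forms (pluecker_index n d 2) e"
  shows "pencil \<xi> \<in> nonvanishing n d 2 F \<longleftrightarrow> peval (pluecker_of \<xi>) F \<noteq> 0"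
  using nonvanishing_iff[OF ordered_basis_pencil(2,1)] assms by blast

lemma polyfun_pluecker_of:
  assumes "F \<in> forms (pluecker_index n d 2) e"
  shows "polyfun coords (\<lambda>\<xi>. peval (pluecker_of \<xi>) F)"
proof (rule polyfun_peval[OF _ assms])
  fix J assume "J \<in> pluecker_index n d 2"
  then show "polyfun coords (\<lambda>\<xi>. pluecker_of \<xi> J)"
    by (auto simp: pluecker_index_2 pluecker_pair lookup_form_of intro!: polyfun_intros)
qed

text \<open>The Pluecker coordinates that restrict to the coordinates of the chart.\<close>

definition index_of :: "coord \<Rightarrow> (nat \<Rightarrow>\<^sub>0 nat) list" where
  "index_of i = (if fst i then [m0, snd i] else [snd i, m1])"

lemma index_of_in: "i \<in> coords \<Longrightarrow> index_of i \<in> pluecker_index n d 2"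
  by (auto simp: index_of_def pluecker_index_2 m0 m1)

text \<open>Cramer's rule: multiplying the coefficient matrix by the inverse of its block at
  \<open>m0\<close>, \<open>m1\<close> gives the reduced basis, whose entries are quotients of
  minors. Multiplying back by the block recovers \<open>f\<close> and \<open>g\<close>.\<close>

lemma normalise:
  assumes L: "\<Lambda> \<in> Gr 2 (S n d)" and vs: "ordered_basis vs \<Lambda>" and p: "pluecker vs [m0, m1] \<noteq> 0"
  defines "\<xi> \<equiv> \<lambda>i. pluecker vs (index_of i) / pluecker vs [m0, m1]"
  shows "\<xi> \<in> chart_points" "pencil \<xi> = \<Lambda>"
proof -
  obtain f g where fg: "vs = [f, g]" "f \<in> S n d" "g \<in> S n d" "cpoly.span {f, g} = \<Lambda>"
    using ordered_basis_pair[OF L vs] .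
  define p where "p = pluecker vs [m0, m1]"
  have p0: "p \<noteq> 0" using p by (simp add: p_def)
  note pl = pluecker_pair p_def \<xi>_def index_of_def fg(1)
  show xi: "\<xi> \<in> chart_points"
    using p by (auto simp: chart_points_def pl)
  let ?f = "form_of \<xi> False" and ?g = "form_of \<xi> True"
  let ?l = "Poly_Mapping.lookup"
  have zero: "?l h m = 0" if "h \<in> S n d" "m \<notin> monomials {..n} d" for h m
    using that by (auto simp: S_def dest: formsD)
  have f: "cscale (?l g m1 / p) f + cscale (- ?l f m1 / p) g = ?f"
    by (rule poly_mapping_eqI)
       (auto simp: lookup_form_of lookup_add lookup_minus lookup_cscale pl zero[OF fg(2)] zero[OF fg(3)]
          diff_divide_distrib mult.commute)
  have g: "cscale (- ?l g m0 / p) f + cscale (?l f m0 / p) g = ?g"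
    by (rule poly_mapping_eqI)
       (auto simp: lookup_form_of lookup_add lookup_minus lookup_cscale pl zero[OF fg(2)] zero[OF fg(3)]
          diff_divide_distrib mult.commute)
  have pp: "p = ?l f m0 * ?l g m1 - ?l f m1 * ?l g m0" by (simp add: pl)
  have "cscale (?l f m0) ?f + cscale (?l f m1) ?g = f"
    unfolding f[symmetric] g[symmetric]
    by (rule poly_mapping_eqI)
       (use p0 in \<open>simp add: lookup_add lookup_minus lookup_cscale field_simps\<close>,
        simp add: pp algebra_simps)
  moreover have "cscale (?l g m0) ?f + cscale (?l g m1) ?g = g"
    unfolding f[symmetric] g[symmetric]
    by (rule poly_mapping_eqI)
       (use p0 in \<open>simp add: lookup_add lookup_minus lookup_cscale field_simps\<close>,
        simp add: pp algebra_simps)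
  ultimately have "{f, g} \<subseteq> pencil \<xi>"
    unfolding pencil_def span_pair by (auto intro: sym)
  moreover have "{?f, ?g} \<subseteq> cpoly.span {f, g}"
    unfolding span_pair f[symmetric] g[symmetric] by blast
  ultimately show "pencil \<xi> = \<Lambda>"
    unfolding pencil_def fg(4)[symmetric] by (metis cpoly.span_eq)
qed

text \<open>Homogenisation in the Pluecker coordinates. The formula covers every pair with nonzero
  minor, not only the points of the chart, because \<open>extend_vanishing\<close> leaves the
  chart.\<close>

lemma chart_form:
  assumes "polyfun coords P"
  obtains e F where "F \<in> forms (pluecker_index n d 2) e"
    "\<forall>\<xi>. minor \<xi> \<noteq> 0 \<longrightarrow> peval (pluecker_of \<xi>) F =
       minor \<xi> ^ e * P (\<lambda>i. pluecker_of \<xi> (index_of i) / minor \<xi>)"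
proof -
  have "[m0, m1] \<in> pluecker_index n d 2" by (simp add: pluecker_index_2 m0 m1)
  from homogenise[of coords P index_of, OF assms _ this] index_of_in obtain e F where
    F_form: "F \<in> forms (pluecker_index n d 2) e" and
    F: "\<forall>\<alpha>. \<alpha> [m0, m1] \<noteq> 0 \<longrightarrow> peval \<alpha> F = \<alpha> [m0, m1] ^ e * P (\<lambda>i. \<alpha> (index_of i) / \<alpha> [m0, m1])"
    by metis
  have "\<forall>\<xi>. minor \<xi> \<noteq> 0 \<longrightarrow> peval (pluecker_of \<xi>) F =
      minor \<xi> ^ e * P (\<lambda>i. pluecker_of \<xi> (index_of i) / minor \<xi>)"
  proof
    fix \<xi>
    show "minor \<xi> \<noteq> 0 \<longrightarrow> peval (pluecker_of \<xi>) F =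
      minor \<xi> ^ e * P (\<lambda>i. pluecker_of \<xi> (index_of i) / minor \<xi>)"
      using F[THEN spec, of "pluecker_of \<xi>"] unfolding pluecker_of_minor .
  qed
  with F_form show thesis by (rule that)
qed

lemma normalise_chart_points:
  assumes "\<xi> \<in> chart_points" "i \<in> coords"
  shows "pluecker_of \<xi> (index_of i) / minor \<xi> = \<xi> i"
  using assms
  by (auto simp: index_of_def pluecker_pair lookup_form_of m0 m1) (auto simp: chart_points_def)

text \<open>
  The extension is the homogenised function times \<open>minor\<close>, the latter to cover dependent pairs.
\<close>

lemma extend_vanishing:
  assumes P: "polyfun coords P" and Y: "\<And>\<xi>. \<xi> \<in> chart_points \<Longrightarrow> pencil \<xi> \<in> Y \<Longrightarrow> P \<xi> = 0"
  obtains P' where "polyfun coords P'" "\<forall>\<xi>\<in>chart_points. P' \<xi> = P \<xi>"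
    "\<forall>\<xi>. minor \<xi> = 0 \<or> pencil \<xi> \<in> Y \<longrightarrow> P' \<xi> = 0"
proof -
  obtain F e where F: "F \<in> forms (pluecker_index n d 2) e"
    and eq: "\<forall>\<xi>. minor \<xi> \<noteq> 0 \<longrightarrow> peval (pluecker_of \<xi>) F =
       minor \<xi> ^ e * P (\<lambda>i. pluecker_of \<xi> (index_of i) / minor \<xi>)"
    using chart_form[OF P] .
  show thesis
  proof
    show "polyfun coords (\<lambda>\<xi>. minor \<xi> * peval (pluecker_of \<xi>) F)"
      by (intro polyfun_mult polyfun_minor polyfun_pluecker_of[OF F])
    show "\<forall>\<xi>\<in>chart_points. minor \<xi> * peval (pluecker_of \<xi>) F = P \<xi>"
    proof
      fix \<xi> assume xi: "\<xi> \<in> chart_points"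
      then show "minor \<xi> * peval (pluecker_of \<xi>) F = P \<xi>"
        using eq[rule_format, of \<xi>] polyfun_cong[OF P normalise_chart_points[OF xi]] by simp
    qed
    have "peval (pluecker_of \<xi>) F = 0" if "pencil \<xi> \<in> Y" "minor \<xi> \<noteq> 0" for \<xi>
    proof -
      from normalise[OF ordered_basis_pencil(2,1)[OF that(2)]] that(2)
      have "P (\<lambda>i. pluecker_of \<xi> (index_of i) / minor \<xi>) = 0"
        using that by (intro Y) (auto simp: pluecker_of_minor)
      then show ?thesis using eq that(2) by simp
    qed
    then show "\<forall>\<xi>. minor \<xi> = 0 \<or> pencil \<xi> \<in> Y \<longrightarrow> minor \<xi> * peval (pluecker_of \<xi>) F = 0"
      by auto
  qed
qed

subsection \<open>Closed sets seen in the chart\<close>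

abbreviation (input) "X \<equiv> zariski_Gr n d 2"

lemma closed_of_polyfun:
  assumes "polyfun coords P"
  obtains K where "closedin X K" "\<forall>\<xi>\<in>chart_points. pencil \<xi> \<in> K \<longleftrightarrow> P \<xi> = 0"
proof -
  obtain F e where F: "F \<in> forms (pluecker_index n d 2) e"
    and eq: "\<forall>\<xi>. minor \<xi> \<noteq> 0 \<longrightarrow> peval (pluecker_of \<xi>) F =
       minor \<xi> ^ e * P (\<lambda>i. pluecker_of \<xi> (index_of i) / minor \<xi>)"
    using chart_form[OF assms] .
  show thesis
  proof
    show "closedin X (topspace X - nonvanishing n d 2 F)"
      by (intro closedin_diff closedin_topspace openin_nonvanishing[OF F])
    show "\<forall>\<xi>\<in>chart_points. pencil \<xi> \<in> topspace X - nonvanishing n d 2 F \<longleftrightarrow> P \<xi> = 0"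
    proof
      fix \<xi> assume xi: "\<xi> \<in> chart_points"
      then show "pencil \<xi> \<in> topspace X - nonvanishing n d 2 F \<longleftrightarrow> P \<xi> = 0"
        using eq[rule_format, of \<xi>] polyfun_cong[OF assms normalise_chart_points[OF xi]]
          pencil_in_nonvanishing[OF _ F, of \<xi>] ordered_basis_pencil(2)[of \<xi>]
        by (simp add: topspace_zariski)
    qed
  qed
qed

text \<open>Converse to \<open>closed_of_polyfun\<close>: together they identify the topology
  induced on the chart with the Zariski topology of an affine space.\<close>

lemma polyfun_separating:
  assumes "closedin X K" "\<xi> \<in> chart_points" "pencil \<xi> \<notin> K"
  obtains P where "polyfun coords P" "P \<xi> \<noteq> 0" "\<forall>\<eta>\<in>chart_points. pencil \<eta> \<in> K \<longrightarrow> P \<eta> = 0"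
proof -
  have "openin X (topspace X - K)" using assms(1) by blast
  moreover have "pencil \<xi> \<in> topspace X - K"
    using assms ordered_basis_pencil(2)[of \<xi>] by (simp add: topspace_zariski)
  ultimately obtain F e where F: "F \<in> forms (pluecker_index n d 2) e"
    "pencil \<xi> \<in> nonvanishing n d 2 F" "nonvanishing n d 2 F \<subseteq> topspace X - K"
    using zariski_basis by meson
  show thesis
  proof
    show "polyfun coords (\<lambda>\<xi>. peval (pluecker_of \<xi>) F)" by (rule polyfun_pluecker_of[OF F(1)])
    show "peval (pluecker_of \<xi>) F \<noteq> 0"
      using F(2) pencil_in_nonvanishing[OF _ F(1), of \<xi>] assms(2) by simp
    have "peval (pluecker_of \<eta>) F = 0" if "\<eta> \<in> chart_points" "pencil \<eta> \<in> K" for \<eta>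
      using F(3) pencil_in_nonvanishing[OF _ F(1), of \<eta>] that by auto
    then show "\<forall>\<eta>\<in>chart_points. pencil \<eta> \<in> K \<longrightarrow> peval (pluecker_of \<eta>) F = 0" by blast
  qed
qed

lemma chart_open:
  obtains K where "closedin X K"
    "\<forall>\<Lambda>\<in>topspace X. \<Lambda> \<in> K \<longleftrightarrow> \<Lambda> \<notin> pencil ` chart_points"
proof -
  \<comment> \<open>A single Pluecker coordinate; its zero locus is what the chart omits.\<close>
  define F where "F = Poly_Mapping.single (Poly_Mapping.single [m0, m1] (1 :: nat)) (1 :: complex)"
  have F: "F \<in> forms (pluecker_index n d 2) 1"
    unfolding F_def by (intro forms_single single_in_monomials) (simp add: pluecker_index_2 m0 m1)
  have ev: "peval \<alpha> F = \<alpha> [m0, m1]" for \<alpha> by (simp add: F_def)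
  show thesis
  proof
    show "closedin X (topspace X - nonvanishing n d 2 F)"
      by (intro closedin_diff closedin_topspace openin_nonvanishing[OF F])
    have "\<Lambda> \<in> nonvanishing n d 2 F \<longleftrightarrow> \<Lambda> \<in> pencil ` chart_points" for \<Lambda>
    proof
      assume "\<Lambda> \<in> nonvanishing n d 2 F"
      then obtain vs where "\<Lambda> \<in> Gr 2 (S n d)" "ordered_basis vs \<Lambda>" "pluecker vs [m0, m1] \<noteq> 0"
        by (auto simp: nonvanishing_def ev)
      from normalise[OF this] show "\<Lambda> \<in> pencil ` chart_points" by blast
    next
      assume "\<Lambda> \<in> pencil ` chart_points"
      then show "\<Lambda> \<in> nonvanishing n d 2 F"
        using pencil_in_nonvanishing[OF _ F] by (auto simp: ev pluecker_of_minor)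
    qed
    then show "\<forall>\<Lambda>\<in>topspace X. \<Lambda> \<in> topspace X - nonvanishing n d 2 F \<longleftrightarrow> \<Lambda> \<notin> pencil ` chart_points"
      by blast
  qed
qed

text \<open>The argument runs in the affine space of all pairs of forms. There \<open>minor\<close>
  and the value of a form defining a neighbourhood off \<open>K\<close> are both not identically
  zero, so some pair makes both nonzero, and it can be normalised.\<close>

lemma chart_dense:
  assumes K: "closedin X K" "K \<noteq> topspace X"
  shows "\<exists>\<xi>\<in>chart_points. pencil \<xi> \<notin> K"
proof -
  obtain \<Lambda> where "\<Lambda> \<in> topspace X - K" using K closedin_subset by blast
  moreover have "openin X (topspace X - K)" using K(1) by blast
  ultimately obtain F e where F: "F \<in> forms (pluecker_index n d 2) e"
    "\<Lambda> \<in> nonvanishing n d 2 F" "nonvanishing n d 2 F \<subseteq> topspace X - K"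
    using zariski_basis by meson
  from F(2) obtain vs where L: "\<Lambda> \<in> Gr 2 (S n d)" "ordered_basis vs \<Lambda>" "peval (pluecker vs) F \<noteq> 0"
    by (auto simp: nonvanishing_def)
  obtain f g where fg: "vs = [f, g]" "f \<in> S n d" "g \<in> S n d"
    using ordered_basis_pair[OF L(1,2)] .
  let ?\<xi> = "\<lambda>(b, m). Poly_Mapping.lookup (if b then g else f) m"
  have "form_of ?\<xi> False = f" "form_of ?\<xi> True = g" using fg by (auto intro: form_of_eqI)
  then have xi: "peval (pluecker_of ?\<xi>) F \<noteq> 0" using L(3) fg(1) by simp
  have "\<exists>\<eta>. peval (pluecker_of \<eta>) F * minor \<eta> \<noteq> 0"
  proof (rule ccontr)
    assume "\<nexists>\<eta>. peval (pluecker_of \<eta>) F * minor \<eta> \<noteq> 0"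
    then have "peval (pluecker_of \<eta>) F * minor \<eta> = 0" for \<eta> by blast
    then have "minor \<eta> = 0" for \<eta>
      by (intro polyfun_integral[where P = "\<lambda>\<xi>. peval (pluecker_of \<xi>) F" and Q = minor,
            OF line_closed_UNIV polyfun_pluecker_of[OF F(1)] polyfun_minor _ UNIV_I xi UNIV_I])
    then show False using minor_nonzero by blast
  qed
  then obtain \<eta> where eta: "minor \<eta> \<noteq> 0" "peval (pluecker_of \<eta>) F \<noteq> 0" by auto
  then have "pencil \<eta> \<notin> K"
    using F(3) pencil_in_nonvanishing[OF eta(1) F(1)] by blast
  then show ?thesis
    using normalise[OF ordered_basis_pencil(2,1)[OF eta(1)]] eta(1) by (metis pluecker_of_minor)
qed

text \<open>A cover by two proper closed sets would give two functions, neither of them zero on the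
  chart, whose product vanishes there.\<close>

lemma irreducible_Grassmannian: "irreducible_closed X (topspace X)"
  unfolding irreducible_closed_def
proof (intro conjI allI impI)
  show "topspace X \<noteq> {}"
    using minor_nonzero ordered_basis_pencil(2) by (auto simp: topspace_zariski)
  fix K L assume KL: "closedin X K" "closedin X L" "topspace X = K \<union> L"
  show "topspace X = K \<or> topspace X = L"
  proof (rule ccontr)
    assume "\<not> ?thesis"
    then obtain \<xi> \<eta> where xi: "\<xi> \<in> chart_points" "pencil \<xi> \<notin> K"
      and eta: "\<eta> \<in> chart_points" "pencil \<eta> \<notin> L"
      using chart_dense[OF KL(1)] chart_dense[OF KL(2)] by blast
    obtain P where P: "polyfun coords P" "P \<xi> \<noteq> 0"
        "\<forall>\<eta>\<in>chart_points. pencil \<eta> \<in> K \<longrightarrow> P \<eta> = 0"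
      using polyfun_separating[OF KL(1) xi] .
    obtain Q where Q: "polyfun coords Q" "Q \<eta> \<noteq> 0"
        "\<forall>\<eta>\<in>chart_points. pencil \<eta> \<in> L \<longrightarrow> Q \<eta> = 0"
      using polyfun_separating[OF KL(2) eta] .
    have "pencil \<zeta> \<in> K \<union> L" if "\<zeta> \<in> chart_points" for \<zeta>
      using ordered_basis_pencil(2)[of \<zeta>] that KL(3) by (simp add: topspace_zariski)
    then have "P \<zeta> * Q \<zeta> = 0" if "\<zeta> \<in> chart_points" for \<zeta>
      using P(3) Q(3) that by auto
    from polyfun_integral[OF line_closed_chart_points P(1) Q(1) this xi(1) P(2) eta(1)] Q(2)
    show False by blast
  qed
qed auto

end

section \<open>Chains of irreducible closed sets of length one\<close>

lemma codim_irreducible_ge_1: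
  assumes "irreducible_closed T Z" "irreducible_closed T W" "Z \<subset> W"
  shows "codim_irreducible T Z \<ge> 1"
proof -
  let ?C = "\<lambda>i::nat. if i = 0 then Z else W"
  have "1 \<in> {k. \<exists>C. C 0 = Z \<and> (\<forall>i\<le>k. irreducible_closed T (C i)) \<and> (\<forall>i<k. C i \<subset> C (Suc i))}"
    using assms by (intro CollectI exI[of _ ?C]) auto
  then show ?thesis
    unfolding codim_irreducible_def one_enat_def by (rule SUP_upper)
qed

text \<open>In a longer chain the member just above \<open>Z\<close> would already be the whole
  space, leaving no room for the next one.\<close>

lemma codim_irreducible_le_1:
  assumes "\<And>C. irreducible_closed T C \<Longrightarrow> Z \<subset> C \<Longrightarrow> C = topspace T"
  shows "codim_irreducible T Z \<le> 1"
  unfolding codim_irreducible_def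
proof (rule SUP_least, elim CollectE exE conjE)
  fix k C assume C: "C 0 = Z" "\<forall>i\<le>k. irreducible_closed T (C i)" "\<forall>i<k. C i \<subset> C (Suc i)"
  have "k \<le> 1"
  proof (rule ccontr)
    assume "\<not> k \<le> 1"
    then have "C 0 \<subset> C 1" "C 1 \<subset> C 2" "irreducible_closed T (C 1)" "irreducible_closed T (C 2)"
      using C(2,3) by (auto simp: numeral_2_eq_2)
    then show False
      using assms[of "C 1"] C(1) by (auto simp: irreducible_closed_def dest: closedin_subset)
  qed
  then show "enat k \<le> 1" by (simp add: one_enat_def)
qed

lemma irreducible_closed_subset:
  assumes "irreducible_closed T C" "closedin T K" "closedin T L" "C \<subseteq> K \<union> L"
  shows "C \<subseteq> K \<or> C \<subseteq> L"
proof -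
  have "closedin T (C \<inter> K)" "closedin T (C \<inter> L)"
    using assms(1-3) by (auto simp: irreducible_closed_def)
  moreover have "C = (C \<inter> K) \<union> (C \<inter> L)" using assms(4) by blast
  ultimately have "C = C \<inter> K \<or> C = C \<inter> L"
    using assms(1) unfolding irreducible_closed_def by blast
  then show ?thesis by blast
qed

section \<open>A criterion for codimension one\<close>

context pencil_chart
begin

text \<open>The assumption \<open>dense\<close> says that the projection of \<open>Y\<close> along
  the coordinate \<open>a\<close> is dominant. It stands in for primality of D: a remainder modulo D
  is free of \<open>a\<close>, so it vanishes on the chart as soon as it vanishes on
  \<open>Y\<close>.\<close>

lemma codimension_eq_1:
  assumes Y: "Y \<subseteq> Gr 2 (S n d)"
    and a: "a \<in> coords" "snd a \<notin> {m0, m1}"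
    and A: "polyfun coords A" "indep_of a A" and B: "polyfun coords B" "indep_of a B"
    and vanish: "\<And>\<xi>. \<xi> \<in> chart_points \<Longrightarrow> pencil \<xi> \<in> Y \<Longrightarrow> A \<xi> * \<xi> a + B \<xi> = 0"
    and A_nz: "\<xi>0 \<in> chart_points" "A \<xi>0 \<noteq> 0"
    and dense: "\<And>P \<xi>. polyfun coords P \<Longrightarrow> indep_of a P \<Longrightarrow>
        (\<And>\<eta>. \<eta> \<in> chart_points \<Longrightarrow> pencil \<eta> \<in> Y \<Longrightarrow> P \<eta> = 0) \<Longrightarrow> \<xi> \<in> chart_points \<Longrightarrow> P \<xi> = 0"
  shows "codimension X Y = 1"
proof -
  define D where "D = (\<lambda>\<xi>. A \<xi> * \<xi> a + B \<xi>)"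
  have D: "polyfun coords D" unfolding D_def by (intro polyfun_intros A B a)
  obtain Kinf where Kinf: "closedin X Kinf"
      "\<forall>\<Lambda>\<in>topspace X. \<Lambda> \<in> Kinf \<longleftrightarrow> \<Lambda> \<notin> pencil ` chart_points"
    using chart_open .
  obtain KD where KD: "closedin X KD" "\<forall>\<xi>\<in>chart_points. pencil \<xi> \<in> KD \<longleftrightarrow> D \<xi> = 0"
    using closed_of_polyfun[OF D] .
  obtain KA where KA: "closedin X KA" "\<forall>\<xi>\<in>chart_points. pencil \<xi> \<in> KA \<longleftrightarrow> A \<xi> = 0"
    using closed_of_polyfun[OF A(1)] .
  have pt: "pencil \<xi> \<in> topspace X" if "\<xi> \<in> chart_points" for \<xi>
    using that ordered_basis_pencil(2)[of \<xi>] by (simp add: topspace_zariski)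
  have closedin_cover: "C \<subseteq> pencil ` chart_points \<union> Kinf" if "closedin X C" for C
    using closedin_subset[OF that] Kinf(2) by blast

  have "Y \<subseteq> KD \<union> Kinf"
    using Y Kinf(2) KD(2) vanish by (auto simp: topspace_zariski D_def)
  then have cl_Y: "X closure_of Y \<subseteq> KD \<union> Kinf"
    by (intro closure_of_minimal closedin_Un KD Kinf)
  \<comment> \<open>The coordinate \<open>a\<close> is chosen so that \<open>D\<close> takes the
    value 1; this keeps the point away from the closure of \<open>Y\<close>.\<close>
  define \<xi>1 where "\<xi>1 = \<xi>0(a := (1 - B \<xi>0) / A \<xi>0)"
  have xi1: "\<xi>1 \<in> chart_points"
    using A_nz(1) a(2) by (cases a) (auto simp: chart_points_def \<xi>1_def)
  have "D \<xi>1 = 1"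
    using A_nz(2) by (simp add: D_def \<xi>1_def indep_ofD[OF A(2)] indep_ofD[OF B(2)])
  then have "pencil \<xi>1 \<notin> KD \<union> Kinf"
    using xi1 KD(2) Kinf(2) pt by auto
  then have ne: "pencil \<xi>1 \<in> topspace X - (X closure_of Y)"
    using cl_Y pt[OF xi1] by blast

  have ge: "codim_irreducible X Z \<ge> 1" if "irreducible_closed X Z" "Z \<subseteq> X closure_of Y" for Z
  proof (rule codim_irreducible_ge_1[OF that(1) irreducible_Grassmannian])
    show "Z \<subset> topspace X"
      using ne that by (auto simp: irreducible_closed_def dest: closedin_subset)
  qed

  \<comment> \<open>Where \<open>A\<close> vanishes, the equation no longer determines the
    coordinate \<open>a\<close>, and the closure of \<open>Y\<close> might have further components
    there; they are left out.\<close>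
  define Y0 where "Y0 = pencil ` {\<xi> \<in> chart_points. pencil \<xi> \<in> Y \<and> A \<xi> \<noteq> 0}"
  define Z where "Z = X closure_of Y0"
  have Y0: "Y0 \<subseteq> Y" "Y0 \<subseteq> topspace X" using pt by (auto simp: Y0_def)
  have Z_cl: "closedin X Z" "Y0 \<subseteq> Z"
    unfolding Z_def using closure_of_subset[OF Y0(2)] by simp_all
  have Z_sub: "Z \<subseteq> X closure_of Y" unfolding Z_def by (rule closure_of_mono[OF Y0(1)])

  \<comment> \<open>polynomial functions vanishing on \<open>Y0\<close> are divisible by \<open>D\<close> up to powers of \<open>A\<close>\<close>
  have divide: "\<exists>n Q. polyfun coords Q \<and> has_degree coords a (deg - 1) Q \<and>
      (\<forall>\<xi>\<in>chart_points. A \<xi> ^ n * P \<xi> = D \<xi> * Q \<xi>)"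
    if P: "has_degree coords a deg P" and P0: "\<And>\<xi>. \<xi> \<in> chart_points \<Longrightarrow> pencil \<xi> \<in> Y0 \<Longrightarrow> P \<xi> = 0"
    for P deg
  proof -
    obtain Q R where QR: "has_degree coords a (deg - 1) Q" "polyfun coords R" "indep_of a R"
      "\<And>\<xi>. A \<xi> ^ deg * P \<xi> = (A \<xi> * \<xi> a + B \<xi>) * Q \<xi> + R \<xi>"
      using pseudo_division[OF P A B] by metis
    \<comment> \<open>The factor \<open>A\<close> disposes of the points of \<open>Y\<close> where
      \<open>A\<close> vanishes: \<open>P\<close> is known to vanish only on \<open>Y0\<close>,
      whereas \<open>dense\<close> asks about all of \<open>Y\<close>.\<close>
    have "A \<eta> * R \<eta> = 0" if "\<eta> \<in> chart_points" for \<eta>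
    proof (rule dense[OF _ _ _ that])
      show "polyfun coords (\<lambda>\<xi>. A \<xi> * R \<xi>)" by (intro polyfun_mult A QR)
      show "indep_of a (\<lambda>\<xi>. A \<xi> * R \<xi>)" using A(2) QR(3) by (simp add: indep_of_def)
      fix \<eta> assume eta: "\<eta> \<in> chart_points" "pencil \<eta> \<in> Y"
      show "A \<eta> * R \<eta> = 0"
      proof (cases "A \<eta> = 0")
        case False
        then have "P \<eta> = 0" using P0[of \<eta>] eta by (auto simp: Y0_def)
        then show ?thesis using QR(4)[of \<eta>] vanish[OF eta] by simp
      qed simp
    qed
    then have "R \<eta> = 0" if "\<eta> \<in> chart_points" for \<eta>
      using polyfun_integral[OF line_closed_chart_points A(1) QR(2) _ A_nz that] by blast
    then have "\<forall>\<xi>\<in>chart_points. A \<xi> ^ deg * P \<xi> = D \<xi> * Q \<xi>"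
      using QR(4) by (simp add: D_def)
    then show ?thesis
      using QR(1) has_degree_polyfun[OF QR(1) a(1)] by blast
  qed

  have Z_irr: "irreducible_closed X Z"
    unfolding irreducible_closed_def
  proof (intro conjI allI impI)
    show "closedin X Z" by (rule Z_cl)
    show "Z \<noteq> {}"
    proof
      assume "Z = {}"
      then have "A \<xi> = 0" if "\<xi> \<in> chart_points" "pencil \<xi> \<in> Y" for \<xi>
        using Z_cl(2) that by (auto simp: Y0_def)
      from dense[OF A this A_nz(1)] A_nz(2) show False by simp
    qed
    fix K L assume KL: "closedin X K" "closedin X L" "Z = K \<union> L"
    show "Z = K \<or> Z = L"
    proof (rule ccontr)
      assume neq: "\<not> (Z = K \<or> Z = L)"
      have "\<not> Y0 \<subseteq> K"
        using closure_of_minimal[OF _ KL(1), of Y0] KL(3) neq by (auto simp: Z_def)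
      then obtain \<xi> where xi: "\<xi> \<in> chart_points" "A \<xi> \<noteq> 0" "pencil \<xi> \<in> Y" "pencil \<xi> \<notin> K"
        by (auto simp: Y0_def)
      have "\<not> Y0 \<subseteq> L"
        using closure_of_minimal[OF _ KL(2), of Y0] KL(3) neq by (auto simp: Z_def)
      then obtain \<eta> where eta: "\<eta> \<in> chart_points" "A \<eta> \<noteq> 0" "pencil \<eta> \<in> Y" "pencil \<eta> \<notin> L"
        by (auto simp: Y0_def)
      obtain P where P: "polyfun coords P" "P \<xi> \<noteq> 0"
          "\<forall>\<zeta>\<in>chart_points. pencil \<zeta> \<in> K \<longrightarrow> P \<zeta> = 0"
        using polyfun_separating[OF KL(1) xi(1,4)] .
      obtain Q where Q: "polyfun coords Q" "Q \<eta> \<noteq> 0"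
          "\<forall>\<zeta>\<in>chart_points. pencil \<zeta> \<in> L \<longrightarrow> Q \<zeta> = 0"
        using polyfun_separating[OF KL(2) eta(1,4)] .
      obtain k where k: "has_degree coords a k P" using polyfun_has_degree[OF P(1)] by blast
      obtain l where l: "has_degree coords a l Q" using polyfun_has_degree[OF Q(1)] by blast
      obtain q1 r1 where r1: "polyfun coords r1" "indep_of a r1"
          "\<And>\<xi>. A \<xi> ^ k * P \<xi> = (A \<xi> * \<xi> a + B \<xi>) * q1 \<xi> + r1 \<xi>"
        using pseudo_division[OF k A B] by metis
      obtain q2 r2 where r2: "polyfun coords r2" "indep_of a r2"
          "\<And>\<xi>. A \<xi> ^ l * Q \<xi> = (A \<xi> * \<xi> a + B \<xi>) * q2 \<xi> + r2 \<xi>"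
        using pseudo_division[OF l A B] by metis
      \<comment> \<open>On \<open>Y\<close> the remainders equal \<open>P\<close> and
        \<open>Q\<close> up to powers of \<open>A\<close>, so on \<open>Y0\<close> their product
        vanishes. Unlike \<open>P\<close> and \<open>Q\<close> they are free of \<open>a\<close>, so
        \<open>dense\<close> applies to them.\<close>
      have Ar: "A \<zeta> * (r1 \<zeta> * r2 \<zeta>) = 0" if "\<zeta> \<in> chart_points" for \<zeta>
      proof (rule dense[OF _ _ _ that])
        show "polyfun coords (\<lambda>\<xi>. A \<xi> * (r1 \<xi> * r2 \<xi>))" by (intro polyfun_mult A r1 r2)
        show "indep_of a (\<lambda>\<xi>. A \<xi> * (r1 \<xi> * r2 \<xi>))"
          using A(2) r1(2) r2(2) by (simp add: indep_of_def)
        fix \<zeta> assume z: "\<zeta> \<in> chart_points" "pencil \<zeta> \<in> Y"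
        show "A \<zeta> * (r1 \<zeta> * r2 \<zeta>) = 0"
        proof (cases "A \<zeta> = 0")
          case False
          then have "pencil \<zeta> \<in> K \<union> L"
            using z Z_cl(2) KL(3) by (auto simp: Y0_def)
          then have "P \<zeta> = 0 \<or> Q \<zeta> = 0" using P(3) Q(3) z(1) by blast
          then show ?thesis using r1(3)[of \<zeta>] r2(3)[of \<zeta>] vanish[OF z] by auto
        qed simp
      qed
      have r12: "r1 \<zeta> * r2 \<zeta> = 0" if "\<zeta> \<in> chart_points" for \<zeta>
        by (rule polyfun_integral[OF line_closed_chart_points A(1) polyfun_mult[OF r1(1) r2(1)]
              Ar A_nz that])
      have "r1 \<xi> \<noteq> 0" using r1(3)[of \<xi>] vanish[OF xi(1,3)] xi(2) P(2) by auto
      from polyfun_integral[OF line_closed_chart_points r1(1) r2(1) r12 xi(1) this eta(1)]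
      have "r2 \<eta> = 0" .
      then show False using r2(3)[of \<eta>] vanish[OF eta(1,3)] eta(2) Q(2) by auto
    qed
  qed

  have maximal: "C = topspace X" if C: "irreducible_closed X C" "Z \<subset> C" for C
  proof (rule ccontr)
    assume "C \<noteq> topspace X"
    have C_cl: "closedin X C" using C(1) by (simp add: irreducible_closed_def)
    obtain \<xi>2 where xi2: "\<xi>2 \<in> chart_points" "pencil \<xi>2 \<notin> C"
      using chart_dense[OF C_cl \<open>C \<noteq> topspace X\<close>] by blast
    \<comment> \<open>The ideal of \<open>C\<close> in the chart. It is prime because
      \<open>C\<close> is irreducible and not contained in the complement of the chart.\<close>
    define J where "J = {P. polyfun coords P \<and> (\<forall>\<xi>\<in>chart_points. pencil \<xi> \<in> C \<longrightarrow> P \<xi> = 0)}"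
    have not_KA: "\<not> C \<subseteq> KA" and not_Kinf: "\<not> C \<subseteq> Kinf"
    proof -
      obtain \<Lambda> where "\<Lambda> \<in> Y0"
        using Z_irr unfolding irreducible_closed_def Z_def by (auto simp: closure_of_def)
      then have "\<Lambda> \<in> C" "\<Lambda> \<notin> KA" "\<Lambda> \<notin> Kinf"
        using C(2) Z_cl(2) KA(2) Kinf(2) pt by (auto simp: Y0_def)
      then show "\<not> C \<subseteq> KA" "\<not> C \<subseteq> Kinf" by auto
    qed
    have prime: "P \<in> J \<or> Q \<in> J"
      if PQ: "polyfun coords P" "polyfun coords Q" "\<And>\<xi>. \<xi> \<in> chart_points \<Longrightarrow> pencil \<xi> \<in> C \<Longrightarrow> P \<xi> * Q \<xi> = 0"
      for P Q
    proof -
      obtain K where K: "closedin X K" "\<forall>\<xi>\<in>chart_points. pencil \<xi> \<in> K \<longleftrightarrow> P \<xi> = 0"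
        using closed_of_polyfun[OF PQ(1)] .
      obtain L where L: "closedin X L" "\<forall>\<xi>\<in>chart_points. pencil \<xi> \<in> L \<longleftrightarrow> Q \<xi> = 0"
        using closed_of_polyfun[OF PQ(2)] .
      have "C \<subseteq> (K \<union> L) \<union> Kinf"
        using closedin_cover[OF C_cl] K(2) L(2) PQ(3) by fastforce
      then have "C \<subseteq> K \<union> L"
        using irreducible_closed_subset[OF C(1) closedin_Un[OF K(1) L(1)] Kinf(1)] not_Kinf by blast
      then have "C \<subseteq> K \<or> C \<subseteq> L"
        by (rule irreducible_closed_subset[OF C(1) K(1) L(1)])
      then show ?thesis using K(2) L(2) PQ(1,2) by (auto simp: J_def)
    qed
    have Y0C: "pencil \<xi> \<in> C" if "pencil \<xi> \<in> Y0" for \<xi> using that Z_cl(2) C(2) by blast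
    obtain P2 where P2: "polyfun coords P2" "P2 \<xi>2 \<noteq> 0"
        "\<forall>\<zeta>\<in>chart_points. pencil \<zeta> \<in> C \<longrightarrow> P2 \<zeta> = 0"
      using polyfun_separating[OF C_cl xi2] .
    \<comment> \<open>A member of \<open>J\<close> of least degree in \<open>a\<close> that is
      nonzero on the chart. Up to a power of \<open>A\<close> it is \<open>D\<close> times a
      quotient of smaller degree; primality puts one of the two factors into \<open>J\<close>, and
      minimality excludes the quotient.\<close>
    define good where "good = (\<lambda>k. \<exists>P\<in>J. has_degree coords a k P \<and> (\<exists>\<xi>\<in>chart_points. P \<xi> \<noteq> 0))"
    have "\<exists>k. good k"
      using polyfun_has_degree[OF P2(1), of a] P2 xi2(1) unfolding good_def J_def by blast
    then have good: "good (LEAST k. good k)" by (rule LeastI_ex)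
    define k where "k = (LEAST k. good k)"
    obtain P \<xi> where P: "P \<in> J" "has_degree coords a k P" "\<xi> \<in> chart_points" "P \<xi> \<noteq> 0"
      using good unfolding good_def k_def by blast
    have P_van: "P \<xi> = 0" if "\<xi> \<in> chart_points" "pencil \<xi> \<in> C" for \<xi>
      using P(1) that by (auto simp: J_def)
    from divide[OF P(2) P_van[OF _ Y0C]] obtain l Q where
      Q: "polyfun coords Q" "has_degree coords a (k - 1) Q"
        "\<forall>\<xi>\<in>chart_points. A \<xi> ^ l * P \<xi> = D \<xi> * Q \<xi>" by blast
    have "\<exists>\<xi>\<in>chart_points. Q \<xi> \<noteq> 0"
    proof (rule ccontr)
      assume "\<not> ?thesis"
      then have AP: "A \<xi> ^ l * P \<xi> = 0" if "\<xi> \<in> chart_points" for \<xi> using Q(3) that by simp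
      have "P \<xi> = 0"
        using A_nz P(1) by (intro polyfun_integral[OF line_closed_chart_points
              polyfun_power[OF A(1)] _ AP A_nz(1) _ P(3)]) (auto simp: J_def)
      then show False using P(4) by simp
    qed
    have "D \<in> J"
    proof (cases "k = 0")
      \<comment> \<open>In degree 0 the member is free of \<open>a\<close>, and density makes it
        zero.\<close>
      case True
      then have P_ind: "indep_of a P" using has_degree_0_indep P(2) by metis
      have P_poly: "polyfun coords P" using P(1) by (simp add: J_def)
      have AP: "A \<zeta> * P \<zeta> = 0" if "\<zeta> \<in> chart_points" for \<zeta>
      proof (rule dense[OF _ _ _ that])
        show "polyfun coords (\<lambda>\<xi>. A \<xi> * P \<xi>)" by (intro polyfun_mult A P_poly)
        show "indep_of a (\<lambda>\<xi>. A \<xi> * P \<xi>)" using P_ind A(2) by (simp add: indep_of_def)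
        fix \<eta> assume eta: "\<eta> \<in> chart_points" "pencil \<eta> \<in> Y"
        show "A \<eta> * P \<eta> = 0"
        proof (cases "A \<eta> = 0")
          case False
          then have "pencil \<eta> \<in> C" using eta Y0C by (auto simp: Y0_def)
          then show ?thesis using P_van eta by simp
        qed simp
      qed
      have "P \<xi> = 0"
        by (rule polyfun_integral[OF line_closed_chart_points A(1) P_poly AP A_nz P(3)])
      then have False using P(4) by simp
      then show ?thesis by simp
    next
      case False
      have "Q \<notin> J"
      proof
        assume "Q \<in> J"
        then have "good (k - 1)" using Q(2) \<open>\<exists>\<xi>\<in>chart_points. Q \<xi> \<noteq> 0\<close> unfolding good_def by blast
        then show False using not_less_Least[of "k - 1" good] False unfolding k_def by simp
      qed
      moreover have "D \<xi> * Q \<xi> = 0" if "\<xi> \<in> chart_points" "pencil \<xi> \<in> C" for \<xi>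
        using Q(3) P_van[OF that] that by force
      ultimately show ?thesis using prime[OF D Q(1)] by blast
    qed
    \<comment> \<open>At a chart point of \<open>C\<close> with \<open>A\<close> nonzero,
      \<open>D\<close> vanishes; a function vanishing on \<open>Z\<close> is a multiple of
      \<open>D\<close> up to powers of \<open>A\<close>, so it cannot separate this point from
      \<open>Z\<close>.\<close>
    have "C \<subseteq> Z \<union> (KA \<union> Kinf)"
    proof
      fix \<Lambda> assume L: "\<Lambda> \<in> C"
      show "\<Lambda> \<in> Z \<union> (KA \<union> Kinf)"
      proof (rule ccontr)
        assume n: "\<Lambda> \<notin> Z \<union> (KA \<union> Kinf)"
        then obtain \<zeta> where z: "\<zeta> \<in> chart_points" "\<Lambda> = pencil \<zeta>"
          using closedin_cover[OF C_cl] L by blast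
        have Az: "A \<zeta> \<noteq> 0" using n z KA(2) by auto
        have Dz: "D \<zeta> = 0" using \<open>D \<in> J\<close> z L by (auto simp: J_def)
        obtain R where R: "polyfun coords R" "R \<zeta> \<noteq> 0"
            "\<forall>\<eta>\<in>chart_points. pencil \<eta> \<in> Z \<longrightarrow> R \<eta> = 0"
          using polyfun_separating[OF Z_cl(1) z(1)] n z(2) by blast
        obtain r where r: "has_degree coords a r R" using polyfun_has_degree[OF R(1)] by blast
        have "R \<eta> = 0" if "\<eta> \<in> chart_points" "pencil \<eta> \<in> Y0" for \<eta>
          using R(3) that Z_cl(2) by blast
        from divide[OF r this] obtain l Q where "A \<zeta> ^ l * R \<zeta> = D \<zeta> * Q \<zeta>" using z(1) by blast
        then show False using Az Dz R(2) by simp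
      qed
    qed
    then have "C \<subseteq> Z \<or> C \<subseteq> KA \<union> Kinf"
      by (rule irreducible_closed_subset[OF C(1) Z_cl(1) closedin_Un[OF KA(1) Kinf(1)]])
    then have "C \<subseteq> Z"
      using irreducible_closed_subset[OF C(1) KA(1) Kinf(1)] not_KA not_Kinf by blast
    then show False using C(2) by blast
  qed

  show ?thesis
    unfolding codimension_def
  proof (rule antisym)
    show "(INF Z\<in>{Z. irreducible_closed X Z \<and> Z \<subseteq> X closure_of Y}. codim_irreducible X Z) \<le> 1"
      using Z_irr Z_sub by (intro INF_lower2[of Z] codim_irreducible_le_1 maximal) auto
    show "1 \<le> (INF Z\<in>{Z. irreducible_closed X Z \<and> Z \<subseteq> X closure_of Y}. codim_irreducible X Z)"
      using ge by (intro INF_greatest) auto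
  qed
qed

end

section \<open>Ternary cubics\<close>

lemma cscale_eq: "cscale c p = Poly_Mapping.single 0 c * p"
  unfolding cscale_def by (simp add: mult_map_scale_conv_mult)

lemma cscale_mult_left: "cscale c p * q = cscale c (p * q)"
  by (simp add: cscale_eq mult.assoc)

lemma cscale_mult_right: "p * cscale c q = cscale c (p * q)"
  by (simp add: cscale_eq mult.left_commute)

lemma cscale_sum_right: "cscale c (\<Sum>a\<in>A. p a) = (\<Sum>a\<in>A. cscale c (p a))"
  by (simp add: cscale_eq sum_distrib_left)

lemma cscale_sum_left: "cscale (\<Sum>a\<in>A. c a) p = (\<Sum>a\<in>A. cscale (c a) p)"
  by (simp add: cpoly.scale_sum_left)

definition var :: "nat \<Rightarrow> nat cpoly" where
  "var i = Poly_Mapping.single (Poly_Mapping.single i 1) 1"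

definition linear_form :: "(nat \<Rightarrow> complex) \<Rightarrow> nat cpoly" where
  "linear_form c = (\<Sum>i<3. cscale (c i) (var i))"

definition monom3 :: "nat \<Rightarrow> nat \<Rightarrow> nat \<Rightarrow> (nat \<Rightarrow>\<^sub>0 nat)" where
  "monom3 i j k = Poly_Mapping.single i 1 + Poly_Mapping.single j 1 + Poly_Mapping.single k 1"

lemma monom3_commute: "monom3 i j k = monom3 j i k" "monom3 i j k = monom3 i k j"
  by (simp_all add: monom3_def ac_simps)

lemma all_less_3: "(\<forall>i<3::nat. P i) \<longleftrightarrow> P 0 \<and> P 1 \<and> P 2"
  by (auto simp: less_Suc_eq numeral_3_eq_3 numeral_2_eq_2)

lemma sum_less_3: "(\<Sum>i<3::nat. f i) = f 0 + f 1 + (f 2 :: 'a :: comm_monoid_add)"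
  by (simp add: numeral_3_eq_3 numeral_2_eq_2)

lemma var_in_S: "i < 3 \<Longrightarrow> var i \<in> S 2 1"
  unfolding S_def var_def by (intro forms_single single_in_monomials) auto

lemma subspace_S: "cpoly.subspace (S n d)"
  by (simp add: S_def subspace_forms)

lemma linear_form_in_S: "linear_form c \<in> S 2 1"
  unfolding linear_form_def
  by (intro cpoly.subspace_sum subspace_S cpoly.subspace_scale var_in_S) auto

lemma S_mult: "p \<in> S n d \<Longrightarrow> q \<in> S n e \<Longrightarrow> p * q \<in> S n (d + e)"
  unfolding S_def by (rule forms_mult)

lemma S_mult3: "p \<in> S n 1 \<Longrightarrow> q \<in> S n 1 \<Longrightarrow> r \<in> S n 1 \<Longrightarrow> p * q * r \<in> S n 3"
  using S_mult[of "p * q" n "1 + 1" r 1] S_mult[of p n 1 q 1] by (simp add: numeral_3_eq_3)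

lemma monomials_Suc:
  assumes "m \<in> monomials X (Suc d)"
  obtains x m' where "x \<in> X" "m' \<in> monomials X d" "m = m' + Poly_Mapping.single x 1"
proof -
  have "Poly_Mapping.keys m \<noteq> {}" using assms by (auto simp: monomials_def)
  then obtain x where x: "x \<in> Poly_Mapping.keys m" by blast
  define m' where "m' = Poly_Mapping.update x (Poly_Mapping.lookup m x - 1) m"
  have m: "m = m' + Poly_Mapping.single x 1"
    using x by (intro poly_mapping_eqI)
      (auto simp: m'_def lookup_add lookup_update lookup_single when_def in_keys_iff)
  have "total_degree (Poly_Mapping.single x (1 :: nat)) = 1" by (simp add: total_degree_def)
  then have "total_degree m' = d"
    using assms total_degree_add[of m' "Poly_Mapping.single x 1"] m by (simp add: monomials_iff)
  moreover have "Poly_Mapping.keys m' \<subseteq> X"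
    using assms by (auto simp: m'_def monomials_iff in_keys_iff lookup_update subset_iff split: if_splits)
  ultimately show thesis using that x assms m by (auto simp: monomials_iff)
qed

lemma monomials_0: "monomials X 0 = {0}"
  by (auto simp: monomials_def in_keys_iff intro: poly_mapping_eqI)

lemma monomials_1E:
  assumes "m \<in> monomials {..2 :: nat} 1"
  obtains i where "i < 3" "m = Poly_Mapping.single i 1"
proof -
  have "m \<in> monomials {..2} (Suc 0)" using assms by simp
  then obtain i m' where i: "i \<in> {..2}" "m' \<in> monomials {..2 :: nat} 0"
      "m = m' + Poly_Mapping.single i 1" by (rule monomials_Suc)
  show thesis using that[of i] i by (auto simp: monomials_0)
qed

lemma monomials_3E:
  assumes "m \<in> monomials {..2} 3"
  obtains i j k where "i < 3" "j < 3" "k < 3" "m = monom3 i j k"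
proof -
  have "m \<in> monomials {..2} (Suc (Suc (Suc 0)))" using assms by (simp add: numeral_3_eq_3)
  then obtain k m2 where k: "k \<in> {..2}" "m2 \<in> monomials {..2} (Suc (Suc 0))"
      "m = m2 + Poly_Mapping.single k 1" by (rule monomials_Suc)
  from k(2) obtain j m1 where j: "j \<in> {..2}" "m1 \<in> monomials {..2} (Suc 0)"
      "m2 = m1 + Poly_Mapping.single j 1" by (rule monomials_Suc)
  from j(2) obtain i m0 where i: "i \<in> {..2}" "m0 \<in> monomials {..2} 0"
      "m1 = m0 + Poly_Mapping.single i 1" by (rule monomials_Suc)
  show thesis using that[of i j k] i j k by (auto simp: monomials_0 monom3_def)
qed

lemma monom3_in: "i < 3 \<Longrightarrow> j < 3 \<Longrightarrow> k < 3 \<Longrightarrow> monom3 i j k \<in> monomials {..2} 3"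
  using monomials_add[OF monomials_add[OF single_in_monomials[of i "{..2}"]
      single_in_monomials[of j "{..2}"]] single_in_monomials[of k "{..2}"]]
  by (simp add: monom3_def numeral_3_eq_3)

text \<open>
  The weight \<open>4\<^sup>x\<close> of the variable \<open>x\<close> distinguishes the monomials of degree 3 in \<open>x\<^sub>0, x\<^sub>1, x\<^sub>2\<close>.
\<close>

lemma lookup_monom3:
  assumes "i < 3" "j < 3" "k < 3"
  shows "Poly_Mapping.lookup (monom3 i j k) x =
    (if x < 3 then (4 ^ i + 4 ^ j + 4 ^ k) div 4 ^ x mod 4 else 0)"
proof -
  have "\<forall>i<3. \<forall>j<3. \<forall>k<3. \<forall>x<3. Poly_Mapping.lookup (monom3 i j k) x =
      (4 ^ i + 4 ^ j + 4 ^ k) div 4 ^ x mod 4"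
    by (simp add: all_less_3 monom3_def lookup_add lookup_single when_def)
  then show ?thesis using assms by (auto simp: monom3_def lookup_add lookup_single when_def)
qed

text \<open>The exponents are the base 4 digits of the sum; they are at most 3, so no carry occurs.
  Equality of concrete monomials thereby becomes numeral arithmetic.\<close>

lemma monom3_eq_iff:
  assumes "i < 3" "j < 3" "k < 3" "a < 3" "b < 3" "c < 3"
  shows "monom3 i j k = monom3 a b c \<longleftrightarrow> 4 ^ i + 4 ^ j + 4 ^ k = 4 ^ a + 4 ^ b + (4 ^ c :: nat)"
proof
  assume eq: "monom3 i j k = monom3 a b c"
  define w where "w m = (\<Sum>x<3. 4 ^ x * Poly_Mapping.lookup m x)" for m :: "nat \<Rightarrow>\<^sub>0 nat"
  have single: "w (Poly_Mapping.single x 1) = 4 ^ x" if "x < 3" for x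
    using that by (auto simp: w_def lookup_single when_def sum_less_3 less_Suc_eq numeral_3_eq_3)
  have "w (m + m') = w m + w m'" for m m'
    by (simp add: w_def lookup_add algebra_simps sum.distrib)
  then have "w (monom3 x y z) = 4 ^ x + 4 ^ y + 4 ^ z" if "x < 3" "y < 3" "z < 3" for x y z
    unfolding monom3_def using that by (simp only: single)
  with eq assms show "4 ^ i + 4 ^ j + 4 ^ k = 4 ^ a + 4 ^ b + (4 ^ c :: nat)" by metis
qed (use assms in \<open>auto intro!: poly_mapping_eqI simp: lookup_monom3\<close>)

section \<open>Polarisation of ternary cubics\<close>

lemma sum_mult3:
  fixes f g h :: "'a \<Rightarrow> 'b :: semiring_0"
  shows "sum f A * sum g B * sum h C = (\<Sum>a\<in>A. \<Sum>b\<in>B. \<Sum>c\<in>C. f a * g b * h c)"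
proof -
  have "sum f A * sum g B * sum h C = (\<Sum>a\<in>A. \<Sum>b\<in>B. f a * g b * sum h C)"
    by (subst sum_product) (simp only: sum_distrib_right)
  then show ?thesis by (simp only: sum_distrib_left)
qed

text \<open>
  The polarisation of a cubic, up to the factor 6: the weights are the factorials of the exponents.
\<close>

definition weight3 :: "nat \<Rightarrow> nat \<Rightarrow> nat \<Rightarrow> complex" where
  "weight3 i j k = (if i = j \<and> j = k then 6 else if i = j \<or> j = k \<or> i = k then 2 else 1)"

definition polar :: "nat cpoly \<Rightarrow> nat \<Rightarrow> nat \<Rightarrow> nat \<Rightarrow> complex" where
  "polar f i j k = weight3 i j k * Poly_Mapping.lookup f (monom3 i j k)"

lemma polar_commute: "polar f i j k = polar f j i k" "polar f i j k = polar f i k j"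
proof -
  have "weight3 i j k = weight3 j i k" "weight3 i j k = weight3 i k j"
    by (auto simp: weight3_def)
  then show "polar f i j k = polar f j i k" "polar f i j k = polar f i k j"
    using monom3_commute[of i j k] by (simp_all add: polar_def)
qed

lemma weight3_nonzero: "weight3 i j k \<noteq> 0"
  by (simp add: weight3_def)

text \<open>Each monomial occurs \<open>6 / weight3\<close> times among the products of three variables.\<close>

lemma weight3_sum:
  fixes x :: "nat \<Rightarrow> nat \<Rightarrow> nat \<Rightarrow> complex"
  assumes sym: "\<And>i j k. x i j k = x j i k" "\<And>i j k. x i j k = x i k j"
    and abc: "a < 3" "b < 3" "c < 3"
  shows "weight3 a b c * (\<Sum>i<3. \<Sum>j<3. \<Sum>k<3. if monom3 i j k = monom3 a b c then x i j k else 0) =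
    6 * x a b c"
proof -
  have sort: "x (Suc 0) 0 k = x 0 (Suc 0) k" "x 2 0 k = x 0 2 k" "x 2 (Suc 0) k = x (Suc 0) 2 k"
    "x i (Suc 0) 0 = x i 0 (Suc 0)" "x i 2 0 = x i 0 2" "x i 2 (Suc 0) = x i (Suc 0) 2" for i k
    by (rule sym)+
  have "\<forall>a<3. \<forall>b<3. \<forall>c<3.
      weight3 a b c * (\<Sum>i<3. \<Sum>j<3. \<Sum>k<3. if monom3 i j k = monom3 a b c then x i j k else 0) =
      6 * x a b c"
    unfolding all_less_3 sum_less_3
    by (intro conjI; simp add: monom3_eq_iff weight3_def sort)
  then show ?thesis using abc by blast
qed

lemma var_mult3: "var i * var j * var k = Poly_Mapping.single (monom3 i j k) 1"
  by (simp add: var_def mult_single monom3_def)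

text \<open>The sum runs over ordered triples, hence the division by 6. In this tensor form a linear
  substitution of the variables acts on each index separately, which
  \<open>apolar_imp_hankel\<close> exploits.\<close>

lemma polar_expansion:
  assumes "f \<in> S 2 3"
  shows "f = (\<Sum>i<3. \<Sum>j<3. \<Sum>k<3. cscale (polar f i j k / 6) (var i * var j * var k))"
    (is "f = ?r")
proof (rule poly_mapping_eqI)
  fix m
  have r: "Poly_Mapping.lookup ?r m =
      (\<Sum>i<3. \<Sum>j<3. \<Sum>k<3. if monom3 i j k = m then polar f i j k / 6 else 0)"
    by (simp add: lookup_sum lookup_cscale var_mult3 lookup_single when_def if_distrib cong: if_cong)
  show "Poly_Mapping.lookup f m = Poly_Mapping.lookup ?r m"
  proof (cases "m \<in> monomials {..2} 3")
    case False
    then have "Poly_Mapping.lookup f m = 0" using assms by (auto simp: S_def dest: formsD)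
    moreover have "Poly_Mapping.lookup ?r m = 0"
      unfolding r using False monom3_in by (intro sum.neutral ballI) auto
    ultimately show ?thesis by simp
  next
    case True
    then obtain a b c where abc: "a < 3" "b < 3" "c < 3" "m = monom3 a b c" by (rule monomials_3E)
    have "weight3 a b c * Poly_Mapping.lookup ?r m = 6 * (polar f a b c / 6)"
      unfolding r unfolding abc(4) by (rule weight3_sum[OF _ _ abc(1-3)]) (metis polar_commute)+
    then have "weight3 a b c * Poly_Mapping.lookup ?r m = weight3 a b c * Poly_Mapping.lookup f m"
      by (simp add: polar_def abc(4))
    then show ?thesis using weight3_nonzero by simp
  qed
qed

lemma polar_linear_form_cube:
  assumes "i < 3" "j < 3" "k < 3"
  shows "polar (linear_form c ^ 3) i j k = 6 * c i * c j * c k"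
proof -
  have "linear_form c ^ 3 = linear_form c * linear_form c * linear_form c"
    by (simp add: numeral_3_eq_3 mult.assoc)
  also have "\<dots> = (\<Sum>i<3. \<Sum>j<3. \<Sum>k<3. cscale (c i * c j * c k) (var i * var j * var k))"
    unfolding linear_form_def sum_mult3 by (simp add: cscale_mult_left cscale_mult_right ac_simps)
  finally have *: "Poly_Mapping.lookup (linear_form c ^ 3) m =
      (\<Sum>i<3. \<Sum>j<3. \<Sum>k<3. if monom3 i j k = m then c i * c j * c k else 0)" for m
    by (simp add: lookup_sum lookup_cscale var_mult3 lookup_single when_def if_distrib cong: if_cong)
  show ?thesis
    unfolding polar_def * using weight3_sum[of "\<lambda>i j k. c i * c j * c k", OF _ _ assms]
    by (simp add: ac_simps)
qed

lemma linear_formE: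
  assumes "q \<in> S 2 1"
  obtains c where "q = linear_form c"
proof
  show "q = linear_form (\<lambda>i. Poly_Mapping.lookup q (Poly_Mapping.single i 1))"
  proof (rule poly_mapping_eqI)
    fix m
    have r: "Poly_Mapping.lookup (linear_form c) m =
      (\<Sum>i<3. if Poly_Mapping.single i 1 = m then c i else 0)" for c m
      by (simp add: linear_form_def lookup_sum lookup_cscale var_def lookup_single when_def if_distrib
          cong: if_cong)
    show "Poly_Mapping.lookup q m =
        Poly_Mapping.lookup (linear_form (\<lambda>i. Poly_Mapping.lookup q (Poly_Mapping.single i 1))) m"
    proof (cases "m \<in> monomials {..2} 1")
      case True
      then obtain i where i: "i < 3" "m = Poly_Mapping.single i 1" by (rule monomials_1E)
      have inj: "(Poly_Mapping.single j 1 = Poly_Mapping.single i (1 :: nat)) = (j = i)" for j :: nat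
        by (metis inj_single lookup_single_eq lookup_single_not_eq one_neq_zero)
      show ?thesis unfolding r i(2) inj using i(1) by simp
    next
      case False
      then have "Poly_Mapping.lookup q m = 0" using assms by (auto simp: S_def dest: formsD)
      moreover have "Poly_Mapping.single i 1 \<noteq> m" if "i < 3" for i
        using False single_in_monomials[of i "{..2}"] that by auto
      ultimately show ?thesis unfolding r by simp
    qed
  qed
qed

section \<open>Power sums on a conic\<close>

subsection \<open>Sequences with a linear recurrence\<close>

text \<open>The characteristic polynomial of a recurrence, given by its roots: its coefficients are
  then polynomial functions of \<open>t\<close>, which allows passing from distinct roots to
  repeated ones.\<close>

definition root_poly :: "nat \<Rightarrow> (nat \<Rightarrow> complex) \<Rightarrow> complex poly" where
  "root_poly n t = (\<Prod>s<n. [:- t s, 1:])"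

lemma degree_root_poly: "degree (root_poly n t) = n"
  by (simp add: root_poly_def degree_prod_eq_sum_degree)

lemma lead_coeff_root_poly: "coeff (root_poly n t) n = 1"
  using lead_coeff_prod[of "\<lambda>s. [:- t s, 1:]" "{..<n}"] degree_root_poly[of n t]
  by (simp add: root_poly_def)

lemma poly_eq_sum_atMost:
  fixes p :: "'a :: comm_semiring_1 poly"
  assumes "degree p \<le> n"
  shows "poly p x = (\<Sum>j\<le>n. coeff p j * x ^ j)"
  unfolding poly_altdef
  by (rule sum.mono_neutral_left) (use assms in \<open>auto simp: coeff_eq_0\<close>)

lemma polyfun_coeff_root_poly: "polyfun UNIV (\<lambda>t. coeff (root_poly n t) j)"
proof (induction n arbitrary: j)
  case 0
  show ?case by (simp add: root_poly_def)
next
  case (Suc n)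
  have "coeff (root_poly (Suc n) t) j =
      (if j = 0 then 0 else coeff (root_poly n t) (j - 1)) - t n * coeff (root_poly n t) j" for t
    by (cases j) (simp_all add: root_poly_def mult.commute)
  then show ?case
    by (cases "j = 0") (auto intro!: polyfun_intros Suc)
qed

text \<open>Interpolation at \<open>n + 1\<close> nodes reproduces all polynomials of degree at most
  \<open>n\<close>. Applied to the powers of the variable it produces the geometric progressions
  \<open>t s ^ m\<close>.\<close>

lemma lagrange_monom:
  assumes t: "inj_on t {..<Suc n}"
  obtains L where "\<And>s. s \<le> n \<Longrightarrow> degree (L s) \<le> n"
    "\<And>m. m \<le> n \<Longrightarrow> monom 1 m = (\<Sum>s\<le>n. smult (t s ^ m) (L s))"
    "\<And>s r. s \<le> n \<Longrightarrow> r \<le> n \<Longrightarrow> poly (L s) (t r) = (if r = s then 1 else (0::complex))"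
proof -
  define l where "l s = (\<Prod>r\<in>{..n} - {s}. [:- t r, 1:])" for s
  define L where "L s = smult (inverse (poly (l s) (t s))) (l s)" for s
  have inj: "t s = t r \<longleftrightarrow> s = r" if "s \<le> n" "r \<le> n" for s r
    using t that by (auto simp: inj_on_def)
  have l: "poly (l s) (t r) = 0 \<longleftrightarrow> r \<noteq> s" if "s \<le> n" "r \<le> n" for s r
    using that by (auto simp: l_def poly_prod inj)
  have deg: "degree (L s) \<le> n" if "s \<le> n" for s
  proof -
    have "degree (l s) = card ({..n} - {s})" unfolding l_def by (subst degree_prod_eq_sum_degree) auto
    then show ?thesis using that degree_smult_le[of _ "l s"] by (simp add: L_def)
  qed
  have L: "poly (L s) (t r) = (if r = s then 1 else 0)" if "s \<le> n" "r \<le> n" for s r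
    using l that by (auto simp: L_def)
  have "monom 1 m = (\<Sum>s\<le>n. smult (t s ^ m) (L s))" if "m \<le> n" for m
  proof (rule poly_eqI_degree[of "t ` {..n}"])
    show "poly (monom 1 m) x = poly (\<Sum>s\<le>n. smult (t s ^ m) (L s)) x" if "x \<in> t ` {..n}" for x
      using that by (auto simp: poly_monom poly_sum L if_distrib cong: if_cong)
    have "card (t ` {..n}) = Suc n"
      using t by (simp add: card_image lessThan_Suc_atMost)
    then show "degree (monom (1::complex) m) < card (t ` {..n})"
        "degree (\<Sum>s\<le>n. smult (t s ^ m) (L s)) < card (t ` {..n})"
      using that deg by (auto simp: degree_monom_eq less_Suc_eq_le
          intro!: degree_sum_le order.trans[OF degree_smult_le])
  qed
  with deg L show thesis using that by blast
qed

text \<open>The weight \<open>c s\<close> is the value at the Lagrange polynomial of the node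
  \<open>t s\<close> of the linear functional sending x^j to \<open>\<alpha> j\<close>.
  Interpolation gives the terms up to 4; as the recurrence is monic, its two instances determine the
  terms 5 and 6.\<close>

lemma recurrence_imp_power_sum:
  assumes t: "inj_on t {..<5}"
    and rec: "\<And>e. e < 2 \<Longrightarrow> (\<Sum>j\<le>5. coeff (root_poly 5 t) j * \<alpha> (j + e)) = 0"
  obtains c where "\<forall>m\<le>6. \<alpha> m = (\<Sum>s<5. c s * t s ^ m)"
proof -
  have "inj_on t {..<Suc 4}" using t by simp
  from lagrange_monom[OF this] obtain L where L: "\<And>s. s \<le> 4 \<Longrightarrow> degree (L s) \<le> 4"
    "\<And>m. m \<le> 4 \<Longrightarrow> monom 1 m = (\<Sum>s\<le>4. smult (t s ^ m) (L s))" by metis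
  define c where "c s = (\<Sum>j\<le>4. coeff (L s) j * \<alpha> j)" for s
  define \<beta> where "\<beta> m = (\<Sum>s<5. c s * t s ^ m)" for m
  have five: "{..<5::nat} = {..4}" by auto
  have low: "\<alpha> m = \<beta> m" if "m \<le> 4" for m
  proof -
    have "\<alpha> m = (\<Sum>j\<le>4. coeff (monom 1 m) j * \<alpha> j)"
      using that by (simp add: if_distrib[of "\<lambda>c. c * _"] cong: if_cong)
    also have "\<dots> = (\<Sum>j\<le>4. \<Sum>s\<le>4. t s ^ m * coeff (L s) j * \<alpha> j)"
      unfolding L(2)[OF that] by (simp add: coeff_sum sum_distrib_right)
    also have "\<dots> = (\<Sum>s\<le>4. \<Sum>j\<le>4. t s ^ m * coeff (L s) j * \<alpha> j)" by (rule sum.swap)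
    also have "\<dots> = \<beta> m"
      by (simp add: \<beta>_def c_def five sum_distrib_right sum_distrib_left ac_simps)
    finally show ?thesis .
  qed
  have rec': "(\<Sum>j\<le>5. coeff (root_poly 5 t) j * \<beta> (j + e)) = 0" for e
  proof -
    have "(\<Sum>j\<le>5. coeff (root_poly 5 t) j * \<beta> (j + e)) =
        (\<Sum>j\<le>5. \<Sum>s<5. coeff (root_poly 5 t) j * (c s * t s ^ (j + e)))"
      by (simp add: \<beta>_def sum_distrib_left)
    also have "\<dots> = (\<Sum>s<5. \<Sum>j\<le>5. coeff (root_poly 5 t) j * (c s * t s ^ (j + e)))"
      by (rule sum.swap)
    also have "\<dots> = (\<Sum>s<5. c s * t s ^ e * poly (root_poly 5 t) (t s))"
      by (simp add: poly_eq_sum_atMost[of _ 5] degree_root_poly sum_distrib_left power_add ac_simps)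
    also have "\<dots> = 0"
      by (intro sum.neutral ballI) (auto simp: root_poly_def poly_prod)
    finally show ?thesis .
  qed
  have step: "\<alpha> (5 + e) = \<beta> (5 + e)" if "e < 2" "\<And>j. j < 5 \<Longrightarrow> \<alpha> (j + e) = \<beta> (j + e)" for e
  proof -
    have "{..5::nat} = insert 5 {..<5}" by auto
    then have "\<alpha> (5 + e) = - (\<Sum>j<5. coeff (root_poly 5 t) j * \<alpha> (j + e))"
        "\<beta> (5 + e) = - (\<Sum>j<5. coeff (root_poly 5 t) j * \<beta> (j + e))"
      using rec[OF that(1)] rec'[of e] lead_coeff_root_poly[of 5 t]
      by (simp_all add: eq_neg_iff_add_eq_0)
    then show ?thesis using that(2) by simp
  qed
  have "\<alpha> (5 + 0) = \<beta> (5 + 0)" by (rule step) (auto simp: low)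
  moreover from this have "\<alpha> (5 + 1) = \<beta> (5 + 1)"
    by (intro step) (use low in \<open>auto simp: less_Suc_eq numeral_eq_Suc\<close>)
  ultimately have \<alpha>56: "\<alpha> 5 = \<beta> 5" "\<alpha> 6 = \<beta> 6" by simp_all
  have "\<alpha> m = \<beta> m" if "m \<le> 6" for m
  proof -
    have "m \<le> 4 \<or> m = 5 \<or> m = 6" using that by linarith
    with \<alpha>56 low show ?thesis by auto
  qed
  then show thesis using that[of c] by (simp add: \<beta>_def)
qed

subsection \<open>Cubes of points on a conic\<close>

text \<open>
  \<open>conic_form l x\<close> is the linear form at the parameter \<open>x\<close> of the conic that corresponds to the
  coordinate system \<open>l\<close>, and \<open>hankel l\<close> spans the cubics that are apolar to this conic.
\<close>

definition conic_form :: "(nat \<Rightarrow> nat cpoly) \<Rightarrow> complex \<Rightarrow> nat cpoly" where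
  "conic_form l x = (\<Sum>a<3. cscale (x ^ a) (l a))"

definition hankel :: "(nat \<Rightarrow> nat cpoly) \<Rightarrow> (nat \<Rightarrow> complex) \<Rightarrow> nat cpoly" where
  "hankel l \<alpha> = (\<Sum>a<3. \<Sum>b<3. \<Sum>c<3. cscale (\<alpha> (a + b + c)) (l a * l b * l c))"

lemma conic_form_cube:
  "conic_form l x ^ 3 = hankel l (\<lambda>m. x ^ m)"
proof -
  have "conic_form l x ^ 3 = conic_form l x * conic_form l x * conic_form l x"
    by (simp add: numeral_3_eq_3 mult.assoc)
  then show ?thesis
    unfolding conic_form_def hankel_def sum_mult3
    by (simp add: cscale_mult_left cscale_mult_right power_add ac_simps)
qed

lemma hankel_cong:
  assumes "\<And>m. m \<le> 6 \<Longrightarrow> \<alpha> m = \<beta> m"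
  shows "hankel l \<alpha> = hankel l \<beta>"
  unfolding hankel_def by (intro sum.cong) (auto simp: assms)

lemma hankel_sum:
  "hankel l (\<lambda>m. \<Sum>s\<in>A. c s * \<alpha> s m) = (\<Sum>s\<in>A. cscale (c s) (hankel l (\<alpha> s)))"
  unfolding hankel_def
  by (simp add: cscale_sum_left cscale_sum_right sum.swap[of _ _ A])

lemma hankel_power_sum:
  assumes "\<forall>m\<le>6. \<alpha> m = (\<Sum>s\<in>A. c s * t s ^ m)"
  shows "hankel l \<alpha> = (\<Sum>s\<in>A. cscale (c s) (conic_form l (t s) ^ 3))"
  using hankel_cong[of \<alpha> "\<lambda>m. \<Sum>s\<in>A. c s * t s ^ m" l] assms
  by (simp add: hankel_sum conic_form_cube)

text \<open>That all values \<open>z\<close> are attained expresses that the three forms are independent.\<close>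

definition coordinate_system :: "(nat \<Rightarrow> nat cpoly) \<Rightarrow> bool" where
  "coordinate_system l \<longleftrightarrow> (\<forall>a<3. l a \<in> S 2 1) \<and> (\<forall>z. \<exists>y. \<forall>a<3. peval y (l a) = z a)"

lemma conic_form_in_S: "coordinate_system l \<Longrightarrow> conic_form l x \<in> S 2 1"
  unfolding conic_form_def coordinate_system_def
  by (intro cpoly.subspace_sum subspace_S cpoly.subspace_scale) auto

lemma hankel_in_S: "coordinate_system l \<Longrightarrow> hankel l \<alpha> \<in> S 2 3"
  unfolding hankel_def coordinate_system_def
  by (intro cpoly.subspace_sum subspace_S cpoly.subspace_scale S_mult3) auto

text \<open>
  Evaluation turns a relation among the cubes into a relation among the values \<open>r (t s)\<^sup>3\<close> of
  quadratic polynomials \<open>r\<close>, hence by polarisation among products of three quadratic polynomials.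
  Some product vanishes at all but one of the five parameters.
\<close>

lemma independent_cubes:
  fixes s :: nat
  assumes l: "coordinate_system l" and t: "inj_on t {..<5}"
    and rel: "(\<Sum>s<5. cscale (\<mu> s) (conic_form l (t s) ^ 3)) = 0" and s: "s < 5"
  shows "\<mu> s = 0"
proof -
  define q where "q z x = (\<Sum>a<3. z a * x ^ a)" for z :: "nat \<Rightarrow> complex" and x
  have cube: "(\<Sum>s<5. \<mu> s * q z (t s) ^ 3) = 0" for z
  proof -
    obtain y where "\<forall>a<3. peval y (l a) = z a"
      using l unfolding coordinate_system_def by blast
    then have "peval y (conic_form l x) = q z x" for x
      by (simp add: conic_form_def q_def peval_sum peval_cscale mult.commute)
    then show ?thesis
      using arg_cong[OF rel, of "peval y"] by (simp add: peval_sum peval_cscale peval_power)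
  qed
  have q_add: "q (\<lambda>a. z a + w a) x = q z x + q w x" and q_diff: "q (\<lambda>a. z a - w a) x = q z x - q w x" for z w x
    by (simp_all add: q_def sum.distrib sum_subtractf algebra_simps)
  have prod: "(\<Sum>s<5. \<mu> s * (q u (t s) * q v (t s) * q w (t s))) = 0" for u v w
  proof -
    have "24 * (x * y * z) = (x + y + z) ^ 3 - (x + y - z) ^ 3 - (x - y + z) ^ 3 - (y + z - x) ^ 3"
      for x y z :: complex
      by (simp add: power3_eq_cube algebra_simps)
    then have "24 * (\<Sum>s<5. \<mu> s * (q u (t s) * q v (t s) * q w (t s))) =
      (\<Sum>s<5. \<mu> s * ((q u (t s) + q v (t s) + q w (t s)) ^ 3 - (q u (t s) + q v (t s) - q w (t s)) ^ 3 -
        (q u (t s) - q v (t s) + q w (t s)) ^ 3 - (q v (t s) + q w (t s) - q u (t s)) ^ 3))"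
      unfolding sum_distrib_left by (intro sum.cong refl) (metis mult.left_commute)
    also have "\<dots> = 0"
      using cube[of "\<lambda>a. u a + v a + w a"] cube[of "\<lambda>a. u a + v a - w a"]
        cube[of "\<lambda>a. u a - v a + w a"] cube[of "\<lambda>a. v a + w a - u a"]
      by (simp add: right_diff_distrib sum_subtractf q_add q_diff)
    finally show ?thesis by simp
  qed
  have "card ({..<5} - {s}) = Suc (Suc (Suc (Suc 0)))" using s by simp
  then obtain b c d e where bcde: "{..<5} - {s} = {b, c, d, e}"
    unfolding card_Suc_eq by auto
  have q2: "\<exists>z. \<forall>x. q z x = (x - x1) * (x - x2)" for x1 x2
    by (rule exI[of _ "\<lambda>a. if a = 0 then x1 * x2 else if a = 1 then - (x1 + x2) else 1"])
       (simp add: q_def sum_less_3 algebra_simps power2_eq_square)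
  obtain u where u: "\<And>x. q u x = (x - t b) * (x - t c)" using q2 by metis
  obtain v where v: "\<And>x. q v x = (x - t d) * (x - t e)" using q2 by metis
  \<comment> \<open>Two quadratic factors already vanish at the four other parameters, so the third
    is the constant 1.\<close>
  define w where "w = (\<lambda>a::nat. if a = 0 then 1 else 0 :: complex)"
  have w: "q w x = 1" for x by (simp add: q_def w_def sum_less_3)
  have "0 = (\<Sum>s<5. \<mu> s * (q u (t s) * q v (t s) * q w (t s)))" using prod by simp
  also have "\<dots> = \<mu> s * (q u (t s) * q v (t s) * q w (t s)) +
      (\<Sum>r\<in>{..<5} - {s}. \<mu> r * (q u (t r) * q v (t r) * q w (t r)))"
    using s by (intro sum.remove) auto
  also have "(\<Sum>r\<in>{..<5} - {s}. \<mu> r * (q u (t r) * q v (t r) * q w (t r))) = 0"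
    unfolding bcde by (rule sum.neutral) (auto simp: u v)
  finally have "\<mu> s * (q u (t s) * q v (t s) * q w (t s)) = 0" by simp
  moreover have "t r \<noteq> t s" if "r \<in> {b, c, d, e}" for r
    using t s that unfolding bcde[symmetric] by (auto simp: inj_on_def)
  then have "q u (t s) * q v (t s) * q w (t s) \<noteq> 0"
    by (simp add: u v w) (metis insertCI)
  ultimately show ?thesis by simp
qed

lemma independent_family:
  fixes v :: "nat \<Rightarrow> 'x cpoly"
  assumes "\<And>\<mu> s. (\<Sum>s<n. cscale (\<mu> s) (v s)) = 0 \<Longrightarrow> s < n \<Longrightarrow> \<mu> s = 0"
  shows "inj_on v {..<n}" "cpoly.independent (v ` {..<n})"
proof -
  show inj: "inj_on v {..<n}"
  proof (rule inj_onI, rule ccontr)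
    fix i j assume ij: "i \<in> {..<n}" "j \<in> {..<n}" "v i = v j" "i \<noteq> j"
    let ?\<mu> = "\<lambda>s. (if s = i then 1 else 0) - (if s = j then 1 else (0 :: complex))"
    have "(\<Sum>s<n. cscale (?\<mu> s) (v s)) =
        (\<Sum>s<n. (if s = i then v s else 0) - (if s = j then v s else 0))"
      by (intro sum.cong) auto
    also have "\<dots> = 0" using ij by (simp add: sum_subtractf)
    finally show False using assms[of ?\<mu> i] ij by simp
  qed
  show "cpoly.independent (v ` {..<n})"
  proof (rule cpoly.independent_if_scalars_zero)
    fix f x assume sum: "(\<Sum>x\<in>v ` {..<n}. cscale (f x) x) = 0" and "x \<in> v ` {..<n}"
    then obtain s where "s < n" "x = v s" by auto
    then show "f x = 0" using assms[of "\<lambda>s. f (v s)" s] sum by (simp add: sum.reindex[OF inj])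
  qed simp
qed

lemma conic_forms_in_U:
  assumes l: "coordinate_system l" and t: "inj_on t {..<5}"
  shows "(\<lambda>s::nat. conic_form l (t s)) ` {..<5} \<in> U 2 3 5"
proof -
  let ?q = "\<lambda>s::nat. conic_form l (t s)"
  have ind: "inj_on (\<lambda>s. ?q s ^ 3) {..<5}" "cpoly.independent ((\<lambda>s. ?q s ^ 3) ` {..<5})"
    by (rule independent_family; erule (1) independent_cubes[OF l t])+
  have inj: "inj_on ?q {..<5}"
    using ind(1) by (auto simp: inj_on_def)
  have "inj_on (\<lambda>q. q ^ 3) (?q ` {..<5})"
    using ind(1) by (auto simp: inj_on_def)
  then show ?thesis
    using ind(2) inj conic_form_in_S[OF l] by (auto simp: U_def card_image image_image)
qed

definition monom_xyz :: "nat \<Rightarrow>\<^sub>0 nat" where "monom_xyz = monom3 0 1 2"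

definition monom_yyy :: "nat \<Rightarrow>\<^sub>0 nat" where "monom_yyy = monom3 1 1 1"

text \<open>These two monomials are chosen so that \<open>base_point\<close> lies in the chart, and
  x^3 is neither of them, so its coefficient can vary freely.\<close>

interpretation cubic: pencil_chart 2 3 monom_xyz monom_yyy
proof
  show "monom_xyz \<in> monomials {..2} 3" "monom_yyy \<in> monomials {..2} 3"
    unfolding monom_xyz_def monom_yyy_def by (rule monom3_in; simp)+
  show "monom_xyz \<noteq> monom_yyy"
    unfolding monom_xyz_def monom_yyy_def by (subst monom3_eq_iff) auto
qed

lemma solve_linear_system:
  fixes A :: "'a :: field Matrix.mat"
  assumes A: "A \<in> carrier_mat n n" and det: "Determinant.det A \<noteq> 0" and b: "b \<in> carrier_vec n"
  obtains v where "v \<in> carrier_vec n" "A *\<^sub>v v = b"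
proof
  let ?w = "adj_mat A *\<^sub>v b"
  have w: "?w \<in> carrier_vec n" using adj_mat(1)[OF A] b by simp
  show "(1 / Determinant.det A) \<cdot>\<^sub>v ?w \<in> carrier_vec n" using w by simp
  have "A *\<^sub>v ?w = (Determinant.det A \<cdot>\<^sub>m 1\<^sub>m n) *\<^sub>v b"
    using assoc_mult_mat_vec[OF A adj_mat(1)[OF A] b] by (simp add: adj_mat(2)[OF A])
  also have "\<dots> = Determinant.det A \<cdot>\<^sub>v b"
    using b by (intro eq_vecI) auto
  finally show "A *\<^sub>v ((1 / Determinant.det A) \<cdot>\<^sub>v ?w) = b"
    using det b by (simp add: mult_mat_vec[OF A w] smult_smult_assoc)
qed

section \<open>Pencils of cubics that are apolar to a conic\<close>

definition hankel_pair :: "(nat \<Rightarrow> nat cpoly) \<Rightarrow> (bool \<times> nat \<Rightarrow> complex) \<Rightarrow> coord \<Rightarrow> complex" where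
  "hankel_pair l x = (\<lambda>(b, m). Poly_Mapping.lookup (hankel l (\<lambda>j. x (b, j))) m)"

lemma polyfun_hankel_pair:
  assumes "\<And>i. polyfun J (\<lambda>y. x y i)" "polyfun I P"
  shows "polyfun J (\<lambda>y. P (hankel_pair l (x y)))"
proof (rule polyfun_compose[OF assms(2)])
  fix i :: coord
  show "polyfun J (\<lambda>y. hankel_pair l (x y) i)"
    by (cases i) (simp add: hankel_pair_def hankel_def lookup_sum lookup_cscale,
      intro polyfun_intros assms(1))
qed

lemma form_of_hankel_pair:
  "coordinate_system l \<Longrightarrow> cubic.form_of (hankel_pair l x) b = hankel l (\<lambda>j. x (b, j))"
  by (rule cubic.form_of_eqI) (auto simp: hankel_pair_def hankel_in_S)

definition recurrent :: "(nat \<Rightarrow> complex) \<Rightarrow> (bool \<times> nat \<Rightarrow> complex) \<Rightarrow> bool" where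
  "recurrent t x \<longleftrightarrow> (\<forall>b. \<forall>e<2. (\<Sum>j\<le>5. coeff (root_poly 5 t) j * x (b, j + e)) = 0)"

text \<open>Both sequences obey the recurrence with the same roots \<open>t\<close>, so both cubics
  are combinations of the same five cubes.\<close>

lemma hankel_pair_in_Sigma:
  assumes l: "coordinate_system l" and t: "inj_on t {..<5}" and rec: "recurrent t x"
    and minor: "cubic.minor (hankel_pair l x) \<noteq> 0"
  shows "cubic.pencil (hankel_pair l x) \<in> Sigma_var 2 3 2 5"
proof -
  let ?q = "\<lambda>s::nat. conic_form l (t s)"
  let ?W = "cpoly.span ((\<lambda>q. q ^ 3) ` ?q ` {..<5})"
  have W: "hankel l (\<lambda>j. x (b, j)) \<in> ?W" for b
  proof -
    obtain c where "\<forall>m\<le>6. x (b, m) = (\<Sum>s<5. c s * t s ^ m)"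
      using recurrence_imp_power_sum[OF t, of "\<lambda>j. x (b, j)"] rec unfolding recurrent_def by auto
    then have eq: "hankel l (\<lambda>j. x (b, j)) = (\<Sum>s<5. cscale (c s) (?q s ^ 3))"
      by (rule hankel_power_sum)
    show ?thesis
      unfolding eq by (intro cpoly.span_sum cpoly.span_scale cpoly.span_base) auto
  qed
  have "cubic.pencil (hankel_pair l x) \<subseteq> ?W"
    unfolding cubic.pencil_def form_of_hankel_pair[OF l]
    by (rule cpoly.span_minimal) (use W in auto)
  then show ?thesis
    using conic_forms_in_U[OF l t] cubic.ordered_basis_pencil(2)[OF minor]
    unfolding Sigma_var_def by blast
qed

context
  fixes l :: "nat \<Rightarrow> nat cpoly" and P :: "(coord \<Rightarrow> complex) \<Rightarrow> complex"
  assumes l: "coordinate_system l" and P: "polyfun cubic.coords P"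
    and vanish: "\<forall>\<xi>. cubic.minor \<xi> = 0 \<or> cubic.pencil \<xi> \<in> Sigma_var 2 3 2 5 \<longrightarrow> P \<xi> = 0"
begin

lemma vanish_distinct:
  "inj_on t {..<5} \<Longrightarrow> recurrent t x \<Longrightarrow> P (hankel_pair l x) = 0"
  using hankel_pair_in_Sigma[OF l] vanish by blast

text \<open>The first five terms of recurrent sequences determine the rest polynomially in \<open>t\<close>.\<close>

lemma vanish_recurrent:
  assumes rec: "recurrent t x"
  shows "P (hankel_pair l x) = 0"
proof -
  let ?h = "\<lambda>t. coeff (root_poly 5 t)"
  define y5 where "y5 t b = - (\<Sum>j<5. ?h t j * x (b, j))" for t b
  define y6 where "y6 t b = - (\<Sum>j<4. ?h t j * x (b, j + 1)) - ?h t 4 * y5 t b" for t b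
  define y where "y t = (\<lambda>(b, m). if m \<le> 4 then x (b, m) else if m = 5 then y5 t b else y6 t b)" for t
  define vander where "vander t = (\<Prod>j<5. \<Prod>i<j. t j - t i)" for t :: "nat \<Rightarrow> complex"
  have h5: "?h t 5 = 1" for t by (rule lead_coeff_root_poly)
  have set5: "{..5::nat} = {0, 1, 2, 3, 4, 5}" "{..<5::nat} = {0, 1, 2, 3, 4}" "{..<4::nat} = {0, 1, 2, 3}"
    by auto
  have y: "recurrent t (y t)" for t
    unfolding recurrent_def
  proof (intro allI impI)
    fix b and e :: nat assume "e < 2"
    then consider "e = 0" | "e = 1" by linarith
    then show "(\<Sum>j\<le>5. coeff (root_poly 5 t) j * y t (b, j + e)) = 0"
      by cases (simp_all add: set5 y_def y5_def y6_def h5)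
  qed
  have Py: "polyfun UNIV (\<lambda>t. P (hankel_pair l (y t)))"
  proof (rule polyfun_hankel_pair[OF _ P])
    fix i :: "bool \<times> nat"
    have y5: "polyfun UNIV (\<lambda>t. y5 t b)" for b
      unfolding y5_def by (intro polyfun_intros polyfun_coeff_root_poly)
    have "polyfun UNIV (\<lambda>t. y6 t b)" for b
      unfolding y6_def by (intro polyfun_intros polyfun_coeff_root_poly y5)
    with y5 show "polyfun UNIV (\<lambda>t. y t i)"
      by (cases i; cases "snd i \<le> 4"; cases "snd i = 5") (simp_all add: y_def)
  qed
  have vander: "polyfun UNIV vander"
    unfolding vander_def by (intro polyfun_intros) auto
  have inj: "inj_on t {..<5}" if "vander t \<noteq> 0" for t
  proof (rule linorder_inj_onI)
    fix i j :: nat assume "i < j" "j \<in> {..<5}"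
    moreover have "\<forall>j<5. \<forall>i<j. t j \<noteq> t i" using that unfolding vander_def by auto
    ultimately show "t i \<noteq> t j" by (metis lessThan_iff)
  qed auto
  \<comment> \<open>The Vandermonde factor absorbs the tuples with repeated roots. It is nonzero at
    \<open>of_nat\<close>, so it can be cancelled, and repeated roots are included.\<close>
  have "vander t * P (hankel_pair l (y t)) = 0" for t
    using vanish_distinct[OF inj y, of t] by auto
  moreover have "vander of_nat \<noteq> 0" by (auto simp: vander_def)
  ultimately have "P (hankel_pair l (y t)) = 0"
    by (intro polyfun_integral[OF line_closed_UNIV vander Py _ UNIV_I _ UNIV_I])
  moreover have "hankel_pair l (y t) = hankel_pair l x"
  proof -
    have five: "x (b, 5) = y5 t b" for b
    proof -
      have "x (b, 5) + (\<Sum>j<5. ?h t j * x (b, j)) = 0"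
        using rec[unfolded recurrent_def, rule_format, of 0 b] by (simp add: set5 h5 ac_simps)
      then show ?thesis by (simp add: y5_def eq_neg_iff_add_eq_0)
    qed
    have "x (b, 6) = y6 t b" for b
    proof -
      have "x (b, 6) + ((\<Sum>j<4. ?h t j * x (b, j + 1)) + ?h t 4 * x (b, 5)) = 0"
        using rec[unfolded recurrent_def, rule_format, of 1 b] by (simp add: set5 h5 ac_simps)
      then show ?thesis by (simp add: y6_def five add_eq_0_iff2)
    qed
    with five have "y t (b, m) = x (b, m)" if "m \<le> 6" for b m
      using that by (auto simp: y_def le_Suc_eq numeral_eq_Suc)
    then show ?thesis
      unfolding hankel_pair_def by (auto intro!: arg_cong2[of _ _ _ _ Poly_Mapping.lookup] hankel_cong)
  qed
  ultimately show ?thesis by simp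
qed

lemma vanish_hankel_pair: "P (hankel_pair l x) = 0"
proof -
  \<comment> \<open>Two sequences and two shifts give four equations for a common monic recurrence
    of order 5, which has five free coefficients; that of x^4 is set to 0 to make the system square.
    Row \<open>r\<close> belongs to the sequence \<open>2 \<le> r\<close> and the shift
    \<open>r mod 2\<close>.\<close>
  define A where "A x = Matrix.mat 4 4 (\<lambda>(r, j). x (2 \<le> r, r mod 2 + j))" for x :: "bool \<times> nat \<Rightarrow> complex"
  have A: "A x \<in> carrier_mat 4 4" for x by (simp add: A_def)
  define \<Delta> where "\<Delta> x = Determinant.det (A x)" for x
  have set: "{0..<4::nat} = {0, 1, 2, 3}" "{..5::nat} = {0, 1, 2, 3, 4, 5}" by auto
  have gen: "P (hankel_pair l x) = 0" if nz: "\<Delta> x \<noteq> 0" for x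
  proof -
    define b where "b = Matrix.vec 4 (\<lambda>r. - x (2 \<le> r, r mod 2 + 5))"
    have b: "b \<in> carrier_vec 4" by (simp add: b_def)
    obtain v where v: "v \<in> carrier_vec 4" "A x *\<^sub>v v = b"
      using solve_linear_system[OF A nz[unfolded \<Delta>_def] b] .
    have eq: "(\<Sum>j = 0..<4. x (2 \<le> r, r mod 2 + j) * v $ j) = - x (2 \<le> r, r mod 2 + 5)"
      if "r < 4" for r
    proof -
      have "(A x *\<^sub>v v) $ r = b $ r" by (simp add: v(2))
      then show ?thesis using that v(1) by (simp add: A_def b_def scalar_prod_def)
    qed
    define p where "p = [:v $ 0, v $ 1, v $ 2, v $ 3, 0, 1:]"
    have "p \<noteq> 0" "degree p = 5" "lead_coeff p = 1" by (simp_all add: p_def)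
    then obtain M where M: "size M = 5" "p = (\<Prod>x\<in>#M. [:- x, 1:])"
      using alg_closed_imp_factorization[of p] by auto
    obtain ts where ts: "mset ts = M" using ex_mset by blast
    define t where "t s = ts ! s" for s
    have "p = (\<Prod>x\<leftarrow>ts. [:- x, 1:])" using M(2) ts by (metis mset_map prod_mset_prod_list)
    also have "\<dots> = root_poly 5 t"
      using M(1) ts by (auto simp: root_poly_def t_def prod.list_conv_set_nth lessThan_atLeast0)
    finally have p: "root_poly 5 t = p" ..
    have "recurrent t x"
      unfolding recurrent_def p
    proof (intro allI impI)
      fix b :: bool and e :: nat assume "e < 2"
      then have r: "(if b then 2 else 0) + e < 4" "(2 \<le> (if b then 2 else 0) + e) = b"
          "((if b then 2 else 0) + e) mod 2 = e"
        by auto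
      have "(\<Sum>j = 0..<4. x (b, e + j) * v $ j) = - x (b, e + 5)"
        using eq[OF r(1)] unfolding r(2,3) .
      moreover have "coeff p 0 = v $ 0" "coeff p 1 = v $ 1" "coeff p 2 = v $ 2" "coeff p 3 = v $ 3"
          "coeff p 4 = 0" "coeff p 5 = 1"
        by (simp_all add: p_def numeral_eq_Suc)
      ultimately show "(\<Sum>j\<le>5. coeff p j * x (b, j + e)) = 0"
        unfolding set by (simp add: eq_neg_iff_add_eq_0 ac_simps)
    qed
    then show ?thesis by (rule vanish_recurrent)
  qed
  have "\<Delta> x * P (hankel_pair l x) = 0" for x using gen[of x] by auto
  moreover have "polyfun UNIV \<Delta>"
    unfolding \<Delta>_def by (rule polyfun_det[OF A]) (auto simp: A_def intro: polyfun_var)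
  moreover have "polyfun UNIV (\<lambda>x. P (hankel_pair l x))"
    by (rule polyfun_hankel_pair[OF _ P]) (auto intro: polyfun_var)
  \<comment> \<open>The sequences with a single 1 at index 1 and at index 3 turn the system into a
    permutation matrix.\<close>
  moreover have "\<Delta> (\<lambda>(b, j). if j = (if b then 3 else 1) then 1 else 0) \<noteq> 0" (is "\<Delta> ?x \<noteq> 0")
  proof
    assume "\<Delta> ?x = 0"
    then obtain v where v: "v \<in> carrier_vec 4" "v \<noteq> 0\<^sub>v 4" "A ?x *\<^sub>v v = 0\<^sub>v 4"
      unfolding \<Delta>_def using det_0_iff_vec_prod_zero_field[OF A] by blast
    have "(A ?x *\<^sub>v v) $ r = 0" if "r < 4" for r using v(3) that by simp
    from this[of 0] this[of 1] this[of 2] this[of 3] have "v $ 0 = 0" "v $ 1 = 0" "v $ 2 = 0" "v $ 3 = 0"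
      using v(1) by (simp_all add: A_def scalar_prod_def set)
    then have "v = 0\<^sub>v 4"
      using v(1) by (intro eq_vecI) (auto simp: less_Suc_eq numeral_eq_Suc)
    then show False using v(2) by simp
  qed
  ultimately show ?thesis
    by (intro polyfun_integral[where P = \<Delta> and Q = "\<lambda>x. P (hankel_pair l x)", OF line_closed_UNIV])
       auto
qed

end

subsection \<open>Coordinates adapted to a conic\<close>

lemma left_inverse_imp_right_inverse:
  fixes E F :: "nat \<Rightarrow> nat \<Rightarrow> 'a :: field"
  assumes "\<And>i j. i < n \<Longrightarrow> j < n \<Longrightarrow> (\<Sum>a<n. F i a * E a j) = (if i = j then 1 else 0)"
    and "a < n" "b < n"
  shows "(\<Sum>i<n. E a i * F i b) = (if a = b then 1 else 0)"
proof -
  let ?E = "Matrix.mat n n (\<lambda>(a, i). E a i)" and ?F = "Matrix.mat n n (\<lambda>(i, a). F i a)"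
  have "?F * ?E = 1\<^sub>m n"
    using assms(1) by (intro eq_matI) (auto simp: scalar_prod_def lessThan_atLeast0)
  then have "?E * ?F = 1\<^sub>m n"
    by (intro mat_mult_left_right_inverse[of ?F n ?E]) auto
  then have "(?E * ?F) $$ (a, b) = 1\<^sub>m n $$ (a, b)" by simp
  then show ?thesis using assms(2,3) by (simp add: scalar_prod_def lessThan_atLeast0)
qed

lemma cholesky3:
  fixes q :: "nat \<Rightarrow> nat \<Rightarrow> complex"
  assumes sym: "\<And>i j. q i j = q j i"
    and m1: "q 0 0 \<noteq> 0" and m2: "q 0 0 * q 1 1 - q 0 1 ^ 2 \<noteq> 0"
    and m3: "q 0 0 * (q 1 1 * q 2 2 - q 1 2 ^ 2) - q 0 1 * (q 0 1 * q 2 2 - q 1 2 * q 0 2) +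
      q 0 2 * (q 0 1 * q 1 2 - q 1 1 * q 0 2) \<noteq> 0"
  obtains R F :: "nat \<Rightarrow> nat \<Rightarrow> complex" where "\<forall>i<3. \<forall>j<3. q i j = (\<Sum>a<3. R a i * R a j)"
    "\<forall>i<3. \<forall>j<3. (\<Sum>a<3. F i a * R a j) = (if i = j then 1 else 0)"
proof -
  define a where "a = csqrt (q 0 0)"
  have a2: "q 0 0 = a ^ 2" by (simp add: a_def)
  then have a0: "a \<noteq> 0" using m1 by auto
  define b where "b = q 0 1 / a"
  define c where "c = q 0 2 / a"
  have b: "q 0 1 = a * b" and c: "q 0 2 = a * c" using a0 by (simp_all add: b_def c_def)
  define d where "d = csqrt (q 1 1 - b ^ 2)"
  have d: "q 1 1 = b ^ 2 + d ^ 2" by (simp add: d_def)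
  have "q 0 0 * q 1 1 - q 0 1 ^ 2 = (a * d) ^ 2"
    unfolding a2 b d by (simp add: power2_eq_square algebra_simps)
  then have d0: "d \<noteq> 0" using m2 by auto
  define e where "e = (q 1 2 - b * c) / d"
  have e: "q 1 2 = b * c + d * e" using d0 by (simp add: e_def)
  define g where "g = csqrt (q 2 2 - c ^ 2 - e ^ 2)"
  have g: "q 2 2 = c ^ 2 + e ^ 2 + g ^ 2" by (simp add: g_def)
  have "q 0 0 * (q 1 1 * q 2 2 - q 1 2 ^ 2) - q 0 1 * (q 0 1 * q 2 2 - q 1 2 * q 0 2) +
      q 0 2 * (q 0 1 * q 1 2 - q 1 1 * q 0 2) = (a * d * g) ^ 2"
    unfolding a2 b c d e g by (simp add: power2_eq_square algebra_simps)
  then have g0: "g \<noteq> 0" using m3 by auto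
  define R where "R i j = [[a, b, c], [0, d, e], [0, 0, g]] ! i ! j" for i j
  define F where "F i j = [[1 / a, - b / (a * d), (b * e - c * d) / (a * d * g)],
    [0, 1 / d, - e / (d * g)], [0, 0, 1 / g]] ! i ! j" for i j
  show thesis
  proof
    show "\<forall>i<3. \<forall>j<3. q i j = (\<Sum>a<3. R a i * R a j)"
      using sym[of 1 0] sym[of 2 0] sym[of 2 1] a2 b c d e g
      by (simp add: all_less_3 sum_less_3 R_def numeral_2_eq_2 power2_eq_square)
    show "\<forall>i<3. \<forall>j<3. (\<Sum>a<3. F i a * R a j) = (if i = j then 1 else 0)"
      using a0 d0 g0
      by (simp add: all_less_3 sum_less_3 R_def F_def numeral_2_eq_2 field_simps)
  qed
qed

text \<open>In the coordinates \<open>E\<close> the conic is the curve with points (1, x, x^2),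
  which is the parametrisation behind \<open>conic_form\<close>.\<close>

lemma conic_coordinates:
  fixes q :: "nat \<Rightarrow> nat \<Rightarrow> complex"
  assumes "\<And>i j. q i j = q j i"
    and "q 0 0 \<noteq> 0" "q 0 0 * q 1 1 - q 0 1 ^ 2 \<noteq> 0"
    and "q 0 0 * (q 1 1 * q 2 2 - q 1 2 ^ 2) - q 0 1 * (q 0 1 * q 2 2 - q 1 2 * q 0 2) +
      q 0 2 * (q 0 1 * q 1 2 - q 1 1 * q 0 2) \<noteq> 0"
  obtains E F :: "nat \<Rightarrow> nat \<Rightarrow> complex" where "\<forall>i<3. \<forall>j<3. q i j = (E 0 i * E 2 j + E 2 i * E 0 j) / 2 - E 1 i * E 1 j"
    "\<forall>i<3. \<forall>j<3. (\<Sum>a<3. F i a * E a j) = (if i = j then 1 else 0)"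
proof -
  obtain R G :: "nat \<Rightarrow> nat \<Rightarrow> complex" where R: "\<forall>i<3. \<forall>j<3. q i j = (\<Sum>a<3. R a i * R a j)"
    and G: "\<forall>i<3. \<forall>j<3. (\<Sum>a<3. G i a * R a j) = (if i = j then 1 else 0)"
    using cholesky3[OF assms] .
  \<comment> \<open>\<open>x\<^sup>2 + y\<^sup>2 + z\<^sup>2 = (x + \<i>y)(x - \<i>y) - (\<i>z)\<^sup>2\<close>\<close>
  define E where "E a j = (if a = 0 then R 0 j + \<i> * R 1 j else if a = 1 then \<i> * R 2 j
    else R 0 j - \<i> * R 1 j)" for a :: nat and j
  define F where "F i a = (if a = 0 then (G i 0 - \<i> * G i 1) / 2 else if a = 1 then - \<i> * G i 2
    else (G i 0 + \<i> * G i 1) / 2)" for i and a :: nat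
  have "(\<Sum>a<3. F i a * E a j) = (\<Sum>a<3. G i a * R a j)" for i j
    by (simp add: sum_less_3 F_def E_def field_simps)
  moreover have "(E 0 i * E 2 j + E 2 i * E 0 j) / 2 - E 1 i * E 1 j = (\<Sum>a<3. R a i * R a j)" for i j
    by (simp add: sum_less_3 E_def field_simps)
  ultimately show thesis using that[of E F] R G by simp
qed

lemma sum_swap33:
  fixes g :: "'a \<Rightarrow> 'a \<Rightarrow> 'a \<Rightarrow> 'b \<Rightarrow> 'b \<Rightarrow> 'b \<Rightarrow> 'c :: comm_monoid_add"
  shows "(\<Sum>i\<in>A. \<Sum>j\<in>A. \<Sum>k\<in>A. \<Sum>a\<in>B. \<Sum>b\<in>B. \<Sum>c\<in>B. g i j k a b c) =
    (\<Sum>a\<in>B. \<Sum>b\<in>B. \<Sum>c\<in>B. \<Sum>i\<in>A. \<Sum>j\<in>A. \<Sum>k\<in>A. g i j k a b c)"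
  by (simp only: sum.swap[of _ B A])

text \<open>\<open>G\<close> is the polar tensor in the new coordinates. Apolarity to the normal
  form says \<open>G 0 2 c = G 1 1 c\<close>; with symmetry, an entry then depends only on the sum
  of its indices.\<close>

lemma apolar_imp_hankel:
  assumes q: "\<forall>i<3. \<forall>j<3. q i j = (E 0 i * E 2 j + E 2 i * E 0 j) / 2 - E 1 i * E 1 j"
    and F: "\<forall>i<3. \<forall>j<3. (\<Sum>a<3. F i a * E a j) = (if i = j then 1 else 0)"
    and f: "f \<in> S 2 3" and apolar: "\<forall>k<3. (\<Sum>i<3. \<Sum>j<3. q i j * polar f i j k) = 0"
  shows "\<exists>\<alpha>. f = hankel (\<lambda>a. linear_form (\<lambda>i. F i a)) \<alpha>"
proof -
  define l where "l a = linear_form (\<lambda>i. F i a)" for a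
  define G where "G a b c = (\<Sum>i<3. \<Sum>j<3. \<Sum>k<3. E a i * E b j * E c k * polar f i j k)" for a b c
  have var: "var i = (\<Sum>a<3. cscale (E a i) (l a))" if "i < 3" for i
  proof -
    have "(\<Sum>a<3. cscale (E a i) (l a)) = (\<Sum>a<3. \<Sum>j<3. cscale (F j a * E a i) (var j))"
      by (simp add: l_def linear_form_def cscale_sum_right mult.commute)
    also have "\<dots> = (\<Sum>j<3. \<Sum>a<3. cscale (F j a * E a i) (var j))" by (rule sum.swap)
    also have "\<dots> = (\<Sum>j<3. cscale (if j = i then 1 else 0) (var j))"
      using F that by (simp flip: cscale_sum_left)
    also have "\<dots> = (\<Sum>j<3. if j = i then var j else 0)" by (rule sum.cong) auto
    finally show ?thesis using that by simp
  qed
  have vars: "cscale p (var i * var j * var k) = (\<Sum>a<3. \<Sum>b<3. \<Sum>c<3.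
      cscale (E a i * E b j * E c k * p) (l a * l b * l c))" if "i < 3" "j < 3" "k < 3" for p i j k
    unfolding var[OF that(1)] var[OF that(2)] var[OF that(3)] sum_mult3 cscale_sum_right
    by (simp add: cscale_mult_left cscale_mult_right ac_simps)
  have "f = (\<Sum>i<3. \<Sum>j<3. \<Sum>k<3. cscale (polar f i j k / 6) (var i * var j * var k))"
    by (rule polar_expansion[OF f])
  also have "\<dots> = (\<Sum>i<3. \<Sum>j<3. \<Sum>k<3. \<Sum>a<3. \<Sum>b<3. \<Sum>c<3.
      cscale (E a i * E b j * E c k * polar f i j k / 6) (l a * l b * l c))"
    by (intro sum.cong refl) (simp add: vars)
  also have "\<dots> = (\<Sum>a<3. \<Sum>b<3. \<Sum>c<3. \<Sum>i<3. \<Sum>j<3. \<Sum>k<3.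
      cscale (E a i * E b j * E c k * polar f i j k / 6) (l a * l b * l c))"
    by (rule sum_swap33)
  also have "\<dots> = (\<Sum>a<3. \<Sum>b<3. \<Sum>c<3. cscale (G a b c / 6) (l a * l b * l c))"
    by (simp add: G_def sum_divide_distrib cscale_sum_left)
  finally have f_eq: "f = (\<Sum>a<3. \<Sum>b<3. \<Sum>c<3. cscale (G a b c / 6) (l a * l b * l c))" .
  have G12: "G a b c = G b a c" for a b c
    unfolding G_def by (subst sum.swap) (simp add: polar_commute(1) mult.commute[of "E b _"])
  have G23: "G a b c = G a c b" for a b c
    unfolding G_def
  proof (rule sum.cong[OF refl])
    fix i
    show "(\<Sum>j<3. \<Sum>k<3. E a i * E b j * E c k * polar f i j k) =
        (\<Sum>j<3. \<Sum>k<3. E a i * E c j * E b k * polar f i j k)"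
      by (subst sum.swap) (simp add: polar_commute(2)[of f i] ac_simps)
  qed
  have conic: "G 0 2 c = G 1 1 c" for c
  proof -
    have q': "(E 0 i * E 2 j * E c k * p + E 2 i * E 0 j * E c k * p) / 2 - E 1 i * E 1 j * E c k * p =
        E c k * (q i j * p)" if "i < 3" "j < 3" for i j k p
      unfolding q[rule_format, OF that] by (simp add: field_simps)
    have "(G 0 2 c + G 2 0 c) / 2 - G 1 1 c = (\<Sum>i<3. \<Sum>j<3. \<Sum>k<3. E c k * (q i j * polar f i j k))"
      unfolding G_def sum_divide_distrib sum.distrib[symmetric] sum_subtractf[symmetric]
      by (intro sum.cong refl q') auto
    also have "\<dots> = (\<Sum>k<3. \<Sum>i<3. \<Sum>j<3. E c k * (q i j * polar f i j k))"
      by (simp add: sum_less_3 ac_simps)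
    also have "\<dots> = (\<Sum>k<3. E c k * (\<Sum>i<3. \<Sum>j<3. q i j * polar f i j k))"
      by (simp add: sum_distrib_left)
    also have "\<dots> = 0" using apolar by simp
    finally show ?thesis using G12[of 2 0 c] by simp
  qed
  \<comment> \<open>One representative for each index sum from 0 to 6; the factor 6 comes from the
    polarisation.\<close>
  define \<alpha> where "\<alpha> m = [G 0 0 0, G 0 0 1, G 0 0 2, G 0 1 2, G 0 2 2, G 1 2 2, G 2 2 2] ! m / 6" for m
  have sort: "G (Suc 0) 0 k = G 0 (Suc 0) k" "G 2 0 k = G 0 2 k" "G 2 (Suc 0) k = G (Suc 0) 2 k"
    "G i (Suc 0) 0 = G i 0 (Suc 0)" "G i 2 0 = G i 0 2" "G i 2 (Suc 0) = G i (Suc 0) 2" for i k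
    by (rule G12 G23)+
  have sort': "G 0 (Suc 0) (Suc 0) = G 0 0 2" "G (Suc 0) (Suc 0) (Suc 0) = G 0 (Suc 0) 2"
    "G (Suc 0) (Suc 0) 2 = G 0 2 2"
    using conic[of 0] conic[of 1] conic[of 2] by (simp_all add: sort)
  have "\<forall>a<3. \<forall>b<3. \<forall>c<3. G a b c / 6 = \<alpha> (a + b + c)"
    unfolding all_less_3 by (intro conjI; simp add: \<alpha>_def numeral_eq_Suc
      sort[unfolded numeral_2_eq_2] sort'[unfolded numeral_2_eq_2])
  then have "f = hankel l \<alpha>"
    unfolding hankel_def by (subst f_eq) (intro sum.cong refl, simp)
  then show ?thesis unfolding l_def[abs_def] by blast
qed

lemma coordinate_system_linear_forms:
  assumes F: "\<forall>i<3. \<forall>j<3. (\<Sum>a<3. F i a * E a j) = (if i = j then 1 else 0)"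
  shows "coordinate_system (\<lambda>a. linear_form (\<lambda>i. F i a))"
  unfolding coordinate_system_def
proof (intro conjI allI impI linear_form_in_S exI)
  fix z :: "nat \<Rightarrow> complex" and a :: nat assume a: "a < 3"
  let ?y = "\<lambda>i. \<Sum>b<3. E b i * z b"
  have "peval ?y (linear_form (\<lambda>i. F i a)) = (\<Sum>i<3. \<Sum>b<3. E b i * F i a * z b)"
    by (simp add: linear_form_def peval_sum peval_cscale var_def sum_distrib_left ac_simps)
  also have "\<dots> = (\<Sum>b<3. \<Sum>i<3. E b i * F i a * z b)" by (rule sum.swap)
  also have "\<dots> = (\<Sum>b<3. (if b = a then 1 else 0) * z b)"
    using left_inverse_imp_right_inverse[of 3 F E _ a] F a by (simp flip: sum_distrib_right)
  also have "\<dots> = (\<Sum>b<3. if b = a then z b else 0)" by (rule sum.cong) auto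
  finally show "peval ?y (linear_form (\<lambda>i. F i a)) = z a" using a by simp
qed

section \<open>The catalecticant of a pencil of cubics\<close>

text \<open>
  The columns of the catalecticant are indexed by the monomials of a dual conic in the order
  \<open>x\<^sub>0\<^sup>2, x\<^sub>0x\<^sub>1, x\<^sub>0x\<^sub>2, x\<^sub>1\<^sup>2, x\<^sub>1x\<^sub>2, x\<^sub>2\<^sup>2\<close>, its rows by the coefficients of the two linear
  forms that this conic produces from the cubics by differentiation.
\<close>

definition col_fst :: "nat \<Rightarrow> nat" where "col_fst c = [0, 0, 0, 1, 1, 2] ! c"

definition col_snd :: "nat \<Rightarrow> nat" where "col_snd c = [0, 1, 2, 1, 2, 2] ! c"

definition col_of :: "nat \<Rightarrow> nat \<Rightarrow> nat" where
  "col_of i j = (if i = 0 \<or> j = 0 then i + j else i + j + 1)"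

text \<open>The symmetric matrix of the conic with coefficient vector \<open>v\<close>; mixed
  coefficients are halved since they occur twice in the double sum.\<close>

definition conic_matrix :: "(nat \<Rightarrow> complex) \<Rightarrow> nat \<Rightarrow> nat \<Rightarrow> complex" where
  "conic_matrix v i j = (if i = j then 1 else 1 / 2) * v (col_of i j)"

lemma col_of_simps:
  "col_of 0 0 = 0" "col_of 0 (Suc 0) = 1" "col_of 0 2 = 2" "col_of (Suc 0) (Suc 0) = 3"
  "col_of (Suc 0) 2 = 4" "col_of 2 2 = 5" "col_of (Suc 0) 0 = 1" "col_of 2 0 = 2" "col_of 2 (Suc 0) = 4"
  by (simp_all add: col_of_def)

lemma conic_matrix_commute: "conic_matrix v i j = conic_matrix v j i"
  by (auto simp: conic_matrix_def col_of_def add.commute)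

lemma lessThan_6: "{..<6::nat} = {0, 1, 2, 3, 4, 5}"
  by auto

lemma col_less: "c < 6 \<Longrightarrow> col_fst c < 3" "c < 6 \<Longrightarrow> col_snd c < 3"
proof -
  have "\<forall>c\<in>{..<6}. col_fst c < 3 \<and> col_snd c < 3"
    unfolding lessThan_6 by (simp add: col_fst_def col_snd_def)
  then show "c < 6 \<Longrightarrow> col_fst c < 3" "c < 6 \<Longrightarrow> col_snd c < 3" by auto
qed

lemma sum_conic:
  fixes g :: "nat \<Rightarrow> nat \<Rightarrow> complex"
  assumes "\<And>i j. g i j = g j i"
  shows "(\<Sum>c<6. g (col_fst c) (col_snd c) * v c) = (\<Sum>i<3. \<Sum>j<3. conic_matrix v i j * g i j)"
  unfolding lessThan_6 sum_less_3 using assms[of 1 0] assms[of 2 0] assms[of 2 1]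
  by (simp add: col_fst_def col_snd_def conic_matrix_def col_of_simps field_simps)

definition polar_at :: "(coord \<Rightarrow> complex) \<Rightarrow> bool \<Rightarrow> nat \<Rightarrow> nat \<Rightarrow> nat \<Rightarrow> complex" where
  "polar_at \<xi> b i j k = weight3 i j k * \<xi> (b, monom3 i j k)"

lemma polar_form_of:
  "i < 3 \<Longrightarrow> j < 3 \<Longrightarrow> k < 3 \<Longrightarrow> polar (cubic.form_of \<xi> b) i j k = polar_at \<xi> b i j k"
  by (simp add: polar_def polar_at_def cubic.lookup_form_of monom3_in)

definition catalecticant :: "(coord \<Rightarrow> complex) \<Rightarrow> complex Matrix.mat" where
  "catalecticant \<xi> = Matrix.mat 6 6 (\<lambda>(r, c). polar_at \<xi> (3 \<le> r) (col_fst c) (col_snd c) (r mod 3))"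

lemma catalecticant_carrier: "catalecticant \<xi> \<in> carrier_mat 6 6"
  by (simp add: catalecticant_def)

lemma catalecticant_index:
  "r < 6 \<Longrightarrow> c < 6 \<Longrightarrow>
    catalecticant \<xi> $$ (r, c) = polar_at \<xi> (3 \<le> r) (col_fst c) (col_snd c) (r mod 3)"
  by (simp add: catalecticant_def)

lemma polyfun_catalecticant:
  "r < 6 \<Longrightarrow> c < 6 \<Longrightarrow> polyfun cubic.coords (\<lambda>\<xi>. catalecticant \<xi> $$ (r, c))"
  by (simp add: catalecticant_index polar_at_def)
     (intro polyfun_cmult polyfun_var, simp add: monom3_in col_less)

subsection \<open>Expansion along the first row\<close>

abbreviation (input) pivot :: coord where "pivot \<equiv> (False, monom3 0 0 0)"

text \<open>The cube of the first variable arises only from the column of its square and the row of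
  its first derivative, so the pivot enters the matrix at the corner alone.\<close>

lemma catalecticant_indep:
  assumes "r < 6" "c < 6" "0 < r \<or> 0 < c"
  shows "catalecticant (\<xi>(pivot := z)) $$ (r, c) = catalecticant \<xi> $$ (r, c)"
proof -
  have *: "\<forall>r\<in>{..<6}. \<forall>c\<in>{..<6}. 0 < r \<or> 0 < c \<longrightarrow>
      3 \<le> r \<or> 4 ^ col_fst c + 4 ^ col_snd c + 4 ^ (r mod 3) \<noteq> 4 ^ 0 + 4 ^ 0 + (4 ^ 0 :: nat)"
    unfolding lessThan_6 by (simp add: col_fst_def col_snd_def)
  have "3 \<le> r \<or> monom3 (col_fst c) (col_snd c) (r mod 3) \<noteq> monom3 0 0 0"
  proof -
    have iff: "monom3 (col_fst c) (col_snd c) (r mod 3) = monom3 0 0 0 \<longleftrightarrow>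
        4 ^ col_fst c + 4 ^ col_snd c + 4 ^ (r mod 3) = 4 ^ 0 + 4 ^ 0 + (4 ^ 0 :: nat)"
      by (rule monom3_eq_iff) (use assms col_less in auto)
    show ?thesis unfolding iff using * assms by blast
  qed
  then show ?thesis using assms by (auto simp: catalecticant_index polar_at_def)
qed

text \<open>The first column of the adjugate: it is annihilated by all rows but the first, and by
  the first as well once the determinant vanishes. This makes the kernel conic polynomial in
  \<open>\<xi>\<close> and independent of the pivot.\<close>

definition conic_of :: "(coord \<Rightarrow> complex) \<Rightarrow> nat \<Rightarrow> complex" where
  "conic_of \<xi> c = cofactor (catalecticant \<xi>) 0 c"

lemma polyfun_conic_of: "c < 6 \<Longrightarrow> polyfun cubic.coords (\<lambda>\<xi>. conic_of \<xi> c)"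
  unfolding conic_of_def cofactor_def
proof (intro polyfun_cmult polyfun_det[of _ 5])
  show "mat_delete (catalecticant \<xi>) 0 c \<in> carrier_mat 5 5" for \<xi>
    by (simp add: mat_delete_def carrier_matD[OF catalecticant_carrier])
  fix i j :: nat assume "c < 6" "i < 5" "j < 5"
  moreover from this have "polyfun cubic.coords
      (\<lambda>\<xi>. catalecticant \<xi> $$ (Suc i, if j < c then j else Suc j))"
    by (intro polyfun_catalecticant) auto
  ultimately show "polyfun cubic.coords (\<lambda>\<xi>. mat_delete (catalecticant \<xi>) 0 c $$ (i, j))"
    by (simp add: mat_delete_def carrier_matD[OF catalecticant_carrier])
qed

lemma conic_of_indep: "c < 6 \<Longrightarrow> conic_of (\<xi>(pivot := z)) c = conic_of \<xi> c"
proof -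
  assume "c < 6"
  have "mat_delete (catalecticant (\<xi>(pivot := z))) 0 c = mat_delete (catalecticant \<xi>) 0 c"
    using catalecticant_indep[of _ _ \<xi> z]
    by (intro eq_matI) (auto simp: mat_delete_def carrier_matD[OF catalecticant_carrier])
  then show ?thesis by (simp add: conic_of_def cofactor_def)
qed

lemma catalecticant_conic_of:
  assumes "r < 6"
  shows "(\<Sum>c<6. catalecticant \<xi> $$ (r, c) * conic_of \<xi> c) =
    (if r = 0 then Determinant.det (catalecticant \<xi>) else 0)"
proof -
  let ?M = "catalecticant \<xi>"
  note d = carrier_matD[OF catalecticant_carrier, of \<xi>]
  have "(?M * adj_mat ?M) $$ (r, 0) = (Determinant.det ?M \<cdot>\<^sub>m 1\<^sub>m 6) $$ (r, 0)"
    by (simp add: adj_mat(2)[OF catalecticant_carrier])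
  then show ?thesis
    using assms by (simp add: adj_mat_def scalar_prod_def d conic_of_def lessThan_atLeast0)
qed

definition cat_lin :: "(coord \<Rightarrow> complex) \<Rightarrow> complex" where
  "cat_lin \<xi> = 6 * conic_of \<xi> 0"

definition cat_const :: "(coord \<Rightarrow> complex) \<Rightarrow> complex" where
  "cat_const \<xi> = (\<Sum>c\<in>{1..<6}. catalecticant \<xi> $$ (0, c) * conic_of \<xi> c)"

lemma det_catalecticant:
  "Determinant.det (catalecticant \<xi>) = cat_lin \<xi> * \<xi> pivot + cat_const \<xi>"
proof -
  have "{..<6::nat} = insert 0 {1..<6}" by auto
  moreover have "catalecticant \<xi> $$ (0, 0) = 6 * \<xi> pivot"
    by (simp add: catalecticant_index polar_at_def col_fst_def col_snd_def weight3_def)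
  ultimately show ?thesis
    using catalecticant_conic_of[of 0 \<xi>] by (simp add: cat_lin_def cat_const_def ac_simps)
qed

lemma cat_lin: "polyfun cubic.coords cat_lin" "indep_of pivot cat_lin"
  unfolding cat_lin_def[abs_def]
  by (intro polyfun_cmult polyfun_conic_of, simp) (simp add: indep_of_def conic_of_indep)

lemma cat_const: "polyfun cubic.coords cat_const" "indep_of pivot cat_const"
proof -
  show "polyfun cubic.coords cat_const"
    unfolding cat_const_def[abs_def]
    by (intro polyfun_intros polyfun_conic_of polyfun_catalecticant) auto
  show "indep_of pivot cat_const"
    unfolding cat_const_def[abs_def] indep_of_def
    by (intro allI sum.cong refl) (simp add: conic_of_indep catalecticant_indep)
qed

subsection \<open>Conics through five points\<close>

lemma conic_through_points:
  fixes p :: "nat \<Rightarrow> nat \<Rightarrow> complex"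
  obtains v where "v \<in> carrier_vec 6" "v \<noteq> 0\<^sub>v 6"
    "\<And>s. s < 5 \<Longrightarrow> (\<Sum>c<6. p s (col_fst c) * p s (col_snd c) * v $ c) = 0"
proof -
  \<comment> \<open>the fifth row is repeated to make the matrix square\<close>
  define B where "B = Matrix.mat 6 6 (\<lambda>(r, c). p (min r 4) (col_fst c) * p (min r 4) (col_snd c))"
  have B: "B \<in> carrier_mat 6 6" by (simp add: B_def)
  have "Determinant.det B = 0"
    by (rule det_identical_rows[OF B, of 4 5]) (auto simp: B_def)
  then obtain v where v: "v \<in> carrier_vec 6" "v \<noteq> 0\<^sub>v 6" "B *\<^sub>v v = 0\<^sub>v 6"
    using det_0_iff_vec_prod_zero_field[OF B] by blast
  have "(\<Sum>c<6. p s (col_fst c) * p s (col_snd c) * v $ c) = 0" if "s < 5" for s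
  proof -
    have "(B *\<^sub>v v) $ s = 0" using v(3) that by simp
    then show ?thesis
      using that v(1) by (simp add: B_def scalar_prod_def lessThan_atLeast0)
  qed
  then show thesis using that v by blast
qed

text \<open>Contracting the cube of \<open>linear_form c\<close> with a conic \<open>v\<close> gives
  6 times the value of \<open>v\<close> at \<open>c\<close> times \<open>c\<close> itself. The conic
  through the five points therefore kills their cubes and, by linearity, both forms of the pencil:
  it is a kernel vector.\<close>

lemma Sigma_imp_det_0:
  assumes "cubic.pencil \<xi> \<in> Sigma_var 2 3 2 5"
  shows "Determinant.det (catalecticant \<xi>) = 0"
proof -
  obtain Q where Q: "Q \<subseteq> S 2 1" "finite Q" "card Q = 5"
    and span: "cubic.pencil \<xi> \<subseteq> cpoly.span ((\<lambda>q. q ^ 3) ` Q)"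
    using assms by (auto simp: Sigma_var_def U_def)
  obtain h where h: "bij_betw h {0..<5::nat} Q"
    using ex_bij_betw_nat_finite[OF Q(2)] Q(3) by auto
  have "\<exists>c. h s = linear_form c" if "s < 5" for s
  proof -
    have "h s \<in> S 2 1" using Q(1) h that by (auto simp: bij_betw_def simp del: One_nat_def)
    then show ?thesis by (rule linear_formE) blast
  qed
  then obtain p where p: "\<And>s. s < 5 \<Longrightarrow> h s = linear_form (p s)" by metis
  obtain v where v: "v \<in> carrier_vec 6" "v \<noteq> 0\<^sub>v 6"
    "\<And>s. s < 5 \<Longrightarrow> (\<Sum>c<6. p s (col_fst c) * p s (col_snd c) * v $ c) = 0"
    using conic_through_points[of p] by metis
  define T where "T k f = (\<Sum>c<6. polar f (col_fst c) (col_snd c) k * v $ c)" for k f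
  have "cpoly.span ((\<lambda>q. q ^ 3) ` Q) \<subseteq> {f. T k f = 0}" if k: "k < 3" for k
  proof (rule cpoly.span_minimal)
    show "cpoly.subspace {f. T k f = 0}"
      by (rule cpoly.subspaceI)
         (simp_all add: T_def polar_def lookup_add lookup_cscale distrib_left distrib_right
           sum.distrib mult.left_commute[of _ "_ :: complex"] mult.assoc flip: sum_distrib_left)
    show "(\<lambda>q. q ^ 3) ` Q \<subseteq> {f. T k f = 0}"
    proof clarify
      fix q assume "q \<in> Q"
      then obtain s where s: "s < 5" "q = linear_form (p s)"
        using h p by (auto simp: bij_betw_def)
      have "T k (q ^ 3) = (\<Sum>c<6. 6 * p s k * (p s (col_fst c) * p s (col_snd c) * v $ c))"
        unfolding T_def s(2) using k
        by (intro sum.cong refl) (simp add: polar_linear_form_cube col_less)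
      also have "\<dots> = 0" using v(3)[OF s(1)] by (simp flip: sum_distrib_left)
      finally show "T k (q ^ 3) = 0" .
    qed
  qed
  moreover have "cubic.form_of \<xi> b \<in> cubic.pencil \<xi>" for b
    unfolding cubic.pencil_def by (cases b) (auto intro: cpoly.span_base)
  ultimately have T: "T k (cubic.form_of \<xi> b) = 0" if "k < 3" for k b
    using span that by blast
  have "catalecticant \<xi> *\<^sub>v v = 0\<^sub>v 6"
  proof (rule eq_vecI)
    fix r assume "r < dim_vec (0\<^sub>v 6 :: complex Matrix.vec)"
    then have r: "r < 6" by simp
    have "(catalecticant \<xi> *\<^sub>v v) $ r = (\<Sum>c<6. catalecticant \<xi> $$ (r, c) * v $ c)"
      using r v(1) by (simp add: scalar_prod_def carrier_matD[OF catalecticant_carrier] lessThan_atLeast0)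
    also have "\<dots> = T (r mod 3) (cubic.form_of \<xi> (3 \<le> r))"
      unfolding T_def using r
      by (intro sum.cong refl) (simp add: catalecticant_index polar_form_of col_less)
    finally show "(catalecticant \<xi> *\<^sub>v v) $ r = 0\<^sub>v 6 $ r" using T r by simp
  qed (simp add: carrier_matD[OF catalecticant_carrier])
  then show ?thesis
    using det_0_iff_vec_prod_zero_field[OF catalecticant_carrier] v by blast
qed

subsection \<open>A pencil with a smooth apolar conic\<close>

text \<open>
  Both \<open>xyz\<close> and the second cubic are apolar to the dual conic \<open>x\<^sup>2 + y\<^sup>2 + z\<^sup>2\<close>, and to no other
  conic simultaneously.
\<close>

definition base_point :: "coord \<Rightarrow> complex" where
  "base_point = (\<lambda>(b, m). if b then
     (if m = monom3 0 1 1 then 3 else if m = monom3 0 2 2 then - 3 else if m = monom3 1 1 1 then 1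
      else if m = monom3 1 2 2 then 3 else if m = monom3 0 0 1 then - 6 else 0)
     else if m = monom3 0 1 2 then 1 else 0)"

lemma base_point_in_chart: "base_point \<in> cubic.chart_points"
  unfolding cubic.chart_points_def
  by (simp add: base_point_def monom_xyz_def monom_yyy_def monom3_eq_iff)

lemma base_point_rows:
  "\<forall>c\<in>{..<6}. catalecticant base_point $$ (0, c) = [0, 0, 0, 0, 1, 0] ! c"
  "\<forall>c\<in>{..<6}. catalecticant base_point $$ (1, c) = [0, 0, 1, 0, 0, 0] ! c"
  "\<forall>c\<in>{..<6}. catalecticant base_point $$ (2, c) = [0, 1, 0, 0, 0, 0] ! c"
  "\<forall>c\<in>{..<6}. catalecticant base_point $$ (3, c) = [0, - 12, 0, 6, 0, - 6] ! c"
  "\<forall>c\<in>{..<6}. catalecticant base_point $$ (4, c) = [- 12, 6, 0, 6, 0, 6] ! c"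
  "\<forall>c\<in>{..<6}. catalecticant base_point $$ (5, c) = [0, 0, - 6, 0, 6, 0] ! c"
  unfolding lessThan_6
  by (simp_all add: catalecticant_index polar_at_def base_point_def col_fst_def col_snd_def
      weight3_def monom3_eq_iff)

text \<open>The cofactors are not computed. One of them is nonzero since its minor has trivial
  kernel; the determinant is zero, so the cofactor vector lies in the kernel of all six rows, and
  these determine it up to scaling.\<close>

lemma base_point_conic:
  "conic_of base_point 0 \<noteq> 0" "conic_of base_point 1 = 0" "conic_of base_point 2 = 0"
  "conic_of base_point 3 = conic_of base_point 0" "conic_of base_point 4 = 0"
  "conic_of base_point 5 = conic_of base_point 0"
proof -
  let ?M = "catalecticant base_point" and ?q = "conic_of base_point"
  note rows = base_point_rows[unfolded lessThan_6, simplified]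
  have M: "?M \<in> carrier_mat 6 6" by (rule catalecticant_carrier)
  show "?q 0 \<noteq> 0"
  proof
    let ?D = "mat_delete ?M 0 0"
    have D: "?D \<in> carrier_mat 5 5" using M by (simp add: mat_delete_def)
    have D_index: "?D $$ (r, c) = ?M $$ (Suc r, Suc c)" if "r < 5" "c < 5" for r c
      using that by (simp add: mat_delete_def carrier_matD[OF M])
    assume "?q 0 = 0"
    then have "Determinant.det ?D = 0" by (simp add: conic_of_def cofactor_def)
    then obtain v where v: "v \<in> carrier_vec 5" "v \<noteq> 0\<^sub>v 5" "?D *\<^sub>v v = 0\<^sub>v 5"
      using det_0_iff_vec_prod_zero_field[OF D] by blast
    have eq: "(\<Sum>c\<in>{0, 1, 2, 3, 4}. ?M $$ (Suc r, Suc c) * v $ c) = 0" if "r < 5" for r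
    proof -
      have "(?D *\<^sub>v v) $ r = 0" using v(3) that by simp
      moreover have "{0..<5::nat} = {0, 1, 2, 3, 4}" by auto
      ultimately show ?thesis
        using that v(1) carrier_matD[OF D] by (simp add: scalar_prod_def D_index)
    qed
    have "v $ 1 = 0" "v $ 0 = 0" using eq[of 0] eq[of 1] rows by (simp_all add: numeral_eq_Suc)
    moreover have "v $ 2 = 0" "v $ 4 = 0" "v $ 3 = 0"
      using eq[of 2] eq[of 3] eq[of 4] rows calculation by (simp_all add: numeral_eq_Suc)
    ultimately have "v = 0\<^sub>v 5"
      using v(1) by (intro eq_vecI) (auto simp: less_Suc_eq numeral_eq_Suc)
    then show False using v(2) by simp
  qed
  have "Determinant.det ?M = 0"
  proof -
    \<comment> \<open>The coefficients of x^2 + y^2 + z^2 in the column order.\<close>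
    define v where "v = Matrix.vec 6 (\<lambda>c. [1, 0, 0, 1, 0, 1 :: complex] ! c)"
    have v: "v \<in> carrier_vec 6" "v \<noteq> 0\<^sub>v 6"
    proof -
      have "v $ 0 \<noteq> 0\<^sub>v 6 $ 0" by (simp add: v_def)
      then show "v \<noteq> 0\<^sub>v 6" by auto
    qed (simp add: v_def)
    have "?M *\<^sub>v v = 0\<^sub>v 6"
    proof (rule eq_vecI)
      fix r assume "r < dim_vec (0\<^sub>v 6 :: complex Matrix.vec)"
      then have r: "r < 6" by simp
      have "(?M *\<^sub>v v) $ r = (\<Sum>c<6. ?M $$ (r, c) * [1, 0, 0, 1, 0, 1] ! c)"
        using r by (simp add: scalar_prod_def carrier_matD[OF M] lessThan_atLeast0 v_def)
      also have "\<dots> = 0"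
      proof -
        have "\<forall>r\<in>{..<6}. (\<Sum>c<6. ?M $$ (r, c) * [1, 0, 0, 1, 0, 1] ! c) = 0"
          unfolding lessThan_6 using rows by simp
        then show ?thesis using r by blast
      qed
      finally show "(?M *\<^sub>v v) $ r = 0\<^sub>v 6 $ r" using r by simp
    qed (simp add: carrier_matD[OF M])
    then show ?thesis using det_0_iff_vec_prod_zero_field[OF M] v by blast
  qed
  then have eq: "(\<Sum>c<6. ?M $$ (r, c) * ?q c) = 0" if "r < 6" for r
    using catalecticant_conic_of[OF that, of base_point] by simp
  note eqs = eq[of 0] eq[of 1] eq[of 2] eq[of 3] eq[of 4] eq[of 5]
  show q1: "?q 1 = 0" and "?q 2 = 0" and "?q 4 = 0"
    using eqs rows unfolding lessThan_6 by simp_all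
  moreover have "?q 3 = ?q 5" using eqs(4) rows q1 unfolding lessThan_6 by simp
  ultimately show "?q 3 = ?q 0" "?q 5 = ?q 0"
    using eqs(5) rows unfolding lessThan_6 by (simp_all add: algebra_simps)
qed

section \<open>Codimension of the variety\<close>

text \<open>With \<open>conic_of \<xi> 0\<close> and \<open>conic_det\<close> these are the leading
  minors that \<open>conic_coordinates\<close> requires to be nonzero.\<close>

definition conic_minor2 :: "(coord \<Rightarrow> complex) \<Rightarrow> complex" where
  "conic_minor2 \<xi> = (let q = conic_matrix (conic_of \<xi>) in q 0 0 * q 1 1 - q 0 1 ^ 2)"

definition conic_det :: "(coord \<Rightarrow> complex) \<Rightarrow> complex" where
  "conic_det \<xi> = (let q = conic_matrix (conic_of \<xi>) in
     q 0 0 * (q 1 1 * q 2 2 - q 1 2 ^ 2) - q 0 1 * (q 0 1 * q 2 2 - q 1 2 * q 0 2) +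
     q 0 2 * (q 0 1 * q 1 2 - q 1 1 * q 0 2))"

lemma Sigma_dense:
  assumes P: "polyfun cubic.coords P" and indep: "indep_of pivot P"
    and vanish: "\<And>\<eta>. \<eta> \<in> cubic.chart_points \<Longrightarrow> cubic.pencil \<eta> \<in> Sigma_var 2 3 2 5 \<Longrightarrow> P \<eta> = 0"
    and xi: "\<xi> \<in> cubic.chart_points"
  shows "P \<xi> = 0"
proof -
  \<comment> \<open>Arbitrary Hankel pairs are not normalised, so a function vanishing on the
    variety off the chart as well is needed.\<close>
  obtain P' where P': "polyfun cubic.coords P'" "\<forall>\<xi>\<in>cubic.chart_points. P' \<xi> = P \<xi>"
    "\<forall>\<xi>. cubic.minor \<xi> = 0 \<or> cubic.pencil \<xi> \<in> Sigma_var 2 3 2 5 \<longrightarrow> P' \<xi> = 0"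
    using cubic.extend_vanishing[OF P vanish] .
  define W where "W = (\<lambda>\<xi>. conic_of \<xi> 0 * conic_minor2 \<xi> * conic_det \<xi>)"
  have W: "polyfun cubic.coords W"
    unfolding W_def conic_minor2_def conic_det_def Let_def conic_matrix_def
    by (intro polyfun_intros polyfun_conic_of) (simp_all add: col_of_def)
  have "P \<xi> = 0" if xi: "\<xi> \<in> cubic.chart_points" and nz: "W \<xi> \<noteq> 0" for \<xi>
  proof -
    let ?q = "conic_matrix (conic_of \<xi>)"
    \<comment> \<open>Moving the pivot to the root of the determinant changes neither
      \<open>P\<close> nor the conic.\<close>
    define \<zeta> where "\<zeta> = \<xi>(pivot := - cat_const \<xi> / cat_lin \<xi>)"
    have zeta: "\<zeta> \<in> cubic.chart_points"
      using xi unfolding cubic.chart_points_def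
      by (simp add: \<zeta>_def monom_xyz_def monom_yyy_def monom3_eq_iff)
    have "conic_of \<xi> 0 \<noteq> 0" using nz by (simp add: W_def)
    then have "Determinant.det (catalecticant \<zeta>) = 0"
      unfolding det_catalecticant \<zeta>_def
      by (simp add: indep_ofD[OF cat_lin(2)] indep_ofD[OF cat_const(2)]) (simp add: cat_lin_def)
    then have ker: "(\<Sum>c<6. catalecticant \<zeta> $$ (r, c) * conic_of \<xi> c) = 0" if "r < 6" for r
      using catalecticant_conic_of[OF that, of \<zeta>] by (simp add: \<zeta>_def conic_of_indep)
    have apolar: "(\<Sum>i<3. \<Sum>j<3. ?q i j * polar (cubic.form_of \<zeta> b) i j k) = 0" if "k < 3" for b k
    proof -
      let ?r = "(if b then 3 else 0) + k"
      have r: "?r < 6" "(3 \<le> ?r) = b" "?r mod 3 = k" using that by auto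
      have "(\<Sum>i<3. \<Sum>j<3. ?q i j * polar (cubic.form_of \<zeta> b) i j k) =
          (\<Sum>c<6. polar (cubic.form_of \<zeta> b) (col_fst c) (col_snd c) k * conic_of \<xi> c)"
        by (rule sum_conic[symmetric]) (rule polar_commute)
      also have "\<dots> = (\<Sum>c<6. catalecticant \<zeta> $$ (?r, c) * conic_of \<xi> c)"
        using that r by (intro sum.cong refl)
          (simp only: catalecticant_index polar_form_of col_less lessThan_iff)
      finally show ?thesis using ker[OF r(1)] by simp
    qed
    obtain E F :: "nat \<Rightarrow> nat \<Rightarrow> complex" where
      E: "\<forall>i<3. \<forall>j<3. ?q i j = (E 0 i * E 2 j + E 2 i * E 0 j) / 2 - E 1 i * E 1 j" and
      F: "\<forall>i<3. \<forall>j<3. (\<Sum>a<3. F i a * E a j) = (if i = j then 1 else 0)"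
    proof (rule conic_coordinates[of ?q])
      show "?q i j = ?q j i" for i j by (rule conic_matrix_commute)
      show "?q 0 0 \<noteq> 0" using nz by (simp add: W_def conic_matrix_def col_of_def)
      show "?q 0 0 * ?q 1 1 - ?q 0 1 ^ 2 \<noteq> 0"
        using nz by (simp add: W_def conic_minor2_def Let_def)
      show "?q 0 0 * (?q 1 1 * ?q 2 2 - ?q 1 2 ^ 2) - ?q 0 1 * (?q 0 1 * ?q 2 2 - ?q 1 2 * ?q 0 2) +
          ?q 0 2 * (?q 0 1 * ?q 1 2 - ?q 1 1 * ?q 0 2) \<noteq> 0"
        using nz by (simp add: W_def conic_det_def Let_def)
    qed
    let ?l = "\<lambda>a. linear_form (\<lambda>i. F i a)"
    have "\<exists>\<alpha>. cubic.form_of \<zeta> b = hankel ?l \<alpha>" for b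
      using apolar by (intro apolar_imp_hankel[OF E F cubic.form_of_in_S]) blast
    then obtain \<alpha> where \<alpha>: "\<And>b. cubic.form_of \<zeta> b = hankel ?l (\<alpha> b)" by metis
    \<comment> \<open>The two points need to agree only on the coordinates that polynomial functions
      read.\<close>
    have "\<zeta> i = hankel_pair ?l (\<lambda>(b, j). \<alpha> b j) i" if "i \<in> cubic.coords" for i
    proof (cases i)
      case (Pair b m)
      then show ?thesis
        using that by (simp add: hankel_pair_def flip: \<alpha>) (simp add: cubic.lookup_form_of)
    qed
    then have "P' \<zeta> = P' (hankel_pair ?l (\<lambda>(b, j). \<alpha> b j))"
      by (rule polyfun_cong[OF P'(1)])
    also have "\<dots> = 0"
      by (rule vanish_hankel_pair[OF coordinate_system_linear_forms[OF F] P'(1,3)])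
    finally show ?thesis
      using P'(2) zeta indep_ofD[OF indep, of \<xi>] by (simp add: \<zeta>_def)
  qed
  then have "W \<xi> * P \<xi> = 0" if "\<xi> \<in> cubic.chart_points" for \<xi>
    using that by auto
  \<comment> \<open>Here the conic is a nonzero multiple of x^2 + y^2 + z^2, so its matrix is scalar
    and all leading minors are nonzero.\<close>
  moreover have "W base_point \<noteq> 0"
    using base_point_conic
    by (simp add: W_def conic_minor2_def conic_det_def conic_matrix_def col_of_simps power2_eq_square)
  ultimately show ?thesis
    using polyfun_integral[OF cubic.line_closed_chart_points W P _ base_point_in_chart _ xi] by blast
qed

theorem theorem4p1:
  shows "codimension (zariski_Gr 2 3 2) (Sigma_var 2 3 2 5) = 1
    \<and> N1 2 2 5 = 16 \<and> N2 2 3 2 = 16"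
proof (intro conjI)
  show "codimension (zariski_Gr 2 3 2) (Sigma_var 2 3 2 5) = 1"
  proof (rule cubic.codimension_eq_1[where a = pivot and A = cat_lin and B = cat_const
        and ?\<xi>0.0 = base_point])
    show "Sigma_var 2 3 2 5 \<subseteq> Gr 2 (S 2 3)" by (auto simp: Sigma_var_def)
    show "pivot \<in> cubic.coords" by (simp add: monom3_in)
    show "snd pivot \<notin> {monom_xyz, monom_yyy}"
      by (simp add: monom_xyz_def monom_yyy_def monom3_eq_iff)
    show "cat_lin \<xi> * \<xi> pivot + cat_const \<xi> = 0" if "cubic.pencil \<xi> \<in> Sigma_var 2 3 2 5" for \<xi>
      using Sigma_imp_det_0[OF that] by (simp add: det_catalecticant)
    show "cat_lin base_point \<noteq> 0" using base_point_conic(1) by (simp add: cat_lin_def)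
  qed (use Sigma_dense in \<open>blast intro: cat_lin cat_const base_point_in_chart\<close>)+
  show "N1 2 2 5 = 16" by (simp add: N1_def)
  have "(5 choose 3) = (10 :: nat)" by (simp add: numeral_eq_Suc)
  then show "N2 2 3 2 = 16" by (simp add: N2_def)
qed

end
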